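(* Let $\mathcal{A}$ be a rigid abelian $\otimes$-category and let $\mathbf{U}$ be the set of subobjects of $\mathbf{1}$. For a Serre $\otimes$-ideal $\mathcal{I}$ of $\mathcal{A}$ put $\Phi(\mathcal{I})=\mathcal{I}\cap\mathbf{U}$ (a cofilter of $\mathbf{U}$), and for a cofilter $\Phi$ of $\mathbf{U}$ let $\mathcal{I}(\Phi)$ be the full subcategory $\{A\in\mathcal{A}\mid \operatorname{Supp}(A)\in\Phi\}$ (a Serre $\otimes$-ideal of $\mathcal{A}$). Then the maps $\mathcal{I}\mapsto\Phi(\mathcal{I})$ and $\Phi\mapsto\mathcal{I}(\Phi)$ are mutually inverse bijections. Moreover there is a one-to-one correspondence between Serre $\otimes$-ideals of $\mathcal{A}$ and ideals of the ring $Z(\mathcal{A})=\operatorname{End}_{\mathcal{A}}(\mathbf{1})$.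
   Context: A $\otimes$-category is an additive symmetric monoidal category with unit $\mathbf{1}$ and biadditive tensor product; it is rigid if every object has a dual. A rigid abelian $\otimes$-category is a rigid $\otimes$-category whose underlying category is abelian. A Serre $\otimes$-ideal $\mathcal{I}$ of $\mathcal{A}$ is a Serre subcategory of $\mathcal{A}$ such that $A\otimes B\in\mathcal{I}$ for all $A\in\mathcal{A}$, $B\in\mathcal{I}$. A cofilter of $\mathbf{U}$ is a subset of $\mathbf{U}$ stable under (finite) sums and subobjects, i.e. a filter for the order opposite to inclusion. For $A\in\mathcal{A}$, the support $\operatorname{Supp}(A)\in\mathbf{U}$ is the image, viewed as a subobject of $\mathbf{1}$, of the morphism $\mathbf{1}\to A^\vee\otimes A$ adjoint to $1_A$; more precisely, every $U\in\mathbf{U}$ has a unique complement $U^\perp$, so that $\mathbf{1}=U\oplus U^\perp$, and $\operatorname{Supp}(A)=\operatorname{Ker}(\mathbf{1}\to A^\vee\otimes A)^\perp$. Equivalently $\operatorname{Supp}(A)$ is the smallest $U\in\mathbf{U}$ with $U^\perp\otimes A=0$. *)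

theory Defs
  imports "HOL-Algebra.Ideal"
begin

(* The data of a preadditive category with a tensor product.  The hom sets
   {f \<in> arr C. src C f = a \<and> tgt C f = b} are disjoint by construction, so a single
   composition and a single addition on arrows suffice. *)
record ('o, 'm) tensor_cat =
  obj :: "'o set"
  arr :: "'m set"
  src :: "'m \<Rightarrow> 'o"
  tgt :: "'m \<Rightarrow> 'o"
  idt :: "'o \<Rightarrow> 'm"
  comp :: "'m \<Rightarrow> 'm \<Rightarrow> 'm"  (infixr "\<cdot>\<index>" 75)  (* g \<cdot> f is "g after f" *)
  plus_arr :: "'m \<Rightarrow> 'm \<Rightarrow> 'm"  (infixl "\<boxplus>\<index>" 65)
  zero_arr :: "'o \<Rightarrow> 'o \<Rightarrow> 'm"
  tens_obj :: "'o \<Rightarrow> 'o \<Rightarrow> 'o"  (infixr "\<otimes>\<^sub>o\<index>" 80)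
  tens_arr :: "'m \<Rightarrow> 'm \<Rightarrow> 'm"  (infixr "\<otimes>\<^sub>a\<index>" 80)
  unit_obj :: "'o"
  assoc :: "'o \<Rightarrow> 'o \<Rightarrow> 'o \<Rightarrow> 'm"  (* (a \<otimes> b) \<otimes> c \<rightarrow> a \<otimes> (b \<otimes> c) *)
  lunit :: "'o \<Rightarrow> 'm"  (* 1 \<otimes> a \<rightarrow> a *)
  runit :: "'o \<Rightarrow> 'm"  (* a \<otimes> 1 \<rightarrow> a *)
  swap :: "'o \<Rightarrow> 'o \<Rightarrow> 'm"  (* a \<otimes> b \<rightarrow> b \<otimes> a *)

definition homset :: "('o, 'm, 'x) tensor_cat_scheme \<Rightarrow> 'o \<Rightarrow> 'o \<Rightarrow> 'm set" where
  "homset C a b = {f \<in> arr C. src C f = a \<and> tgt C f = b}"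

definition hom_group :: "('o, 'm, 'x) tensor_cat_scheme \<Rightarrow> 'o \<Rightarrow> 'o \<Rightarrow> 'm monoid" where
  "hom_group C a b = \<lparr>carrier = homset C a b, mult = plus_arr C, one = zero_arr C a b\<rparr>"

definition end_ring :: "('o, 'm, 'x) tensor_cat_scheme \<Rightarrow> 'o \<Rightarrow> 'm ring" where
  "end_ring C a = \<lparr>carrier = homset C a a, mult = comp C, one = idt C a,
                   zero = zero_arr C a a, add = plus_arr C\<rparr>"

definition inverse_arrs :: "('o, 'm, 'x) tensor_cat_scheme \<Rightarrow> 'm \<Rightarrow> 'm \<Rightarrow> bool" where
  "inverse_arrs C f g \<longleftrightarrow> f \<in> arr C \<and> g \<in> homset C (tgt C f) (src C f) \<and>
     g \<cdot>\<^bsub>C\<^esub> f = idt C (src C f) \<and> f \<cdot>\<^bsub>C\<^esub> g = idt C (tgt C f)"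

definition iso_arr :: "('o, 'm, 'x) tensor_cat_scheme \<Rightarrow> 'm \<Rightarrow> bool" where
  "iso_arr C f \<longleftrightarrow> (\<exists>g. inverse_arrs C f g)"

definition inv_arr :: "('o, 'm, 'x) tensor_cat_scheme \<Rightarrow> 'm \<Rightarrow> 'm" where
  "inv_arr C f = (THE g. inverse_arrs C f g)"

definition mono_arr :: "('o, 'm, 'x) tensor_cat_scheme \<Rightarrow> 'm \<Rightarrow> bool" where
  "mono_arr C m \<longleftrightarrow> m \<in> arr C \<and>
     (\<forall>f\<in>arr C. \<forall>g\<in>arr C. src C f = src C g \<longrightarrow> tgt C f = src C m \<longrightarrow> tgt C g = src C m \<longrightarrow>
        m \<cdot>\<^bsub>C\<^esub> f = m \<cdot>\<^bsub>C\<^esub> g \<longrightarrow> f = g)"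

definition epi_arr :: "('o, 'm, 'x) tensor_cat_scheme \<Rightarrow> 'm \<Rightarrow> bool" where
  "epi_arr C e \<longleftrightarrow> e \<in> arr C \<and>
     (\<forall>f\<in>arr C. \<forall>g\<in>arr C. tgt C f = tgt C g \<longrightarrow> src C f = tgt C e \<longrightarrow> src C g = tgt C e \<longrightarrow>
        f \<cdot>\<^bsub>C\<^esub> e = g \<cdot>\<^bsub>C\<^esub> e \<longrightarrow> f = g)"

definition zero_obj :: "('o, 'm, 'x) tensor_cat_scheme \<Rightarrow> 'o \<Rightarrow> bool" where
  "zero_obj C z \<longleftrightarrow> z \<in> obj C \<and>
     (\<forall>a\<in>obj C. (\<exists>!f. f \<in> homset C z a) \<and> (\<exists>!f. f \<in> homset C a z))"

definition biproduct ::
  "('o, 'm, 'x) tensor_cat_scheme \<Rightarrow> 'o \<Rightarrow> 'o \<Rightarrow> 'o \<Rightarrow> 'm \<Rightarrow> 'm \<Rightarrow> 'm \<Rightarrow> 'm \<Rightarrow> bool" where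
  "biproduct C a b s i j p q \<longleftrightarrow>
     i \<in> homset C a s \<and> j \<in> homset C b s \<and> p \<in> homset C s a \<and> q \<in> homset C s b \<and>
     p \<cdot>\<^bsub>C\<^esub> i = idt C a \<and> q \<cdot>\<^bsub>C\<^esub> j = idt C b \<and>
     p \<cdot>\<^bsub>C\<^esub> j = zero_arr C b a \<and> q \<cdot>\<^bsub>C\<^esub> i = zero_arr C a b \<and>
     (i \<cdot>\<^bsub>C\<^esub> p) \<boxplus>\<^bsub>C\<^esub> (j \<cdot>\<^bsub>C\<^esub> q) = idt C s"

definition is_kernel :: "('o, 'm, 'x) tensor_cat_scheme \<Rightarrow> 'm \<Rightarrow> 'm \<Rightarrow> bool" where
  "is_kernel C k f \<longleftrightarrow> f \<in> arr C \<and> k \<in> arr C \<and> tgt C k = src C f \<and>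
     f \<cdot>\<^bsub>C\<^esub> k = zero_arr C (src C k) (tgt C f) \<and>
     (\<forall>g\<in>arr C. tgt C g = src C f \<longrightarrow> f \<cdot>\<^bsub>C\<^esub> g = zero_arr C (src C g) (tgt C f) \<longrightarrow>
        (\<exists>!h. h \<in> homset C (src C g) (src C k) \<and> k \<cdot>\<^bsub>C\<^esub> h = g))"

definition is_cokernel :: "('o, 'm, 'x) tensor_cat_scheme \<Rightarrow> 'm \<Rightarrow> 'm \<Rightarrow> bool" where
  "is_cokernel C c f \<longleftrightarrow> f \<in> arr C \<and> c \<in> arr C \<and> src C c = tgt C f \<and>
     c \<cdot>\<^bsub>C\<^esub> f = zero_arr C (src C f) (tgt C c) \<and>
     (\<forall>g\<in>arr C. src C g = tgt C f \<longrightarrow> g \<cdot>\<^bsub>C\<^esub> f = zero_arr C (src C f) (tgt C g) \<longrightarrow>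
        (\<exists>!h. h \<in> homset C (tgt C c) (tgt C g) \<and> h \<cdot>\<^bsub>C\<^esub> c = g))"

definition is_image :: "('o, 'm, 'x) tensor_cat_scheme \<Rightarrow> 'm \<Rightarrow> 'm \<Rightarrow> bool" where
  "is_image C m f \<longleftrightarrow> (\<exists>c. is_cokernel C c f \<and> is_kernel C m c)"

(* 0 \<rightarrow> src f \<rightarrow> tgt f = src g \<rightarrow> tgt g \<rightarrow> 0 is exact *)
definition short_exact :: "('o, 'm, 'x) tensor_cat_scheme \<Rightarrow> 'm \<Rightarrow> 'm \<Rightarrow> bool" where
  "short_exact C f g \<longleftrightarrow> is_kernel C f g \<and> is_cokernel C g f"

locale category =
  fixes C :: "('o, 'm, 'x) tensor_cat_scheme" (structure)
  assumes src_obj: "f \<in> arr C \<Longrightarrow> src C f \<in> obj C"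
    and tgt_obj: "f \<in> arr C \<Longrightarrow> tgt C f \<in> obj C"
    and idt_hom: "a \<in> obj C \<Longrightarrow> idt C a \<in> homset C a a"
    and comp_hom: "\<lbrakk>f \<in> homset C a b; g \<in> homset C b c\<rbrakk> \<Longrightarrow> g \<cdot> f \<in> homset C a c"
    and comp_idt: "f \<in> homset C a b \<Longrightarrow> f \<cdot> idt C a = f"
    and idt_comp: "f \<in> homset C a b \<Longrightarrow> idt C b \<cdot> f = f"
    and comp_assoc: "\<lbrakk>f \<in> homset C a b; g \<in> homset C b c; h \<in> homset C c d\<rbrakk>
                       \<Longrightarrow> (h \<cdot> g) \<cdot> f = h \<cdot> (g \<cdot> f)"

locale additive_category = category +
  assumes hom_comm_group: "\<lbrakk>a \<in> obj C; b \<in> obj C\<rbrakk> \<Longrightarrow> comm_group (hom_group C a b)"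
    and comp_plus: "\<lbrakk>f \<in> homset C a b; f' \<in> homset C a b; g \<in> homset C b c\<rbrakk>
                      \<Longrightarrow> g \<cdot> (f \<boxplus> f') = (g \<cdot> f) \<boxplus> (g \<cdot> f')"
    and plus_comp: "\<lbrakk>f \<in> homset C a b; g \<in> homset C b c; g' \<in> homset C b c\<rbrakk>
                      \<Longrightarrow> (g \<boxplus> g') \<cdot> f = (g \<cdot> f) \<boxplus> (g' \<cdot> f)"
    and zero_obj_exists: "\<exists>z. zero_obj C z"
    and biproduct_exists: "\<lbrakk>a \<in> obj C; b \<in> obj C\<rbrakk> \<Longrightarrow> \<exists>s i j p q. biproduct C a b s i j p q"

locale abelian_category = additive_category +
  assumes kernel_exists: "f \<in> arr C \<Longrightarrow> \<exists>k. is_kernel C k f"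
    and cokernel_exists: "f \<in> arr C \<Longrightarrow> \<exists>c. is_cokernel C c f"
    and mono_normal: "mono_arr C m \<Longrightarrow> \<exists>f. is_kernel C m f"
    and epi_normal: "epi_arr C e \<Longrightarrow> \<exists>f. is_cokernel C e f"

locale symmetric_monoidal_category = category +
  assumes tens_obj_closed: "\<lbrakk>a \<in> obj C; b \<in> obj C\<rbrakk> \<Longrightarrow> a \<otimes>\<^sub>o b \<in> obj C"
    and unit_obj_closed: "unit_obj C \<in> obj C"
    and tens_hom: "\<lbrakk>f \<in> homset C a b; g \<in> homset C c d\<rbrakk>
                     \<Longrightarrow> f \<otimes>\<^sub>a g \<in> homset C (a \<otimes>\<^sub>o c) (b \<otimes>\<^sub>o d)"
    and tens_idt: "\<lbrakk>a \<in> obj C; b \<in> obj C\<rbrakk> \<Longrightarrow> idt C a \<otimes>\<^sub>a idt C b = idt C (a \<otimes>\<^sub>o b)"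
    and interchange: "\<lbrakk>f \<in> homset C a b; f' \<in> homset C b c; g \<in> homset C a' b'; g' \<in> homset C b' c'\<rbrakk>
                        \<Longrightarrow> (f' \<cdot> f) \<otimes>\<^sub>a (g' \<cdot> g) = (f' \<otimes>\<^sub>a g') \<cdot> (f \<otimes>\<^sub>a g)"
    and assoc_hom: "\<lbrakk>a \<in> obj C; b \<in> obj C; c \<in> obj C\<rbrakk>
                      \<Longrightarrow> assoc C a b c \<in> homset C ((a \<otimes>\<^sub>o b) \<otimes>\<^sub>o c) (a \<otimes>\<^sub>o (b \<otimes>\<^sub>o c))"
    and assoc_iso: "\<lbrakk>a \<in> obj C; b \<in> obj C; c \<in> obj C\<rbrakk> \<Longrightarrow> iso_arr C (assoc C a b c)"
    and assoc_natural: "\<lbrakk>f \<in> homset C a a'; g \<in> homset C b b'; h \<in> homset C c c'\<rbrakk>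
                          \<Longrightarrow> assoc C a' b' c' \<cdot> ((f \<otimes>\<^sub>a g) \<otimes>\<^sub>a h)
                            = (f \<otimes>\<^sub>a (g \<otimes>\<^sub>a h)) \<cdot> assoc C a b c"
    and lunit_hom: "a \<in> obj C \<Longrightarrow> lunit C a \<in> homset C (unit_obj C \<otimes>\<^sub>o a) a"
    and lunit_iso: "a \<in> obj C \<Longrightarrow> iso_arr C (lunit C a)"
    and lunit_natural: "f \<in> homset C a b
                          \<Longrightarrow> lunit C b \<cdot> (idt C (unit_obj C) \<otimes>\<^sub>a f) = f \<cdot> lunit C a"
    and runit_hom: "a \<in> obj C \<Longrightarrow> runit C a \<in> homset C (a \<otimes>\<^sub>o unit_obj C) a"
    and runit_iso: "a \<in> obj C \<Longrightarrow> iso_arr C (runit C a)"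
    and runit_natural: "f \<in> homset C a b
                          \<Longrightarrow> runit C b \<cdot> (f \<otimes>\<^sub>a idt C (unit_obj C)) = f \<cdot> runit C a"
    and swap_hom: "\<lbrakk>a \<in> obj C; b \<in> obj C\<rbrakk> \<Longrightarrow> swap C a b \<in> homset C (a \<otimes>\<^sub>o b) (b \<otimes>\<^sub>o a)"
    and swap_natural: "\<lbrakk>f \<in> homset C a a'; g \<in> homset C b b'\<rbrakk>
                         \<Longrightarrow> swap C a' b' \<cdot> (f \<otimes>\<^sub>a g) = (g \<otimes>\<^sub>a f) \<cdot> swap C a b"
    and swap_swap: "\<lbrakk>a \<in> obj C; b \<in> obj C\<rbrakk> \<Longrightarrow> swap C b a \<cdot> swap C a b = idt C (a \<otimes>\<^sub>o b)"
    and pentagon: "\<lbrakk>a \<in> obj C; b \<in> obj C; c \<in> obj C; d \<in> obj C\<rbrakk>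
                     \<Longrightarrow> (idt C a \<otimes>\<^sub>a assoc C b c d) \<cdot> (assoc C a (b \<otimes>\<^sub>o c) d \<cdot> (assoc C a b c \<otimes>\<^sub>a idt C d))
                       = assoc C a b (c \<otimes>\<^sub>o d) \<cdot> assoc C (a \<otimes>\<^sub>o b) c d"
    and triangle: "\<lbrakk>a \<in> obj C; b \<in> obj C\<rbrakk>
                     \<Longrightarrow> (idt C a \<otimes>\<^sub>a lunit C b) \<cdot> assoc C a (unit_obj C) b = runit C a \<otimes>\<^sub>a idt C b"
    and hexagon: "\<lbrakk>a \<in> obj C; b \<in> obj C; c \<in> obj C\<rbrakk>
                    \<Longrightarrow> assoc C b c a \<cdot> (swap C a (b \<otimes>\<^sub>o c) \<cdot> assoc C a b c)
                      = (idt C b \<otimes>\<^sub>a swap C a c) \<cdot> (assoc C b a c \<cdot> (swap C a b \<otimes>\<^sub>a idt C c))"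

locale tensor_category = additive_category + symmetric_monoidal_category +
  assumes tens_plus: "\<lbrakk>f \<in> homset C a b; g \<in> homset C c d; g' \<in> homset C c d\<rbrakk>
                        \<Longrightarrow> f \<otimes>\<^sub>a (g \<boxplus> g') = (f \<otimes>\<^sub>a g) \<boxplus> (f \<otimes>\<^sub>a g')"
    and plus_tens: "\<lbrakk>f \<in> homset C a b; f' \<in> homset C a b; g \<in> homset C c d\<rbrakk>
                        \<Longrightarrow> (f \<boxplus> f') \<otimes>\<^sub>a g = (f \<otimes>\<^sub>a g) \<boxplus> (f' \<otimes>\<^sub>a g)"

(* b is a dual of a.  The unit goes 1 \<rightarrow> b \<otimes> a and the counit a \<otimes> b \<rightarrow> 1, so that the unit is the
   arrow adjoint to the identity of a under Hom(a, a) = Hom(1, b \<otimes> a).  Starting instead from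
   1 \<rightarrow> a \<otimes> b and b \<otimes> a \<rightarrow> 1, one obtains these by composing with the symmetry. *)
definition is_dual ::
  "('o, 'm, 'x) tensor_cat_scheme \<Rightarrow> 'o \<Rightarrow> 'o \<Rightarrow> 'm \<Rightarrow> 'm \<Rightarrow> bool" where
  "is_dual C a b \<eta> \<epsilon> \<longleftrightarrow> a \<in> obj C \<and> b \<in> obj C \<and>
     \<eta> \<in> homset C (unit_obj C) (b \<otimes>\<^sub>o\<^bsub>C\<^esub> a) \<and> \<epsilon> \<in> homset C (a \<otimes>\<^sub>o\<^bsub>C\<^esub> b) (unit_obj C) \<and>
     lunit C a \<cdot>\<^bsub>C\<^esub> (\<epsilon> \<otimes>\<^sub>a\<^bsub>C\<^esub> idt C a) \<cdot>\<^bsub>C\<^esub> inv_arr C (assoc C a b a) \<cdot>\<^bsub>C\<^esub> (idt C a \<otimes>\<^sub>a\<^bsub>C\<^esub> \<eta>)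
       = runit C a \<and>
     runit C b \<cdot>\<^bsub>C\<^esub> (idt C b \<otimes>\<^sub>a\<^bsub>C\<^esub> \<epsilon>) \<cdot>\<^bsub>C\<^esub> assoc C b a b \<cdot>\<^bsub>C\<^esub> (\<eta> \<otimes>\<^sub>a\<^bsub>C\<^esub> idt C b)
       = lunit C b"

locale rigid_abelian_tensor_category = tensor_category + abelian_category +
  assumes dual_exists: "a \<in> obj C \<Longrightarrow> \<exists>b \<eta> \<epsilon>. is_dual C a b \<eta> \<epsilon>"

definition factors_through :: "('o, 'm, 'x) tensor_cat_scheme \<Rightarrow> 'm \<Rightarrow> 'm \<Rightarrow> bool" where
  "factors_through C m n \<longleftrightarrow> (\<exists>h \<in> homset C (src C m) (src C n). m = n \<cdot>\<^bsub>C\<^esub> h)"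

definition monos_into :: "('o, 'm, 'x) tensor_cat_scheme \<Rightarrow> 'o \<Rightarrow> 'm set" where
  "monos_into C x = {m. mono_arr C m \<and> tgt C m = x}"

definition subobj_class :: "('o, 'm, 'x) tensor_cat_scheme \<Rightarrow> 'm \<Rightarrow> 'm set" where
  "subobj_class C m =
     {n \<in> monos_into C (tgt C m). factors_through C m n \<and> factors_through C n m}"

(* Subobjects of x are equivalence classes of monomorphisms into x. *)
definition subobjects :: "('o, 'm, 'x) tensor_cat_scheme \<Rightarrow> 'o \<Rightarrow> 'm set set" where
  "subobjects C x = subobj_class C ` monos_into C x"

definition subobj_le :: "('o, 'm, 'x) tensor_cat_scheme \<Rightarrow> 'm set \<Rightarrow> 'm set \<Rightarrow> bool" where
  "subobj_le C u v \<longleftrightarrow> (\<exists>m\<in>u. \<exists>n\<in>v. factors_through C m n)"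

(* w is the sum of the family S of subobjects of x: the smallest subobject containing
   all of them; for S = {} this is the zero subobject. *)
definition is_subobj_sum ::
  "('o, 'm, 'x) tensor_cat_scheme \<Rightarrow> 'o \<Rightarrow> 'm set set \<Rightarrow> 'm set \<Rightarrow> bool" where
  "is_subobj_sum C x S w \<longleftrightarrow> w \<in> subobjects C x \<and> (\<forall>u\<in>S. subobj_le C u w) \<and>
     (\<forall>v\<in>subobjects C x. (\<forall>u\<in>S. subobj_le C u v) \<longrightarrow> subobj_le C w v)"

(* x is the (internal) direct sum of its subobjects u and v *)
definition complementary ::
  "('o, 'm, 'x) tensor_cat_scheme \<Rightarrow> 'o \<Rightarrow> 'm set \<Rightarrow> 'm set \<Rightarrow> bool" where
  "complementary C x u v \<longleftrightarrow> u \<in> subobjects C x \<and> v \<in> subobjects C x \<and>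
     (\<exists>i\<in>u. \<exists>j\<in>v. \<exists>p q. biproduct C (src C i) (src C j) x i j p q)"

(* Supp(a) is the complement of the kernel of 1 \<rightarrow> a^* \<otimes> a, for any choice of dual a^*. *)
definition Supp :: "('o, 'm, 'x) tensor_cat_scheme \<Rightarrow> 'o \<Rightarrow> 'm set" where
  "Supp C a = (THE s. \<exists>b \<eta> \<epsilon> k. is_dual C a b \<eta> \<epsilon> \<and> is_kernel C k \<eta> \<and>
                        complementary C (unit_obj C) (subobj_class C k) s)"

(* Full subcategories are represented by their sets of objects. *)
definition serre_subcategory :: "('o, 'm, 'x) tensor_cat_scheme \<Rightarrow> 'o set \<Rightarrow> bool" where
  "serre_subcategory C I \<longleftrightarrow> I \<subseteq> obj C \<and> I \<noteq> {} \<and>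
     (\<forall>f g. short_exact C f g \<longrightarrow> (src C g \<in> I \<longleftrightarrow> src C f \<in> I \<and> tgt C g \<in> I))"

definition serre_tensor_ideal :: "('o, 'm, 'x) tensor_cat_scheme \<Rightarrow> 'o set \<Rightarrow> bool" where
  "serre_tensor_ideal C I \<longleftrightarrow> serre_subcategory C I \<and>
     (\<forall>a\<in>obj C. \<forall>b\<in>I. a \<otimes>\<^sub>o\<^bsub>C\<^esub> b \<in> I)"

(* Taking S = {} below, a cofilter contains the zero subobject, hence is nonempty. *)
definition cofilter :: "('o, 'm, 'x) tensor_cat_scheme \<Rightarrow> 'm set set \<Rightarrow> bool" where
  "cofilter C \<Phi> \<longleftrightarrow> \<Phi> \<subseteq> subobjects C (unit_obj C) \<and>
     (\<forall>S w. finite S \<longrightarrow> S \<subseteq> \<Phi> \<longrightarrow> is_subobj_sum C (unit_obj C) S w \<longrightarrow> w \<in> \<Phi>) \<and>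
     (\<forall>u\<in>\<Phi>. \<forall>v\<in>subobjects C (unit_obj C). subobj_le C v u \<longrightarrow> v \<in> \<Phi>)"

(* The subobjects of 1 that belong to I.  Their representatives have isomorphic sources and
   Serre subcategories are closed under isomorphism, so one representative decides. *)
definition cofilter_of :: "('o, 'm, 'x) tensor_cat_scheme \<Rightarrow> 'o set \<Rightarrow> 'm set set" where
  "cofilter_of C I = {u \<in> subobjects C (unit_obj C). \<exists>m\<in>u. src C m \<in> I}"

definition serre_ideal_of :: "('o, 'm, 'x) tensor_cat_scheme \<Rightarrow> 'm set set \<Rightarrow> 'o set" where
  "serre_ideal_of C \<Phi> = {a \<in> obj C. Supp C a \<in> \<Phi>}"

(* The ring Z(C) = End(1), and the endomorphisms of 1 whose image belongs to I. *)
abbreviation Z_ring :: "('o, 'm, 'x) tensor_cat_scheme \<Rightarrow> 'm ring" where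
  "Z_ring C \<equiv> end_ring C (unit_obj C)"

definition Z_ideal_of :: "('o, 'm, 'x) tensor_cat_scheme \<Rightarrow> 'o set \<Rightarrow> 'm set" where
  "Z_ideal_of C I =
     {z \<in> homset C (unit_obj C) (unit_obj C). \<exists>m. is_image C m z \<and> src C m \<in> I}"

end

theory Submission
  imports Defs
begin

text \<open>
  Rigidity forces every monomorphism \<open>u : U \<rightarrow> \<bbbone>\<close> to split.  With \<open>q : \<bbbone> \<rightarrow> V\<close> its cokernel,
  \<open>q \<otimes> U\<close> followed by the monomorphism \<open>V \<otimes> u\<close> is \<open>q \<otimes> u = 0\<close>, so \<open>q \<otimes> U = 0\<close>; as \<open>U\<^sup>*\<close> is a
  retract of \<open>U\<^sup>* \<otimes> U \<otimes> U\<^sup>*\<close>, also \<open>q \<otimes> U\<^sup>* = 0\<close>, and \<open>u \<otimes> U\<^sup>*\<close> is invertible.  By the adjunction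
  \<open>Hom(X \<otimes> U\<^sup>*, \<bbbone>) = Hom(X, U)\<close> every map \<open>U \<rightarrow> U\<close>, in particular the identity, extends along \<open>u\<close>.

  Hence subobjects of \<open>\<bbbone>\<close> are the idempotents of the commutative von Neumann regular ring
  \<open>Z = End(\<bbbone>)\<close>, and both cofilters and ideals of \<open>Z\<close> amount to ideals of the Boolean algebra of
  idempotents.  The annihilator in \<open>Z\<close> of an object \<open>a\<close> is generated by an idempotent, whose
  complement \<open>s\<close> cuts out \<open>Supp(a)\<close>; an object belongs to a Serre tensor ideal iff the image of \<open>s\<close>
  does.
\<close>

section \<open>Categories, additive and abelian categories\<close>

text \<open>The unit is special because, for \<open>f\<close> ending and \<open>g\<close> starting
  at \<bbbone>, \<open>g \<otimes> f\<close> is \<open>g \<cdot> f\<close> up to isomorphisms on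
  both sides; this is why a cokernel \<open>q\<close> of \<open>u\<close> satisfies
  \<open>q \<otimes> u = 0\<close>. The exactness of the tensor product that enters is preservation
  of monomorphisms, which the adjunction provides.

  Coherence computations are the main obstacle. The triangle composites of the adjunction,
  identities by coherence, are only shown to be isomorphisms; an inverse is inserted wherever an
  identity would be expected.

  Idempotents replace classes of monomorphisms because inclusion, complement and sum then become
  equations between elements of a commutative ring. The support is pinned down by an annihilator, in
  which no dual occurs, and this settles that \<open>Supp\<close> does not depend on the dual, the
  kernel or the complement. Idempotency also matters for extensions: an element killing both ends of
  a short exact sequence kills the middle only after squaring. Regularity of the ring is what lets
  an ideal be recovered from its idempotents.\<close>

context category
begin

lemma in_homset [simp]: "f \<in> homset C a b \<longleftrightarrow> f \<in> arr C \<and> src C f = a \<and> tgt C f = b"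
  by (auto simp: homset_def)

declare src_obj [simp] tgt_obj [simp]

lemma idt_simps [simp]:
  assumes "a \<in> obj C"
  shows "idt C a \<in> arr C" "src C (idt C a) = a" "tgt C (idt C a) = a"
  using idt_hom[OF assms] by auto

lemma comp_simps [simp]:
  assumes "f \<in> arr C" "g \<in> arr C" "tgt C f = src C g"
  shows "g \<cdot> f \<in> arr C" "src C (g \<cdot> f) = src C f" "tgt C (g \<cdot> f) = tgt C g"
  using comp_hom[of f "src C f" "src C g" g "tgt C g"] assms by auto

lemma comp_idt_simp [simp]: "\<lbrakk>f \<in> arr C; src C f = a\<rbrakk> \<Longrightarrow> f \<cdot> idt C a = f"
  using comp_idt[of f a "tgt C f"] by auto

lemma idt_comp_simp [simp]: "\<lbrakk>f \<in> arr C; tgt C f = a\<rbrakk> \<Longrightarrow> idt C a \<cdot> f = f"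
  using idt_comp[of f "src C f" a] by auto

lemma comp_assoc_simp [simp]:
  "\<lbrakk>f \<in> arr C; g \<in> arr C; h \<in> arr C; tgt C f = src C g; tgt C g = src C h\<rbrakk>
     \<Longrightarrow> (h \<cdot> g) \<cdot> f = h \<cdot> (g \<cdot> f)"
  using comp_assoc[of f "src C f" "src C g" g "src C h" h "tgt C h"] by auto

text \<open>The simplifier nests composites to the right, so \<open>g \<cdot> f\<close> is no longer
  a subterm once something precedes it. This and \<open>comp_rewrite\<close> restate an equation
  between composites in the nested form.\<close>

lemma comp_reduce:
  assumes "g \<cdot> f = h" "f \<in> arr C" "g \<in> arr C" "tgt C f = src C g" "k \<in> arr C" "tgt C k = src C f"
  shows "g \<cdot> (f \<cdot> k) = h \<cdot> k"
  using comp_assoc_simp[of k f g] assms by simp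

lemma comp_rewrite:
  assumes "g \<cdot> f = g' \<cdot> f'" "f \<in> arr C" "g \<in> arr C" "tgt C f = src C g"
    "f' \<in> arr C" "g' \<in> arr C" "tgt C f' = src C g'" "src C f' = src C f" "k \<in> arr C" "tgt C k = src C f"
  shows "g \<cdot> (f \<cdot> k) = g' \<cdot> (f' \<cdot> k)"
  using comp_reduce[of g f "g' \<cdot> f'" k] assms by simp

lemma inverse_arrs_unique:
  assumes "inverse_arrs C f g" "inverse_arrs C f h"
  shows "g = h"
proof -
  have "g = g \<cdot> (f \<cdot> h)"
    using assms by (auto simp: inverse_arrs_def)
  also have "\<dots> = (g \<cdot> f) \<cdot> h"
    using assms by (subst comp_assoc_simp) (auto simp: inverse_arrs_def)
  also have "\<dots> = h"
    using assms by (auto simp: inverse_arrs_def)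
  finally show ?thesis .
qed

lemma inv_arr_eq: "inverse_arrs C f g \<Longrightarrow> inv_arr C f = g"
  unfolding inv_arr_def by (rule the_equality) (auto dest: inverse_arrs_unique)

lemma inverse_arrs_inv_arr: "iso_arr C f \<Longrightarrow> inverse_arrs C f (inv_arr C f)"
  unfolding iso_arr_def using inv_arr_eq by blast

lemma iso_arr_arr: "iso_arr C f \<Longrightarrow> f \<in> arr C"
  by (auto simp: iso_arr_def inverse_arrs_def)

lemma inv_arr_simps [simp]:
  assumes "iso_arr C f"
  shows "inv_arr C f \<in> arr C" "src C (inv_arr C f) = tgt C f" "tgt C (inv_arr C f) = src C f"
    "inv_arr C f \<cdot> f = idt C (src C f)" "f \<cdot> inv_arr C f = idt C (tgt C f)"
  using inverse_arrs_inv_arr[OF assms] by (auto simp: inverse_arrs_def)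

lemma inv_arr_comp [simp]:
  assumes "iso_arr C f" "k \<in> arr C"
  shows "tgt C k = src C f \<Longrightarrow> inv_arr C f \<cdot> (f \<cdot> k) = k"
    "tgt C k = tgt C f \<Longrightarrow> f \<cdot> (inv_arr C f \<cdot> k) = k"
  using comp_reduce[OF inv_arr_simps(4)[OF assms(1)]] comp_reduce[OF inv_arr_simps(5)[OF assms(1)]]
    assms iso_arr_arr[OF assms(1)] by auto

lemma iso_arrI:
  assumes "f \<in> arr C" "g \<in> arr C" "src C g = tgt C f" "tgt C g = src C f"
    "g \<cdot> f = idt C (src C f)" "f \<cdot> g = idt C (tgt C f)"
  shows "iso_arr C f"
  using assms by (auto simp: iso_arr_def inverse_arrs_def)

lemma iso_arr_idt [simp]: "a \<in> obj C \<Longrightarrow> iso_arr C (idt C a)"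
  by (intro iso_arrI[of _ "idt C a"]) auto

lemma iso_arr_inv [simp]: "iso_arr C f \<Longrightarrow> iso_arr C (inv_arr C f)"
  using iso_arr_arr by (intro iso_arrI[of _ f]) auto

lemma iso_arr_comp [simp]:
  assumes "iso_arr C f" "iso_arr C g" "tgt C f = src C g"
  shows "iso_arr C (g \<cdot> f)"
  using assms iso_arr_arr by (intro iso_arrI[of _ "inv_arr C f \<cdot> inv_arr C g"]) auto

lemma mono_arrD:
  assumes "mono_arr C m" "m \<cdot> f = m \<cdot> g" "f \<in> arr C" "g \<in> arr C" "src C f = src C g"
    "tgt C f = src C m" "tgt C g = src C m"
  shows "f = g"
  using assms by (auto simp: mono_arr_def)

lemma mono_arr_arr: "mono_arr C m \<Longrightarrow> m \<in> arr C"
  by (auto simp: mono_arr_def)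

lemma iso_arr_cancel:
  assumes "iso_arr C m" "m \<cdot> f = m \<cdot> g" "f \<in> arr C" "g \<in> arr C"
    "tgt C f = src C m" "tgt C g = src C m"
  shows "f = g"
  using assms by (metis inv_arr_comp(1))

lemma mono_arr_cancel:
  assumes "mono_arr C (m \<cdot> f)" "f \<in> arr C" "m \<in> arr C" "tgt C f = src C m"
  shows "mono_arr C f"
  unfolding mono_arr_def
proof (intro conjI ballI impI)
  fix g h
  assume "g \<in> arr C" "h \<in> arr C" "src C g = src C h" "tgt C g = src C f" "tgt C h = src C f"
    "f \<cdot> g = f \<cdot> h"
  then show "g = h"
    using mono_arrD[OF assms(1), of g h] assms by simp
qed fact

lemma mono_arr_retract:
  assumes "p \<cdot> m = idt C (src C m)" "m \<in> arr C" "p \<in> arr C" "tgt C m = src C p"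
  shows "mono_arr C m"
  unfolding mono_arr_def
proof (intro conjI ballI impI)
  fix g h
  assume "g \<in> arr C" "h \<in> arr C" "src C g = src C h" "tgt C g = src C m" "tgt C h = src C m"
    "m \<cdot> g = m \<cdot> h"
  then show "g = h"
    using comp_assoc_simp[of g m p] comp_assoc_simp[of h m p] assms by (metis idt_comp_simp)
qed fact

lemma iso_arr_mono: "iso_arr C f \<Longrightarrow> mono_arr C f"
  using iso_arr_arr by (intro mono_arr_retract[of "inv_arr C f"]) auto

lemma mono_arr_comp:
  assumes "mono_arr C m" "mono_arr C n" "tgt C n = src C m"
  shows "mono_arr C (m \<cdot> n)"
  unfolding mono_arr_def
proof (intro conjI ballI impI)
  have arr: "m \<in> arr C" "n \<in> arr C"
    using assms mono_arr_arr by auto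
  then show "m \<cdot> n \<in> arr C"
    using assms by simp
  fix g h
  assume "g \<in> arr C" "h \<in> arr C" "src C g = src C h" "tgt C g = src C (m \<cdot> n)"
    "tgt C h = src C (m \<cdot> n)" "(m \<cdot> n) \<cdot> g = (m \<cdot> n) \<cdot> h"
  then show "g = h"
    using arr assms(3)
    by (intro mono_arrD[OF assms(2), of g h] mono_arrD[OF assms(1), of "n \<cdot> g" "n \<cdot> h"]) simp_all
qed

section \<open>Factorization of monomorphisms and subobject classes\<close>

lemma factors_throughE:
  assumes "factors_through C m n"
  obtains h where "h \<in> arr C" "src C h = src C m" "tgt C h = src C n" "m = n \<cdot> h"
  using assms by (auto simp: factors_through_def)

lemma factors_throughI:
  assumes "h \<in> arr C" "src C h = src C m" "tgt C h = src C n" "m = n \<cdot> h"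
  shows "factors_through C m n"
  using assms by (auto simp: factors_through_def)

lemma factors_through_refl: "k \<in> arr C \<Longrightarrow> factors_through C k k"
  by (rule factors_throughI[of "idt C (src C k)"]) auto

lemma factors_through_trans:
  assumes "factors_through C l m" "factors_through C m n" "n \<in> arr C"
  shows "factors_through C l n"
proof -
  obtain g where g: "g \<in> arr C" "src C g = src C l" "tgt C g = src C m" "l = m \<cdot> g"
    using assms(1) by (rule factors_throughE)
  obtain h where h: "h \<in> arr C" "src C h = src C m" "tgt C h = src C n" "m = n \<cdot> h"
    using assms(2) by (rule factors_throughE)
  have "l = (n \<cdot> h) \<cdot> g"
    using g(4) by (simp flip: h(4))
  then have "l = n \<cdot> (h \<cdot> g)"
    using g(1-3) h(1-3) assms(3) by simp
  then show ?thesis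
    using g(1-3) h(1-3) by (intro factors_throughI[of "h \<cdot> g"]) simp_all
qed

lemma subobj_class_self: "m \<in> monos_into C x \<Longrightarrow> m \<in> subobj_class C m"
  using factors_through_refl mono_arr_arr by (auto simp: subobj_class_def monos_into_def)

lemma subobj_class_eqI:
  assumes "m \<in> monos_into C x" "n \<in> subobj_class C m"
  shows "subobj_class C n = subobj_class C m"
  using assms factors_through_trans mono_arr_arr unfolding subobj_class_def monos_into_def
  by auto

lemma subobjects_class:
  assumes "S \<in> subobjects C x" "m \<in> S"
  shows "m \<in> monos_into C x" "S = subobj_class C m"
proof -
  obtain n where n: "n \<in> monos_into C x" "S = subobj_class C n"
    using assms(1) by (auto simp: subobjects_def)
  show "m \<in> monos_into C x"
    using assms(2) n by (auto simp: subobj_class_def monos_into_def)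
  show "S = subobj_class C m"
    using subobj_class_eqI[OF n(1)] assms(2) n(2) by blast
qed

end

context additive_category
begin

lemma zero_simps [simp]:
  assumes "a \<in> obj C" "b \<in> obj C"
  shows "zero_arr C a b \<in> arr C" "src C (zero_arr C a b) = a" "tgt C (zero_arr C a b) = b"
  using monoid.one_closed[OF group.is_monoid[OF comm_group.axioms(2)[OF hom_comm_group[OF assms]]]]
  by (auto simp: hom_group_def)

lemma plus_simps [simp]:
  assumes "f \<in> arr C" "g \<in> arr C" "src C f = src C g" "tgt C f = tgt C g"
  shows "f \<boxplus> g \<in> arr C" "src C (f \<boxplus> g) = src C g" "tgt C (f \<boxplus> g) = tgt C g"
  using monoid.m_closed[OF group.is_monoid[OF comm_group.axioms(2)[OF hom_comm_group[of "src C g" "tgt C g"]]], of f g]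
    assms
  by (auto simp: hom_group_def)

lemma plus_zero [simp]:
  assumes "f \<in> arr C" "src C f = a" "tgt C f = b"
  shows "f \<boxplus> zero_arr C a b = f" "zero_arr C a b \<boxplus> f = f"
  using monoid.r_one[OF group.is_monoid[OF comm_group.axioms(2)[OF hom_comm_group[of a b]]], of f]
    monoid.l_one[OF group.is_monoid[OF comm_group.axioms(2)[OF hom_comm_group[of a b]]], of f]
    assms src_obj[of f] tgt_obj[of f]
  by (auto simp: hom_group_def)

text \<open>Stands in for subtraction, which the category record does not carry: the inverse comes
  from the hom group.\<close>

lemma minus_exists:
  assumes "f \<in> arr C" "g \<in> arr C" "src C f = src C g" "tgt C f = tgt C g"
  obtains h where "h \<in> arr C" "src C h = src C g" "tgt C h = tgt C g" "f = g \<boxplus> h"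
proof -
  let ?G = "hom_group C (src C g) (tgt C g)"
  interpret comm_group ?G
    using assms by (intro hom_comm_group) auto
  have fg: "f \<in> carrier ?G" "g \<in> carrier ?G"
    using assms by (auto simp: hom_group_def)
  then have "inv\<^bsub>?G\<^esub> g \<otimes>\<^bsub>?G\<^esub> f \<in> carrier ?G" "f = g \<otimes>\<^bsub>?G\<^esub> (inv\<^bsub>?G\<^esub> g \<otimes>\<^bsub>?G\<^esub> f)"
    by (auto simp: m_assoc[symmetric])
  then show ?thesis
    by (intro that[of "inv\<^bsub>?G\<^esub> g \<otimes>\<^bsub>?G\<^esub> f"]) (auto simp: hom_group_def)
qed

lemma plus_cancel:
  assumes "f \<boxplus> g = f \<boxplus> h" "f \<in> arr C" "g \<in> arr C" "h \<in> arr C" "src C f = src C g" "tgt C f = tgt C g"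
    "src C f = src C h" "tgt C f = tgt C h"
  shows "g = h"
proof -
  let ?G = "hom_group C (src C f) (tgt C f)"
  interpret comm_group ?G
    using assms by (intro hom_comm_group) auto
  have "f \<in> carrier ?G" "g \<in> carrier ?G" "h \<in> carrier ?G" "f \<otimes>\<^bsub>?G\<^esub> g = f \<otimes>\<^bsub>?G\<^esub> h"
    using assms by (simp_all add: hom_group_def)
  then show ?thesis
    using Units_l_cancel[of f g h] Units_eq by blast
qed

lemma plus_cancel_zero:
  assumes "f \<boxplus> g = f" "f \<in> arr C" "g \<in> arr C" "src C f = src C g" "tgt C f = tgt C g"
  shows "g = zero_arr C (src C g) (tgt C g)"
  using assms by (intro plus_cancel[of f g]) auto

lemma comp_plus_simp:
  assumes "f \<in> arr C" "f' \<in> arr C" "g \<in> arr C" "src C f = src C f'" "tgt C f = tgt C f'" "tgt C f' = src C g"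
  shows "g \<cdot> (f \<boxplus> f') = (g \<cdot> f) \<boxplus> (g \<cdot> f')"
  using comp_plus[of f "src C f'" "src C g" f' g "tgt C g"] assms by auto

lemma plus_comp_simp:
  assumes "f \<in> arr C" "g \<in> arr C" "g' \<in> arr C" "src C g = src C g'" "tgt C g = tgt C g'" "tgt C f = src C g'"
  shows "(g \<boxplus> g') \<cdot> f = (g \<cdot> f) \<boxplus> (g' \<cdot> f)"
  using plus_comp[of f "src C f" "src C g'" g "tgt C g'" g'] assms by auto

lemma zero_comp [simp]:
  assumes "f \<in> arr C" "tgt C f = b" "c \<in> obj C"
  shows "zero_arr C b c \<cdot> f = zero_arr C (src C f) c"
proof -
  have b: "b \<in> obj C"
    using assms by auto
  have "zero_arr C b c \<cdot> f \<boxplus> zero_arr C b c \<cdot> f = zero_arr C b c \<cdot> f"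
    using assms b by (simp flip: plus_comp_simp)
  then show ?thesis
    using plus_cancel_zero assms b by fastforce
qed

lemma comp_zero [simp]:
  assumes "f \<in> arr C" "src C f = b" "a \<in> obj C"
  shows "f \<cdot> zero_arr C a b = zero_arr C a (tgt C f)"
proof -
  have b: "b \<in> obj C"
    using assms by auto
  have "f \<cdot> zero_arr C a b \<boxplus> f \<cdot> zero_arr C a b = f \<cdot> zero_arr C a b"
    using assms b by (simp flip: comp_plus_simp)
  then show ?thesis
    using plus_cancel_zero assms b by fastforce
qed

lemma mono_arrI_zero:
  assumes "m \<in> arr C"
    and "\<And>f. \<lbrakk>f \<in> arr C; tgt C f = src C m; m \<cdot> f = zero_arr C (src C f) (tgt C m)\<rbrakk>
           \<Longrightarrow> f = zero_arr C (src C f) (src C m)"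
  shows "mono_arr C m"
  unfolding mono_arr_def
proof (intro conjI ballI impI)
  fix f g
  assume fg: "f \<in> arr C" "g \<in> arr C" "src C f = src C g" "tgt C f = src C m" "tgt C g = src C m"
    "m \<cdot> f = m \<cdot> g"
  obtain h where h: "h \<in> arr C" "src C h = src C g" "tgt C h = tgt C g" "f = g \<boxplus> h"
    using fg by (elim minus_exists[of f g]) auto
  have "m \<cdot> g \<boxplus> m \<cdot> h = m \<cdot> g"
    using h fg assms(1) by (simp flip: comp_plus_simp)
  then have "m \<cdot> h = zero_arr C (src C h) (tgt C m)"
    using plus_cancel_zero[of "m \<cdot> g" "m \<cdot> h"] h fg assms(1) by simp
  then show "f = g"
    using assms(2)[of h] h fg by simp
qed fact

lemma epi_arrI_zero:
  assumes "e \<in> arr C"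
    and "\<And>f. \<lbrakk>f \<in> arr C; src C f = tgt C e; f \<cdot> e = zero_arr C (src C e) (tgt C f)\<rbrakk>
           \<Longrightarrow> f = zero_arr C (tgt C e) (tgt C f)"
  shows "epi_arr C e"
  unfolding epi_arr_def
proof (intro conjI ballI impI)
  fix f g
  assume fg: "f \<in> arr C" "g \<in> arr C" "tgt C f = tgt C g" "src C f = tgt C e" "src C g = tgt C e"
    "f \<cdot> e = g \<cdot> e"
  obtain h where h: "h \<in> arr C" "src C h = src C g" "tgt C h = tgt C g" "f = g \<boxplus> h"
    using fg by (elim minus_exists[of f g]) auto
  have "g \<cdot> e \<boxplus> h \<cdot> e = g \<cdot> e"
    using h fg assms(1) by (simp flip: plus_comp_simp)
  then have "h \<cdot> e = zero_arr C (src C e) (tgt C h)"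
    using plus_cancel_zero[of "g \<cdot> e" "h \<cdot> e"] h fg assms(1) by simp
  then show "f = g"
    using assms(2)[of h] h fg by simp
qed fact

lemma kernel_factor:
  assumes "is_kernel C k f" "g \<in> arr C" "tgt C g = src C f" "f \<cdot> g = zero_arr C (src C g) (tgt C f)"
  obtains h where "h \<in> arr C" "src C h = src C g" "tgt C h = src C k" "k \<cdot> h = g"
  using assms unfolding is_kernel_def by (metis in_homset)

lemma cokernel_factor:
  assumes "is_cokernel C c f" "g \<in> arr C" "src C g = tgt C f" "g \<cdot> f = zero_arr C (src C f) (tgt C g)"
  obtains h where "h \<in> arr C" "src C h = tgt C c" "tgt C h = tgt C g" "h \<cdot> c = g"
  using assms unfolding is_cokernel_def by (metis in_homset)

lemma kernel_mono:
  assumes "is_kernel C k f"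
  shows "mono_arr C k"
  unfolding mono_arr_def
proof (intro conjI ballI impI)
  show "k \<in> arr C"
    using assms by (simp add: is_kernel_def)
  fix g h
  assume gh: "g \<in> arr C" "h \<in> arr C" "src C g = src C h" "tgt C g = src C k" "tgt C h = src C k"
    "k \<cdot> g = k \<cdot> h"
  have k: "k \<in> arr C" "f \<in> arr C" "tgt C k = src C f" "f \<cdot> k = zero_arr C (src C k) (tgt C f)"
    and univ: "\<And>g. \<lbrakk>g \<in> arr C; tgt C g = src C f; f \<cdot> g = zero_arr C (src C g) (tgt C f)\<rbrakk>
           \<Longrightarrow> \<exists>!h. h \<in> homset C (src C g) (src C k) \<and> k \<cdot> h = g"
    using assms unfolding is_kernel_def by blast+
  have "f \<cdot> (k \<cdot> g) = zero_arr C (src C g) (tgt C f)"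
    using k gh comp_reduce[OF k(4), of g] by simp
  then have "\<exists>!x. x \<in> homset C (src C g) (src C k) \<and> k \<cdot> x = k \<cdot> g"
    using univ[of "k \<cdot> g"] k(1-3) gh(1,4) by (simp only: comp_simps)
  moreover have "g \<in> homset C (src C g) (src C k)" "h \<in> homset C (src C g) (src C k)"
    using gh by auto
  ultimately show "g = h"
    using gh(6) by metis
qed

lemma cokernel_epi_zero:
  assumes "is_cokernel C c f" "h \<in> arr C" "src C h = tgt C c" "h \<cdot> c = zero_arr C (src C c) (tgt C h)"
  shows "h = zero_arr C (tgt C c) (tgt C h)"
proof -
  have c: "c \<in> arr C" "f \<in> arr C" "src C c = tgt C f"
    and univ: "\<And>g. \<lbrakk>g \<in> arr C; src C g = tgt C f; g \<cdot> f = zero_arr C (src C f) (tgt C g)\<rbrakk>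
           \<Longrightarrow> \<exists>!h. h \<in> homset C (tgt C c) (tgt C g) \<and> h \<cdot> c = g"
    using assms(1) unfolding is_cokernel_def by blast+
  have "\<exists>!x. x \<in> homset C (tgt C c) (tgt C h) \<and> x \<cdot> c = zero_arr C (src C c) (tgt C h)"
    using univ[of "zero_arr C (src C c) (tgt C h)"] c assms(2) by simp
  moreover have "h \<in> homset C (tgt C c) (tgt C h)" "zero_arr C (tgt C c) (tgt C h) \<in> homset C (tgt C c) (tgt C h)"
    using assms c by auto
  moreover have "zero_arr C (tgt C c) (tgt C h) \<cdot> c = zero_arr C (src C c) (tgt C h)"
    using assms c by simp
  ultimately show ?thesis
    using assms(4) by blast
qed

text \<open>By \<open>i p + j q = 1\<close>, an arrow killed by \<open>q\<close> equals
  \<open>i (p g)\<close>, and an arrow that kills \<open>i\<close> equals \<open>(g j) q\<close>.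
  Serre subcategories thereby contain direct sums of their members.\<close>

lemma biproduct_short_exact:
  assumes "biproduct C a b s i j p q"
  shows "short_exact C i q"
proof -
  have [simp]: "i \<in> arr C" "j \<in> arr C" "p \<in> arr C" "q \<in> arr C" "src C i = a" "tgt C i = s"
    "src C j = b" "tgt C j = s" "src C p = s" "tgt C p = a" "src C q = s" "tgt C q = b"
    "p \<cdot> i = idt C a" "q \<cdot> j = idt C b" "q \<cdot> i = zero_arr C a b"
    and sum: "(i \<cdot> p) \<boxplus> (j \<cdot> q) = idt C s"
    using assms by (auto simp: biproduct_def)
  have [simp]: "a \<in> obj C" "b \<in> obj C" "s \<in> obj C"
    using src_obj[of i] src_obj[of j] src_obj[of p] by simp_all
  have "\<exists>!h. h \<in> homset C (src C g) a \<and> i \<cdot> h = g"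
    if g [simp]: "g \<in> arr C" "tgt C g = s" and "q \<cdot> g = zero_arr C (src C g) b" for g
  proof (rule ex1I)
    have "g = ((i \<cdot> p) \<boxplus> (j \<cdot> q)) \<cdot> g"
      by (simp add: sum)
    also have "\<dots> = i \<cdot> (p \<cdot> g)"
      using that(3) by (simp add: plus_comp_simp)
    finally show "p \<cdot> g \<in> homset C (src C g) a \<and> i \<cdot> (p \<cdot> g) = g"
      by simp
  next
    fix h
    assume "h \<in> homset C (src C g) a \<and> i \<cdot> h = g"
    then have h: "h \<in> arr C" "tgt C h = a" "i \<cdot> h = g"
      by auto
    then have "p \<cdot> g = p \<cdot> (i \<cdot> h)"
      by simp
    then show "h = p \<cdot> g"
      using h comp_reduce[of p i "idt C a" h] by simp
  qed
  moreover have "\<exists>!h. h \<in> homset C b (tgt C g) \<and> h \<cdot> q = g"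
    if g [simp]: "g \<in> arr C" "src C g = s" and "g \<cdot> i = zero_arr C a (tgt C g)" for g
  proof (rule ex1I)
    have "g = g \<cdot> ((i \<cdot> p) \<boxplus> (j \<cdot> q))"
      by (simp add: sum)
    also have "\<dots> = g \<cdot> (i \<cdot> p) \<boxplus> g \<cdot> (j \<cdot> q)"
      by (rule comp_plus_simp) simp_all
    also have "g \<cdot> (i \<cdot> p) = zero_arr C s (tgt C g)"
      by (simp add: comp_reduce[OF that(3)])
    finally show "g \<cdot> j \<in> homset C b (tgt C g) \<and> (g \<cdot> j) \<cdot> q = g"
      by simp
  next
    fix h
    assume "h \<in> homset C b (tgt C g) \<and> h \<cdot> q = g"
    then show "h = g \<cdot> j"
      by auto
  qed
  ultimately show ?thesis
    by (simp add: short_exact_def is_kernel_def is_cokernel_def)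
qed

lemma zero_obj_hom:
  assumes "zero_obj C z" "f \<in> arr C" "g \<in> arr C" "src C f = src C g" "tgt C f = tgt C g"
    "src C f = z \<or> tgt C f = z"
  shows "f = g"
proof -
  have "f \<in> homset C (src C g) (tgt C g)" "g \<in> homset C (src C g) (tgt C g)" "src C g \<in> obj C" "tgt C g \<in> obj C"
    using assms by auto
  then show ?thesis
    using assms unfolding zero_obj_def by (metis)
qed

lemma end_ring_ring:
  assumes a: "a \<in> obj C"
  shows "ring (end_ring C a)"
proof (rule ringI)
  have "add_monoid (end_ring C a) = hom_group C a a"
    by (simp add: end_ring_def hom_group_def)
  then show "abelian_group (end_ring C a)"
    using hom_comm_group[OF a a]
    by (auto simp: abelian_group_def abelian_monoid_def abelian_group_axioms_def comm_group_def)
  show "Group.monoid (end_ring C a)"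
    using a by (intro monoidI) (auto simp: end_ring_def)
qed (auto simp: end_ring_def comp_plus_simp plus_comp_simp)

end

context abelian_category
begin

text \<open>The monomorphism is a kernel of some \<open>f\<close>; being epi as well, it forces
  \<open>f\<close> to be zero, so the identity factors through it.\<close>

lemma mono_epi_iso:
  assumes "mono_arr C m" "epi_arr C m"
  shows "iso_arr C m"
proof -
  obtain f where f: "is_kernel C m f"
    using mono_normal assms by blast
  then have fm: "f \<in> arr C" "m \<in> arr C" "tgt C m = src C f" "f \<cdot> m = zero_arr C (src C m) (tgt C f)"
    by (auto simp: is_kernel_def)
  have "f = zero_arr C (src C f) (tgt C f)"
    using assms(2) fm unfolding epi_arr_def by (elim conjE ballE[where x=f] ballE[where x="zero_arr C (src C f) (tgt C f)"]) auto
  then have "f \<cdot> idt C (tgt C m) = zero_arr C (tgt C m) (tgt C f)"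
    using fm by simp
  obtain h where h: "h \<in> arr C" "src C h = tgt C m" "tgt C h = src C m" "m \<cdot> h = idt C (tgt C m)"
    by (rule kernel_factor[OF f, of "idt C (tgt C m)"]) (use fm \<open>f \<cdot> idt C (tgt C m) = _\<close> in auto)
  have "h \<cdot> m = idt C (src C m)"
    using h fm by (intro mono_arrD[OF assms(1), of "h \<cdot> m" "idt C (src C m)"]) (auto simp: comp_reduce[OF h(4)])
  then show ?thesis
    using h fm by (intro iso_arrI[of _ h]) auto
qed

text \<open>If \<open>m\<close> is a kernel of \<open>f\<close>, then \<open>f\<close> factors
  through the cokernel \<open>c\<close>. So whatever \<open>c\<close> kills is killed by
  \<open>f\<close> and factors through \<open>m\<close>.\<close>

lemma mono_kernel_cokernel:
  assumes "mono_arr C m" "is_cokernel C c m"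
  shows "is_kernel C m c"
proof -
  obtain f where f: "is_kernel C m f"
    using mono_normal assms by blast
  then have fm: "f \<in> arr C" "m \<in> arr C" "tgt C m = src C f" "f \<cdot> m = zero_arr C (src C m) (tgt C f)"
    by (auto simp: is_kernel_def)
  have c: "c \<in> arr C" "src C c = tgt C m" "c \<cdot> m = zero_arr C (src C m) (tgt C c)"
    using assms(2) by (auto simp: is_cokernel_def)
  obtain h where h: "h \<in> arr C" "src C h = tgt C c" "tgt C h = tgt C f" "h \<cdot> c = f"
    by (rule cokernel_factor[OF assms(2), of f]) (use fm in auto)
  have "\<exists>!x. x \<in> homset C (src C g) (src C m) \<and> m \<cdot> x = g"
    if g: "g \<in> arr C" "tgt C g = src C c" "c \<cdot> g = zero_arr C (src C g) (tgt C c)" for g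
  proof -
    have "f \<cdot> g = h \<cdot> (c \<cdot> g)"
      using h c g comp_assoc_simp[of g c h] by simp
    then have "f \<cdot> g = zero_arr C (src C g) (tgt C f)"
      using h g by simp
    then show ?thesis
      using f g c fm unfolding is_kernel_def by auto
  qed
  then show ?thesis
    using c fm by (simp add: is_kernel_def)
qed

section \<open>Closure properties of Serre subcategories\<close>

context
  fixes I
  assumes serre: "serre_subcategory C I"
begin

lemma serre_obj: "a \<in> I \<Longrightarrow> a \<in> obj C"
  using serre by (auto simp: serre_subcategory_def)

lemma serre_short_exact: "short_exact C f g \<Longrightarrow> src C g \<in> I \<longleftrightarrow> src C f \<in> I \<and> tgt C g \<in> I"
  using serre by (auto simp: serre_subcategory_def)

lemma serre_mono:
  assumes m: "mono_arr C m" and "tgt C m \<in> I"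
  shows "src C m \<in> I"
proof -
  obtain c where c: "is_cokernel C c m"
    using cokernel_exists[OF mono_arr_arr[OF m]] by blast
  then have "short_exact C m c" "src C c = tgt C m"
    using mono_kernel_cokernel[OF m] by (auto simp: short_exact_def is_cokernel_def)
  then show ?thesis
    using serre_short_exact assms(2) by metis
qed

lemma serre_biproduct:
  assumes bi: "biproduct C a b s i j p q" and "a \<in> I" "b \<in> I"
  shows "s \<in> I"
proof -
  have "src C i = a" "src C q = s" "tgt C q = b"
    using bi by (auto simp: biproduct_def)
  then show ?thesis
    using serre_short_exact[OF biproduct_short_exact[OF bi]] assms by simp
qed

text \<open>The zero arrow from \<open>z\<close> into any member of \<open>I\<close> is a
  monomorphism.\<close>

lemma serre_zero_obj:
  assumes z: "zero_obj C z"
  shows "z \<in> I"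
proof -
  obtain a where a: "a \<in> I"
    using serre by (auto simp: serre_subcategory_def)
  have [simp]: "a \<in> obj C" "z \<in> obj C"
    using serre_obj[OF a] z by (auto simp: zero_obj_def)
  have "mono_arr C (zero_arr C z a)"
    unfolding mono_arr_def using zero_obj_hom[OF z] by auto
  then show ?thesis
    using serre_mono a by fastforce
qed

end

end

section \<open>Symmetric monoidal categories and duals\<close>

context symmetric_monoidal_category
begin

abbreviation tunit :: 'a  (\<open>\<bbbone>\<close>) where
  "\<bbbone> \<equiv> unit_obj C"

declare tens_obj_closed [simp] unit_obj_closed [simp] tens_idt [simp]

lemma tens_simps [simp]:
  assumes "f \<in> arr C" "g \<in> arr C"
  shows "f \<otimes>\<^sub>a g \<in> arr C" "src C (f \<otimes>\<^sub>a g) = src C f \<otimes>\<^sub>o src C g"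
    "tgt C (f \<otimes>\<^sub>a g) = tgt C f \<otimes>\<^sub>o tgt C g"
  using tens_hom[of f "src C f" "tgt C f" g "src C g" "tgt C g"] assms by auto

lemma assoc_simps [simp]:
  assumes "a \<in> obj C" "b \<in> obj C" "c \<in> obj C"
  shows "assoc C a b c \<in> arr C" "src C (assoc C a b c) = (a \<otimes>\<^sub>o b) \<otimes>\<^sub>o c"
    "tgt C (assoc C a b c) = a \<otimes>\<^sub>o (b \<otimes>\<^sub>o c)" "iso_arr C (assoc C a b c)"
  using assoc_hom[of a b c] assoc_iso[of a b c] assms by auto

lemma lunit_simps [simp]:
  assumes "a \<in> obj C"
  shows "lunit C a \<in> arr C" "src C (lunit C a) = \<bbbone> \<otimes>\<^sub>o a" "tgt C (lunit C a) = a" "iso_arr C (lunit C a)"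
  using lunit_hom[of a] lunit_iso[of a] assms by auto

lemma runit_simps [simp]:
  assumes "a \<in> obj C"
  shows "runit C a \<in> arr C" "src C (runit C a) = a \<otimes>\<^sub>o \<bbbone>" "tgt C (runit C a) = a" "iso_arr C (runit C a)"
  using runit_hom[of a] runit_iso[of a] assms by auto

lemma swap_simps [simp]:
  assumes "a \<in> obj C" "b \<in> obj C"
  shows "swap C a b \<in> arr C" "src C (swap C a b) = a \<otimes>\<^sub>o b" "tgt C (swap C a b) = b \<otimes>\<^sub>o a"
    "iso_arr C (swap C a b)"
  using swap_hom[of a b] swap_hom[of b a] swap_swap[of a b] swap_swap[of b a] assms
  by (auto intro!: iso_arrI[of _ "swap C b a"])

lemma tens_comp:
  assumes "f \<in> arr C" "f' \<in> arr C" "tgt C f = src C f'" "g \<in> arr C" "g' \<in> arr C" "tgt C g = src C g'"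
  shows "(f' \<otimes>\<^sub>a g') \<cdot> (f \<otimes>\<^sub>a g) = (f' \<cdot> f) \<otimes>\<^sub>a (g' \<cdot> g)"
  using interchange[of f "src C f" "src C f'" f' "tgt C f'" g "src C g" "src C g'" g' "tgt C g'"] assms
  by auto

lemma tens_comp_comp:
  assumes "f \<in> arr C" "f' \<in> arr C" "tgt C f = src C f'" "g \<in> arr C" "g' \<in> arr C" "tgt C g = src C g'"
    "k \<in> arr C" "tgt C k = src C f \<otimes>\<^sub>o src C g"
  shows "(f' \<otimes>\<^sub>a g') \<cdot> ((f \<otimes>\<^sub>a g) \<cdot> k) = ((f' \<cdot> f) \<otimes>\<^sub>a (g' \<cdot> g)) \<cdot> k"
  using assms by (simp add: comp_reduce[OF tens_comp])

lemma iso_arr_tens [simp]: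
  assumes "iso_arr C f" "iso_arr C g"
  shows "iso_arr C (f \<otimes>\<^sub>a g)"
  using assms iso_arr_arr
  by (intro iso_arrI[of _ "inv_arr C f \<otimes>\<^sub>a inv_arr C g"]) (auto simp: tens_comp)

lemma assoc_natural_arr:
  assumes "f \<in> arr C" "g \<in> arr C" "h \<in> arr C"
    "src C f = a" "src C g = b" "src C h = c" "tgt C f = a'" "tgt C g = b'" "tgt C h = c'"
  shows "assoc C a' b' c' \<cdot> ((f \<otimes>\<^sub>a g) \<otimes>\<^sub>a h) = (f \<otimes>\<^sub>a (g \<otimes>\<^sub>a h)) \<cdot> assoc C a b c"
  using assoc_natural[of f a a' g b b' h c c'] assms by auto

lemma iso_square:
  assumes "i' \<cdot> f = g \<cdot> i" "iso_arr C i" "iso_arr C i'" "f \<in> arr C" "g \<in> arr C"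
    "src C f = src C i" "tgt C f = src C i'" "src C g = tgt C i" "tgt C g = tgt C i'"
  shows "inv_arr C i' \<cdot> g = f \<cdot> inv_arr C i"
proof -
  note [simp] = assms(2-)
  have "inv_arr C i' \<cdot> g = inv_arr C i' \<cdot> (g \<cdot> (i \<cdot> inv_arr C i))"
    by simp
  also have "\<dots> = inv_arr C i' \<cdot> (i' \<cdot> (f \<cdot> inv_arr C i))"
    using iso_arr_arr[OF assms(2)] iso_arr_arr[OF assms(3)] comp_rewrite[OF assms(1)]
    by (simp del: inv_arr_simps inv_arr_comp add: inv_arr_simps(1-3))
  also have "\<dots> = f \<cdot> inv_arr C i"
    by simp
  finally show ?thesis .
qed

lemma assoc_inv_natural:
  assumes "f \<in> arr C" "g \<in> arr C" "h \<in> arr C"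
    "src C f = a" "src C g = b" "src C h = c" "tgt C f = a'" "tgt C g = b'" "tgt C h = c'"
  shows "inv_arr C (assoc C a' b' c') \<cdot> (f \<otimes>\<^sub>a (g \<otimes>\<^sub>a h)) = ((f \<otimes>\<^sub>a g) \<otimes>\<^sub>a h) \<cdot> inv_arr C (assoc C a b c)"
  using assms src_obj tgt_obj by (intro iso_square[OF assoc_natural_arr]) auto

lemma runit_natural_arr:
  assumes "f \<in> arr C" "src C f = a" "tgt C f = b"
  shows "runit C b \<cdot> (f \<otimes>\<^sub>a idt C \<bbbone>) = f \<cdot> runit C a"
  using runit_natural[of f a b] assms by auto

lemma runit_inv_natural:
  assumes "f \<in> arr C" "src C f = a" "tgt C f = b"
  shows "inv_arr C (runit C b) \<cdot> f = (f \<otimes>\<^sub>a idt C \<bbbone>) \<cdot> inv_arr C (runit C a)"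
  using assms src_obj tgt_obj by (intro iso_square[OF runit_natural_arr]) auto

lemma lunit_natural_arr:
  assumes "f \<in> arr C" "src C f = a" "tgt C f = b"
  shows "lunit C b \<cdot> (idt C \<bbbone> \<otimes>\<^sub>a f) = f \<cdot> lunit C a"
  using lunit_natural[of f a b] assms by auto

lemma lunit_inv_natural:
  assumes "f \<in> arr C" "src C f = a" "tgt C f = b"
  shows "inv_arr C (lunit C b) \<cdot> f = (idt C \<bbbone> \<otimes>\<^sub>a f) \<cdot> inv_arr C (lunit C a)"
  using assms src_obj tgt_obj by (intro iso_square[OF lunit_natural_arr]) auto

lemma swap_natural_arr:
  assumes "f \<in> arr C" "g \<in> arr C" "src C f = a" "src C g = b" "tgt C f = a'" "tgt C g = b'"
  shows "swap C a' b' \<cdot> (f \<otimes>\<^sub>a g) = (g \<otimes>\<^sub>a f) \<cdot> swap C a b"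
  using swap_natural[of f a a' g b b'] assms by auto

text \<open>Conjugation by \<open>\<lambda> \<rho>\<^sup>-\<^sup>1\<close> maps \<open>End(\<bbbone>)\<close> onto itself and, by naturality of \<open>\<lambda>\<close>, into its
  center.  This avoids the coherence law \<open>\<lambda> = \<rho>\<close> on the unit.\<close>

lemma unit_end_commute:
  assumes x: "x \<in> homset C \<bbbone> \<bbbone>" and y: "y \<in> homset C \<bbbone> \<bbbone>"
  shows "x \<cdot> y = y \<cdot> x"
proof -
  let ?l = "lunit C \<bbbone>" and ?r = "runit C \<bbbone>"
  define z where "z = ?r \<cdot> (inv_arr C ?l \<cdot> (x \<cdot> (?l \<cdot> inv_arr C ?r)))"
  note [simp] = assms[simplified]
  have [simp]: "z \<in> arr C" "src C z = \<bbbone>" "tgt C z = \<bbbone>"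
    by (simp_all add: z_def)
  have "inv_arr C ?r \<cdot> (z \<cdot> ?r) = z \<otimes>\<^sub>a idt C \<bbbone>"
    by (simp flip: runit_natural_arr)
  then have "?l \<cdot> ((z \<otimes>\<^sub>a idt C \<bbbone>) \<cdot> inv_arr C ?l) = ?l \<cdot> ((inv_arr C ?r \<cdot> (z \<cdot> ?r)) \<cdot> inv_arr C ?l)"
    by simp
  then have x_eq: "x = ?l \<cdot> ((z \<otimes>\<^sub>a idt C \<bbbone>) \<cdot> inv_arr C ?l)"
    by (simp add: z_def)
  have "x \<cdot> y = ?l \<cdot> ((z \<otimes>\<^sub>a y) \<cdot> inv_arr C ?l)"
    by (simp add: x_eq lunit_inv_natural[of y \<bbbone> \<bbbone>] tens_comp_comp)
  moreover have "y \<cdot> x = ?l \<cdot> ((z \<otimes>\<^sub>a y) \<cdot> inv_arr C ?l)"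
    using comp_rewrite[OF lunit_natural_arr[of y \<bbbone> \<bbbone>, symmetric]]
    by (simp add: x_eq tens_comp_comp)
  ultimately show ?thesis
    by simp
qed

text \<open>Commutativity of \<open>End(1)\<close> identifies \<open>z\<close> with the conjugate of
  \<open>z \<otimes> 1\<close> by the left unitor at the unit. In that form the interchange law and
  naturality carry it across \<open>f\<close>.\<close>

lemma unit_end_slide:
  assumes z: "z \<in> homset C \<bbbone> \<bbbone>" and f: "f \<in> arr C" "src C f = X" "tgt C f = \<bbbone>"
  shows "z \<cdot> f = f \<cdot> (lunit C X \<cdot> ((z \<otimes>\<^sub>a idt C X) \<cdot> inv_arr C (lunit C X)))"
proof -
  let ?l = "lunit C \<bbbone>" and ?r = "runit C \<bbbone>"
  note [simp] = z[simplified] f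
  have [simp]: "X \<in> obj C"
    using src_obj[of f] by simp
  have "inv_arr C ?r \<cdot> (z \<cdot> ?r) = z \<otimes>\<^sub>a idt C \<bbbone>"
    by (simp flip: runit_natural_arr)
  then have "?l \<cdot> ((z \<otimes>\<^sub>a idt C \<bbbone>) \<cdot> inv_arr C ?l) = ?l \<cdot> ((inv_arr C ?r \<cdot> (z \<cdot> ?r)) \<cdot> inv_arr C ?l)"
    by simp
  also have "\<dots> = (?l \<cdot> inv_arr C ?r) \<cdot> (z \<cdot> (?r \<cdot> inv_arr C ?l))"
    by simp
  \<comment> \<open>The automorphism \<open>?l \<cdot> inv_arr C ?r\<close> of the unit moves to the
    right end, where it cancels.\<close>
  also have "\<dots> = (z \<cdot> (?r \<cdot> inv_arr C ?l)) \<cdot> (?l \<cdot> inv_arr C ?r)"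
    by (rule unit_end_commute) simp_all
  also have "\<dots> = z"
    by simp
  finally have "z \<cdot> f = (?l \<cdot> ((z \<otimes>\<^sub>a idt C \<bbbone>) \<cdot> inv_arr C ?l)) \<cdot> f"
    by (rule arg_cong[where f = "\<lambda>x. x \<cdot> f", OF sym])
  also have "\<dots> = ?l \<cdot> ((z \<otimes>\<^sub>a idt C \<bbbone>) \<cdot> (inv_arr C ?l \<cdot> f))"
    by simp
  also have "\<dots> = ?l \<cdot> ((z \<otimes>\<^sub>a f) \<cdot> inv_arr C (lunit C X))"
    by (simp add: lunit_inv_natural[of f X \<bbbone>] tens_comp_comp)
  also have "\<dots> = f \<cdot> (lunit C X \<cdot> ((z \<otimes>\<^sub>a idt C X) \<cdot> inv_arr C (lunit C X)))"
    using comp_rewrite[OF lunit_natural_arr[of f X \<bbbone>, symmetric]] by (simp add: tens_comp_comp)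
  finally show ?thesis .
qed

text \<open>Interchange splits \<open>g \<otimes> f\<close> into \<open>g \<otimes> 1\<close> after
  \<open>1 \<otimes> f\<close>, and naturality of the right and left unitor reduces these to
  \<open>g\<close> and \<open>f\<close>. The automorphism of the unit left between them is pushed
  through \<open>f\<close> by \<open>unit_end_slide\<close> and absorbed into
  \<open>j\<close>.\<close>

lemma unit_tens_factor:
  assumes f: "f \<in> arr C" "tgt C f = \<bbbone>" and g: "g \<in> arr C" "src C g = \<bbbone>"
  obtains j where "iso_arr C j" "src C j = \<bbbone> \<otimes>\<^sub>o src C f" "tgt C j = src C f"
    "g \<otimes>\<^sub>a f = inv_arr C (runit C (tgt C g)) \<cdot> ((g \<cdot> f) \<cdot> j)"
proof -
  let ?l = "lunit C \<bbbone>" and ?r = "runit C \<bbbone>"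
  define X Y where "X = src C f" and "Y = tgt C g"
  have [simp]: "X \<in> obj C" "Y \<in> obj C" "f \<in> arr C" "g \<in> arr C" "src C f = X" "tgt C f = \<bbbone>"
      "src C g = \<bbbone>" "tgt C g = Y"
    using f g by (auto simp: X_def Y_def)
  define j0 where "j0 = lunit C X \<cdot> (((?r \<cdot> inv_arr C ?l) \<otimes>\<^sub>a idt C X) \<cdot> inv_arr C (lunit C X))"
  have j0 [simp]: "j0 \<in> arr C" "src C j0 = X" "tgt C j0 = X" "iso_arr C j0"
    by (auto simp: j0_def)
  have slide: "?r \<cdot> (inv_arr C ?l \<cdot> f) = f \<cdot> j0"
    using unit_end_slide[of "?r \<cdot> inv_arr C ?l" f X] by (simp add: j0_def)
  have "g \<otimes>\<^sub>a f = (g \<otimes>\<^sub>a idt C \<bbbone>) \<cdot> (idt C \<bbbone> \<otimes>\<^sub>a f)"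
    by (simp add: tens_comp)
  also have "g \<otimes>\<^sub>a idt C \<bbbone> = inv_arr C (runit C Y) \<cdot> (g \<cdot> ?r)"
    by (simp flip: runit_natural_arr[of g \<bbbone> Y])
  also have "idt C \<bbbone> \<otimes>\<^sub>a f = inv_arr C ?l \<cdot> (f \<cdot> lunit C X)"
    by (simp flip: lunit_natural_arr[of f X \<bbbone>])
  also have "(inv_arr C (runit C Y) \<cdot> (g \<cdot> ?r)) \<cdot> (inv_arr C ?l \<cdot> (f \<cdot> lunit C X))
      = inv_arr C (runit C Y) \<cdot> (g \<cdot> ((?r \<cdot> (inv_arr C ?l \<cdot> f)) \<cdot> lunit C X))"
    by simp
  also have "\<dots> = inv_arr C (runit C Y) \<cdot> ((g \<cdot> f) \<cdot> (j0 \<cdot> lunit C X))"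
    by (simp add: slide)
  finally show ?thesis
    by (intro that[of "j0 \<cdot> lunit C X"]) simp_all
qed

section \<open>Duals and the adjunction between tensoring with \<open>b\<close> and with
  \<open>a\<close>\<close>

lemma pentagon_conjugate_inner:
  assumes "Y \<in> obj C" "a \<in> obj C" "b \<in> obj C" "c \<in> obj C"
  shows "(assoc C Y a b \<otimes>\<^sub>a idt C c) \<cdot> inv_arr C (assoc C (Y \<otimes>\<^sub>o a) b c)
       = inv_arr C (assoc C Y (a \<otimes>\<^sub>o b) c)
           \<cdot> ((idt C Y \<otimes>\<^sub>a inv_arr C (assoc C a b c)) \<cdot> assoc C Y a (b \<otimes>\<^sub>o c))"
    (is "?D \<cdot> inv_arr C ?F = inv_arr C ?B \<cdot> (?A' \<cdot> ?E)")
proof -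
  let ?A = "idt C Y \<otimes>\<^sub>a assoc C a b c"
  note [simp] = assms
  have A: "?A' \<cdot> ?A = idt C (Y \<otimes>\<^sub>o (a \<otimes>\<^sub>o b) \<otimes>\<^sub>o c)"
    by (simp add: tens_comp)
  have "?A \<cdot> (?B \<cdot> ?D) = ?E \<cdot> ?F"
    using pentagon[of Y a b c] by simp
  then have "?A' \<cdot> (?A \<cdot> (?B \<cdot> ?D)) \<cdot> inv_arr C ?F = ?A' \<cdot> (?E \<cdot> ?F) \<cdot> inv_arr C ?F"
    by simp
  then have "?B \<cdot> (?D \<cdot> inv_arr C ?F) = ?A' \<cdot> ?E"
    by (simp add: comp_reduce[OF A])
  then have "inv_arr C ?B \<cdot> (?B \<cdot> (?D \<cdot> inv_arr C ?F)) = inv_arr C ?B \<cdot> (?A' \<cdot> ?E)"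
    by (rule arg_cong)
  then show ?thesis
    by simp
qed

text \<open>Like the inner version, this is the pentagon solved for a composite with one associator
  inverted. The inner form serves the first triangle composite of the adjunction, the outer form the
  second.\<close>

lemma pentagon_conjugate_outer:
  assumes "X \<in> obj C" "b \<in> obj C" "a \<in> obj C" "c \<in> obj C"
  shows "assoc C (X \<otimes>\<^sub>o b) a c \<cdot> (inv_arr C (assoc C X b a) \<otimes>\<^sub>a idt C c)
       = inv_arr C (assoc C X b (a \<otimes>\<^sub>o c)) \<cdot> ((idt C X \<otimes>\<^sub>a assoc C b a c) \<cdot> assoc C X (b \<otimes>\<^sub>o a) c)"
    (is "?F \<cdot> ?D' = inv_arr C ?E \<cdot> (?A \<cdot> ?B)")
proof -
  let ?D = "assoc C X b a \<otimes>\<^sub>a idt C c"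
  note [simp] = assms
  have D: "?D \<cdot> ?D' = idt C ((X \<otimes>\<^sub>o (b \<otimes>\<^sub>o a)) \<otimes>\<^sub>o c)"
    by (simp add: tens_comp)
  have "?A \<cdot> (?B \<cdot> ?D) = ?E \<cdot> ?F"
    using pentagon[of X b a c] by simp
  then have "inv_arr C ?E \<cdot> ((?A \<cdot> (?B \<cdot> ?D)) \<cdot> ?D') = inv_arr C ?E \<cdot> ((?E \<cdot> ?F) \<cdot> ?D')"
    by simp
  then show ?thesis
    by (simp add: D)
qed

text \<open>For a dual \<open>b\<close> of \<open>a\<close> these are the unit and counit of the adjunction between
  \<open>- \<otimes> b\<close> (left adjoint) and \<open>- \<otimes> a\<close>.\<close>

definition dual_unit :: "'a \<Rightarrow> 'a \<Rightarrow> 'b \<Rightarrow> 'a \<Rightarrow> 'b" where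
  "dual_unit a b \<eta> X = inv_arr C (assoc C X b a) \<cdot> ((idt C X \<otimes>\<^sub>a \<eta>) \<cdot> inv_arr C (runit C X))"

definition dual_counit :: "'a \<Rightarrow> 'a \<Rightarrow> 'b \<Rightarrow> 'a \<Rightarrow> 'b" where
  "dual_counit a b \<epsilon> Y = runit C Y \<cdot> ((idt C Y \<otimes>\<^sub>a \<epsilon>) \<cdot> assoc C Y a b)"

context
  fixes a b \<eta> \<epsilon>
  assumes dual: "is_dual C a b \<eta> \<epsilon>"
begin

lemma dual_simps [simp]:
  "a \<in> obj C" "b \<in> obj C" "\<eta> \<in> arr C" "src C \<eta> = \<bbbone>" "tgt C \<eta> = b \<otimes>\<^sub>o a"
  "\<epsilon> \<in> arr C" "src C \<epsilon> = a \<otimes>\<^sub>o b" "tgt C \<epsilon> = \<bbbone>"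
  using dual by (auto simp: is_dual_def)

lemma zigzag:
  "lunit C a \<cdot> ((\<epsilon> \<otimes>\<^sub>a idt C a) \<cdot> (inv_arr C (assoc C a b a) \<cdot> (idt C a \<otimes>\<^sub>a \<eta>))) = runit C a"
  "runit C b \<cdot> ((idt C b \<otimes>\<^sub>a \<epsilon>) \<cdot> (assoc C b a b \<cdot> (\<eta> \<otimes>\<^sub>a idt C b))) = lunit C b"
  using dual by (auto simp: is_dual_def)

lemma dual_unit_simps [simp]:
  assumes "X \<in> obj C"
  shows "dual_unit a b \<eta> X \<in> arr C" "src C (dual_unit a b \<eta> X) = X"
    "tgt C (dual_unit a b \<eta> X) = (X \<otimes>\<^sub>o b) \<otimes>\<^sub>o a"
  using assms by (simp_all add: dual_unit_def)

lemma dual_counit_simps [simp]: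
  assumes "Y \<in> obj C"
  shows "dual_counit a b \<epsilon> Y \<in> arr C" "src C (dual_counit a b \<epsilon> Y) = (Y \<otimes>\<^sub>o a) \<otimes>\<^sub>o b"
    "tgt C (dual_counit a b \<epsilon> Y) = Y"
  using assms by (simp_all add: dual_counit_def)

lemma dual_unit_natural:
  assumes "f \<in> arr C" "src C f = X" "tgt C f = X'"
  shows "dual_unit a b \<eta> X' \<cdot> f = ((f \<otimes>\<^sub>a idt C b) \<otimes>\<^sub>a idt C a) \<cdot> dual_unit a b \<eta> X"
proof -
  have [simp]: "X \<in> obj C" "X' \<in> obj C"
    using assms by auto
  note [simp] = assms
  show ?thesis
    using comp_rewrite[OF assoc_inv_natural[of f "idt C b" "idt C a" X b a X' b a, symmetric]]
    by (simp add: dual_unit_def runit_inv_natural[of f X X'] tens_comp tens_comp_comp)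
qed

lemma dual_counit_natural:
  assumes "f \<in> arr C" "src C f = Y" "tgt C f = Y'"
  shows "f \<cdot> dual_counit a b \<epsilon> Y = dual_counit a b \<epsilon> Y' \<cdot> ((f \<otimes>\<^sub>a idt C a) \<otimes>\<^sub>a idt C b)"
proof -
  have [simp]: "Y \<in> obj C" "Y' \<in> obj C"
    using assms by auto
  note [simp] = assms
  show ?thesis
    using comp_rewrite[OF runit_natural_arr[of f Y Y', symmetric]]
    by (simp add: dual_counit_def assoc_natural_arr[of f "idt C a" "idt C b" Y a b Y' a b] tens_comp tens_comp_comp)
qed

text \<open>After the associators are rearranged, the first zigzag turns the composite into
  \<open>(Y \<otimes> runit a)\<close>, an associator and an inverse unitor. Coherence would make
  this the identity; invertibility is visible from the factors and suffices.\<close>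

lemma dual_triangle1:
  assumes "Y \<in> obj C"
  shows "iso_arr C ((dual_counit a b \<epsilon> Y \<otimes>\<^sub>a idt C a) \<cdot> dual_unit a b \<eta> (Y \<otimes>\<^sub>o a))"
proof -
  note [simp] = assms
  let ?w = "(\<epsilon> \<otimes>\<^sub>a idt C a) \<cdot> (inv_arr C (assoc C a b a) \<cdot> (idt C a \<otimes>\<^sub>a \<eta>))"
  have tri: "(runit C Y \<otimes>\<^sub>a idt C a) \<cdot> inv_arr C (assoc C Y \<bbbone> a) = idt C Y \<otimes>\<^sub>a lunit C a"
    by (simp flip: triangle)
  have "(dual_counit a b \<epsilon> Y \<otimes>\<^sub>a idt C a) \<cdot> dual_unit a b \<eta> (Y \<otimes>\<^sub>o a)
      = (runit C Y \<otimes>\<^sub>a idt C a) \<cdot> (((idt C Y \<otimes>\<^sub>a \<epsilon>) \<otimes>\<^sub>a idt C a) \<cdot> ((assoc C Y a b \<otimes>\<^sub>a idt C a)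
          \<cdot> (inv_arr C (assoc C (Y \<otimes>\<^sub>o a) b a) \<cdot> ((idt C (Y \<otimes>\<^sub>o a) \<otimes>\<^sub>a \<eta>) \<cdot> inv_arr C (runit C (Y \<otimes>\<^sub>o a))))))"
    by (simp add: dual_unit_def dual_counit_def tens_comp tens_comp_comp)
  also have "\<dots> = (runit C Y \<otimes>\<^sub>a idt C a) \<cdot> (((idt C Y \<otimes>\<^sub>a \<epsilon>) \<otimes>\<^sub>a idt C a) \<cdot> (inv_arr C (assoc C Y (a \<otimes>\<^sub>o b) a)
      \<cdot> ((idt C Y \<otimes>\<^sub>a inv_arr C (assoc C a b a)) \<cdot> (assoc C Y a (b \<otimes>\<^sub>o a) \<cdot> ((idt C (Y \<otimes>\<^sub>o a) \<otimes>\<^sub>a \<eta>) \<cdot> inv_arr C (runit C (Y \<otimes>\<^sub>o a)))))))"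
    by (simp add: comp_reduce[OF pentagon_conjugate_inner])
  also have "\<dots> = (runit C Y \<otimes>\<^sub>a idt C a) \<cdot> (inv_arr C (assoc C Y \<bbbone> a) \<cdot> ((idt C Y \<otimes>\<^sub>a (\<epsilon> \<otimes>\<^sub>a idt C a))
      \<cdot> ((idt C Y \<otimes>\<^sub>a inv_arr C (assoc C a b a)) \<cdot> ((idt C Y \<otimes>\<^sub>a (idt C a \<otimes>\<^sub>a \<eta>)) \<cdot> (assoc C Y a \<bbbone> \<cdot> inv_arr C (runit C (Y \<otimes>\<^sub>o a)))))))"
    using comp_rewrite[OF assoc_natural_arr[of "idt C Y" "idt C a" \<eta> Y a \<bbbone> Y a "b \<otimes>\<^sub>o a"]]
      comp_rewrite[OF assoc_inv_natural[of "idt C Y" \<epsilon> "idt C a" Y "a \<otimes>\<^sub>o b" a Y \<bbbone> a, symmetric]]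
    by simp
  also have "\<dots> = (idt C Y \<otimes>\<^sub>a (lunit C a \<cdot> ?w)) \<cdot> (assoc C Y a \<bbbone> \<cdot> inv_arr C (runit C (Y \<otimes>\<^sub>o a)))"
    by (simp add: comp_reduce[OF tri] tens_comp_comp)
  also have "\<dots> = (idt C Y \<otimes>\<^sub>a runit C a) \<cdot> (assoc C Y a \<bbbone> \<cdot> inv_arr C (runit C (Y \<otimes>\<^sub>o a)))"
    by (simp only: zigzag)
  finally show ?thesis
    by simp
qed

text \<open>The same strategy with the second zigzag, which replaces the middle of the composite by
  \<open>inv_arr C (runit C b) \<cdot> lunit C b\<close>.\<close>

lemma dual_triangle2:
  assumes "X \<in> obj C"
  shows "iso_arr C (dual_counit a b \<epsilon> (X \<otimes>\<^sub>o b) \<cdot> (dual_unit a b \<eta> X \<otimes>\<^sub>a idt C b))"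
proof -
  note [simp] = assms
  let ?w = "(idt C b \<otimes>\<^sub>a \<epsilon>) \<cdot> (assoc C b a b \<cdot> (\<eta> \<otimes>\<^sub>a idt C b))"
  let ?r = "inv_arr C (runit C X) \<otimes>\<^sub>a idt C b"
  have w: "?w = inv_arr C (runit C b) \<cdot> lunit C b"
    by (simp flip: zigzag(2))
  have "dual_counit a b \<epsilon> (X \<otimes>\<^sub>o b) \<cdot> (dual_unit a b \<eta> X \<otimes>\<^sub>a idt C b)
      = runit C (X \<otimes>\<^sub>o b) \<cdot> ((idt C (X \<otimes>\<^sub>o b) \<otimes>\<^sub>a \<epsilon>) \<cdot> (assoc C (X \<otimes>\<^sub>o b) a b
          \<cdot> ((inv_arr C (assoc C X b a) \<otimes>\<^sub>a idt C b) \<cdot> (((idt C X \<otimes>\<^sub>a \<eta>) \<otimes>\<^sub>a idt C b) \<cdot> ?r))))"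
    by (simp add: dual_unit_def dual_counit_def tens_comp tens_comp_comp)
  also have "\<dots> = runit C (X \<otimes>\<^sub>o b) \<cdot> ((idt C (X \<otimes>\<^sub>o b) \<otimes>\<^sub>a \<epsilon>) \<cdot> (inv_arr C (assoc C X b (a \<otimes>\<^sub>o b))
          \<cdot> ((idt C X \<otimes>\<^sub>a assoc C b a b) \<cdot> (assoc C X (b \<otimes>\<^sub>o a) b \<cdot> (((idt C X \<otimes>\<^sub>a \<eta>) \<otimes>\<^sub>a idt C b) \<cdot> ?r)))))"
    by (simp add: comp_reduce[OF pentagon_conjugate_outer])
  also have "\<dots> = runit C (X \<otimes>\<^sub>o b) \<cdot> (inv_arr C (assoc C X b \<bbbone>) \<cdot> ((idt C X \<otimes>\<^sub>a (idt C b \<otimes>\<^sub>a \<epsilon>))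
          \<cdot> ((idt C X \<otimes>\<^sub>a assoc C b a b) \<cdot> ((idt C X \<otimes>\<^sub>a (\<eta> \<otimes>\<^sub>a idt C b)) \<cdot> (assoc C X \<bbbone> b \<cdot> ?r)))))"
    using comp_rewrite[OF assoc_natural_arr[of "idt C X" \<eta> "idt C b" X \<bbbone> b X "b \<otimes>\<^sub>o a" b]]
      comp_rewrite[OF assoc_inv_natural[of "idt C X" "idt C b" \<epsilon> X b "a \<otimes>\<^sub>o b" X b \<bbbone>, symmetric]]
    by simp
  also have "\<dots> = runit C (X \<otimes>\<^sub>o b) \<cdot> (inv_arr C (assoc C X b \<bbbone>) \<cdot> ((idt C X \<otimes>\<^sub>a ?w) \<cdot> (assoc C X \<bbbone> b \<cdot> ?r)))"
    by (simp add: tens_comp_comp)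
  finally show ?thesis
    by (simp add: w)
qed

text \<open>Tensoring with \<open>a\<close> is a right adjoint. Here \<open>T\<close> is
  transposition: \<open>m \<cdot> T h\<close> depends only on
  \<open>(m \<otimes> a) \<cdot> h\<close>, so \<open>T f = T g\<close>, and \<open>T h\<close>
  determines \<open>h\<close> because the first triangle composite is invertible.\<close>

lemma mono_tens_dual:
  assumes "mono_arr C m"
  shows "mono_arr C (m \<otimes>\<^sub>a idt C a)"
  unfolding mono_arr_def
proof (intro conjI ballI impI)
  define Y where "Y = src C m"
  define Z where "Z = tgt C m"
  have [simp]: "m \<in> arr C" "Y \<in> obj C" "Z \<in> obj C" "src C m = Y" "tgt C m = Z"
    using mono_arr_arr[OF assms] by (auto simp: Y_def Z_def)
  then show "m \<otimes>\<^sub>a idt C a \<in> arr C"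
    by simp
  fix f g
  assume fg: "f \<in> arr C" "g \<in> arr C" "src C f = src C g" "tgt C f = src C (m \<otimes>\<^sub>a idt C a)"
    "tgt C g = src C (m \<otimes>\<^sub>a idt C a)" "(m \<otimes>\<^sub>a idt C a) \<cdot> f = (m \<otimes>\<^sub>a idt C a) \<cdot> g"
  define T where "T h = dual_counit a b \<epsilon> Y \<cdot> (h \<otimes>\<^sub>a idt C b)" for h
  have T [simp]: "T h \<in> arr C" "src C (T h) = src C h \<otimes>\<^sub>o b" "tgt C (T h) = Y"
    if "h \<in> arr C" "tgt C h = Y \<otimes>\<^sub>o a" for h
    using that by (auto simp: T_def)
  have mT: "m \<cdot> T h = dual_counit a b \<epsilon> Z \<cdot> (((m \<otimes>\<^sub>a idt C a) \<cdot> h) \<otimes>\<^sub>a idt C b)"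
    if "h \<in> arr C" "tgt C h = Y \<otimes>\<^sub>o a" for h
    using that comp_rewrite[OF dual_counit_natural[of m Y Z]]
    by (simp add: T_def tens_comp)
  have recover: "(T h \<otimes>\<^sub>a idt C a) \<cdot> dual_unit a b \<eta> (src C h)
      = ((dual_counit a b \<epsilon> Y \<otimes>\<^sub>a idt C a) \<cdot> dual_unit a b \<eta> (Y \<otimes>\<^sub>o a)) \<cdot> h"
    if "h \<in> arr C" "tgt C h = Y \<otimes>\<^sub>o a" for h
    using that by (simp add: dual_unit_natural[of h "src C h" "Y \<otimes>\<^sub>o a"] T_def tens_comp_comp)
  have "T f = T g"
    using mT[of f] mT[of g] fg by (intro mono_arrD[OF assms, of "T f" "T g"]) simp_all
  then show "f = g"
    using fg recover[of f] recover[of g]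
    by (intro iso_arr_cancel[OF dual_triangle1[of Y], of f g]) simp_all
qed

end

end

section \<open>Vanishing of tensor products of arrows\<close>

context tensor_category
begin

lemma plus_tens_arr:
  assumes "f \<in> arr C" "f' \<in> arr C" "g \<in> arr C" "src C f = src C f'" "tgt C f = tgt C f'"
  shows "(f \<boxplus> f') \<otimes>\<^sub>a g = (f \<otimes>\<^sub>a g) \<boxplus> (f' \<otimes>\<^sub>a g)"
  using plus_tens[of f "src C f'" "tgt C f'" f' g "src C g" "tgt C g"] assms by auto

lemma tens_plus_arr:
  assumes "f \<in> arr C" "g \<in> arr C" "g' \<in> arr C" "src C g = src C g'" "tgt C g = tgt C g'"
  shows "f \<otimes>\<^sub>a (g \<boxplus> g') = (f \<otimes>\<^sub>a g) \<boxplus> (f \<otimes>\<^sub>a g')"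
  using tens_plus[of f "src C f" "tgt C f" g "src C g'" "tgt C g'" g'] assms by auto

lemma zero_tens [simp]:
  assumes "a \<in> obj C" "b \<in> obj C" "f \<in> arr C"
  shows "zero_arr C a b \<otimes>\<^sub>a f = zero_arr C (a \<otimes>\<^sub>o src C f) (b \<otimes>\<^sub>o tgt C f)"
proof -
  have "(zero_arr C a b \<otimes>\<^sub>a f) \<boxplus> (zero_arr C a b \<otimes>\<^sub>a f) = zero_arr C a b \<otimes>\<^sub>a f"
    using assms by (simp flip: plus_tens_arr)
  then show ?thesis
    using plus_cancel_zero[of "zero_arr C a b \<otimes>\<^sub>a f" "zero_arr C a b \<otimes>\<^sub>a f"] assms by simp
qed

lemma tens_zero [simp]:
  assumes "a \<in> obj C" "b \<in> obj C" "f \<in> arr C"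
  shows "f \<otimes>\<^sub>a zero_arr C a b = zero_arr C (src C f \<otimes>\<^sub>o a) (tgt C f \<otimes>\<^sub>o b)"
proof -
  have "(f \<otimes>\<^sub>a zero_arr C a b) \<boxplus> (f \<otimes>\<^sub>a zero_arr C a b) = f \<otimes>\<^sub>a zero_arr C a b"
    using assms by (simp flip: tens_plus_arr)
  then show ?thesis
    using plus_cancel_zero[of "f \<otimes>\<^sub>a zero_arr C a b" "f \<otimes>\<^sub>a zero_arr C a b"] assms by simp
qed

lemma comp_iso_zero_iff:
  assumes "iso_arr C j" "f \<in> arr C" "tgt C j = src C f"
  shows "f \<cdot> j = zero_arr C (src C j) (tgt C f) \<longleftrightarrow> f = zero_arr C (src C f) (tgt C f)"
proof
  assume "f \<cdot> j = zero_arr C (src C j) (tgt C f)"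
  then have "(f \<cdot> j) \<cdot> inv_arr C j = zero_arr C (src C j) (tgt C f) \<cdot> inv_arr C j"
    by simp
  then show "f = zero_arr C (src C f) (tgt C f)"
    using assms iso_arr_arr[OF assms(1)] by (simp del: inv_arr_comp)
next
  assume f: "f = zero_arr C (src C f) (tgt C f)"
  show "f \<cdot> j = zero_arr C (src C j) (tgt C f)"
    using assms iso_arr_arr[OF assms(1)] by (subst f) simp
qed

lemma iso_comp_zero_iff:
  assumes "iso_arr C j" "f \<in> arr C" "tgt C f = src C j"
  shows "j \<cdot> f = zero_arr C (src C f) (tgt C j) \<longleftrightarrow> f = zero_arr C (src C f) (tgt C f)"
proof
  assume "j \<cdot> f = zero_arr C (src C f) (tgt C j)"
  then have "inv_arr C j \<cdot> (j \<cdot> f) = inv_arr C j \<cdot> zero_arr C (src C f) (tgt C j)"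
    by simp
  then show "f = zero_arr C (src C f) (tgt C f)"
    using assms iso_arr_arr[OF assms(1)] by simp
next
  assume f: "f = zero_arr C (src C f) (tgt C f)"
  show "j \<cdot> f = zero_arr C (src C f) (tgt C j)"
    using assms iso_arr_arr[OF assms(1)] by (subst f) simp
qed

lemma unit_tens_zero_iff:
  assumes "f \<in> arr C" "tgt C f = \<bbbone>" "g \<in> arr C" "src C g = \<bbbone>"
  shows "g \<otimes>\<^sub>a f = zero_arr C (\<bbbone> \<otimes>\<^sub>o src C f) (tgt C g \<otimes>\<^sub>o \<bbbone>) \<longleftrightarrow> g \<cdot> f = zero_arr C (src C f) (tgt C g)"
proof -
  obtain j where j: "iso_arr C j" "src C j = \<bbbone> \<otimes>\<^sub>o src C f" "tgt C j = src C f"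
    "g \<otimes>\<^sub>a f = inv_arr C (runit C (tgt C g)) \<cdot> ((g \<cdot> f) \<cdot> j)"
    by (rule unit_tens_factor[OF assms])
  have "j \<in> arr C" "tgt C g \<in> obj C"
    using j(1) iso_arr_arr assms by auto
  then show ?thesis
    using iso_comp_zero_iff[of "inv_arr C (runit C (tgt C g))" "(g \<cdot> f) \<cdot> j"]
      comp_iso_zero_iff[of j "g \<cdot> f"] assms j
    by simp
qed

lemma tens_idt_zero_tens:
  assumes "q \<in> arr C" "a \<in> obj C" "c \<in> obj C"
    and "q \<otimes>\<^sub>a idt C a = zero_arr C (src C q \<otimes>\<^sub>o a) (tgt C q \<otimes>\<^sub>o a)"
  shows "q \<otimes>\<^sub>a idt C (a \<otimes>\<^sub>o c) = zero_arr C (src C q \<otimes>\<^sub>o (a \<otimes>\<^sub>o c)) (tgt C q \<otimes>\<^sub>o (a \<otimes>\<^sub>o c))"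
proof -
  have "src C q \<in> obj C" "tgt C q \<in> obj C"
    using assms by auto
  then have "(q \<otimes>\<^sub>a idt C (a \<otimes>\<^sub>o c)) \<cdot> assoc C (src C q) a c
      = zero_arr C ((src C q \<otimes>\<^sub>o a) \<otimes>\<^sub>o c) (tgt C q \<otimes>\<^sub>o (a \<otimes>\<^sub>o c))"
    using assms assoc_natural_arr[of q "idt C a" "idt C c" "src C q" a c "tgt C q" a c] by simp
  then show ?thesis
    using assms comp_iso_zero_iff[of "assoc C (src C q) a c" "q \<otimes>\<^sub>a idt C (a \<otimes>\<^sub>o c)"]
    by simp
qed

lemma tens_idt_zero_retract:
  assumes "q \<in> arr C" "s \<in> homset C c a" "r \<in> homset C a c" "r \<cdot> s = idt C c"
    and "q \<otimes>\<^sub>a idt C a = zero_arr C (src C q \<otimes>\<^sub>o a) (tgt C q \<otimes>\<^sub>o a)"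
  shows "q \<otimes>\<^sub>a idt C c = zero_arr C (src C q \<otimes>\<^sub>o c) (tgt C q \<otimes>\<^sub>o c)"
proof -
  have [simp]: "c \<in> obj C" "a \<in> obj C" "src C q \<in> obj C" "tgt C q \<in> obj C"
    "q \<in> arr C" "s \<in> arr C" "r \<in> arr C" "src C s = c" "tgt C s = a" "src C r = a" "tgt C r = c"
    using assms by auto
  have "q \<otimes>\<^sub>a idt C c = (idt C (tgt C q) \<otimes>\<^sub>a r) \<cdot> ((q \<otimes>\<^sub>a idt C a) \<cdot> (idt C (src C q) \<otimes>\<^sub>a s))"
    by (simp add: tens_comp tens_comp_comp assms(4))
  then show ?thesis
    by (simp add: assms(5))
qed

text \<open>Vanishing on \<open>a\<close> passes to \<open>a \<otimes> b\<close>, by the symmetry to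
  \<open>b \<otimes> a\<close>, then to \<open>(b \<otimes> a) \<otimes> b\<close>, of which the
  second zigzag makes \<open>b\<close> a retract. The symmetry is needed because
  \<open>tens_idt_zero_tens\<close> appends factors on the right.\<close>

lemma tens_idt_zero_dual:
  assumes dual: "is_dual C a b \<eta> \<epsilon>" and q: "q \<in> arr C"
    and zero: "q \<otimes>\<^sub>a idt C a = zero_arr C (src C q \<otimes>\<^sub>o a) (tgt C q \<otimes>\<^sub>o a)"
  shows "q \<otimes>\<^sub>a idt C b = zero_arr C (src C q \<otimes>\<^sub>o b) (tgt C q \<otimes>\<^sub>o b)"
proof -
  note [simp] = dual_simps[OF dual]
  have "q \<otimes>\<^sub>a idt C (a \<otimes>\<^sub>o b) = zero_arr C (src C q \<otimes>\<^sub>o (a \<otimes>\<^sub>o b)) (tgt C q \<otimes>\<^sub>o (a \<otimes>\<^sub>o b))"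
    using tens_idt_zero_tens[OF q _ _ zero] by simp
  then have "q \<otimes>\<^sub>a idt C (b \<otimes>\<^sub>o a) = zero_arr C (src C q \<otimes>\<^sub>o (b \<otimes>\<^sub>o a)) (tgt C q \<otimes>\<^sub>o (b \<otimes>\<^sub>o a))"
    using tens_idt_zero_retract[OF q, of "swap C b a" "b \<otimes>\<^sub>o a" "a \<otimes>\<^sub>o b" "swap C a b"] swap_swap
    by simp
  then have "q \<otimes>\<^sub>a idt C ((b \<otimes>\<^sub>o a) \<otimes>\<^sub>o b)
      = zero_arr C (src C q \<otimes>\<^sub>o ((b \<otimes>\<^sub>o a) \<otimes>\<^sub>o b)) (tgt C q \<otimes>\<^sub>o ((b \<otimes>\<^sub>o a) \<otimes>\<^sub>o b))"
    using tens_idt_zero_tens[OF q, of "b \<otimes>\<^sub>o a" b] by simp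
  moreover have "(runit C b \<cdot> ((idt C b \<otimes>\<^sub>a \<epsilon>) \<cdot> assoc C b a b)) \<cdot> ((\<eta> \<otimes>\<^sub>a idt C b) \<cdot> inv_arr C (lunit C b)) = idt C b"
    using comp_assoc_simp[of "inv_arr C (lunit C b)" "(idt C b \<otimes>\<^sub>a \<epsilon>) \<cdot> (assoc C b a b \<cdot> (\<eta> \<otimes>\<^sub>a idt C b))" "runit C b"]
      zigzag(2)[OF dual]
    by simp
  ultimately show ?thesis
    by (intro tens_idt_zero_retract[OF q, of "(\<eta> \<otimes>\<^sub>a idt C b) \<cdot> inv_arr C (lunit C b)" b "(b \<otimes>\<^sub>o a) \<otimes>\<^sub>o b"
          "runit C b \<cdot> ((idt C b \<otimes>\<^sub>a \<epsilon>) \<cdot> assoc C b a b)"]) simp_all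
qed

end

section \<open>Splitting of subobjects of the unit\<close>

context rigid_abelian_tensor_category
begin

text \<open>The adjunction treats tensoring on the right; conjugating with the symmetry gives the
  left.\<close>

lemma mono_tens:
  assumes "mono_arr C m" "a \<in> obj C"
  shows "mono_arr C (m \<otimes>\<^sub>a idt C a)" "mono_arr C (idt C a \<otimes>\<^sub>a m)"
proof -
  have [simp]: "m \<in> arr C" "a \<in> obj C"
    using assms mono_arr_arr by auto
  show *: "mono_arr C (m \<otimes>\<^sub>a idt C a)"
    using dual_exists[OF assms(2)] mono_tens_dual[OF _ assms(1)] by blast
  have "(swap C (tgt C m) a \<cdot> (m \<otimes>\<^sub>a idt C a)) \<cdot> swap C a (src C m)
      = (idt C a \<otimes>\<^sub>a m) \<cdot> (swap C (src C m) a \<cdot> swap C a (src C m))"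
    by (simp add: swap_natural_arr[of m "idt C a" "src C m" a "tgt C m" a] del: comp_assoc_simp)
      simp
  then have "idt C a \<otimes>\<^sub>a m = (swap C (tgt C m) a \<cdot> (m \<otimes>\<^sub>a idt C a)) \<cdot> swap C a (src C m)"
    by (simp add: swap_swap)
  moreover have "mono_arr C ((swap C (tgt C m) a \<cdot> (m \<otimes>\<^sub>a idt C a)) \<cdot> swap C a (src C m))"
    by (intro mono_arr_comp iso_arr_mono *) simp_all
  ultimately show "mono_arr C (idt C a \<otimes>\<^sub>a m)"
    by simp
qed

lemma cokernel_tens_unit_mono:
  assumes u: "mono_arr C u" "tgt C u = \<bbbone>" and q: "is_cokernel C q u"
  shows "q \<otimes>\<^sub>a idt C (src C u) = zero_arr C (\<bbbone> \<otimes>\<^sub>o src C u) (tgt C q \<otimes>\<^sub>o src C u)"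
proof -
  define U V where "U = src C u" and "V = tgt C q"
  have [simp]: "u \<in> arr C" "q \<in> arr C" "src C u = U" "tgt C u = \<bbbone>" "src C q = \<bbbone>" "tgt C q = V"
    and qu: "q \<cdot> u = zero_arr C U V"
    using assms by (auto simp: U_def V_def is_cokernel_def)
  have [simp]: "U \<in> obj C" "V \<in> obj C"
    using src_obj[of u] tgt_obj[of q] by simp_all
  have "q \<otimes>\<^sub>a u = zero_arr C (\<bbbone> \<otimes>\<^sub>o U) (V \<otimes>\<^sub>o \<bbbone>)"
    using unit_tens_zero_iff[of u q] qu by simp
  then have "(idt C V \<otimes>\<^sub>a u) \<cdot> (q \<otimes>\<^sub>a idt C U) = (idt C V \<otimes>\<^sub>a u) \<cdot> zero_arr C (\<bbbone> \<otimes>\<^sub>o U) (V \<otimes>\<^sub>o U)"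
    by (simp add: tens_comp)
  then have "q \<otimes>\<^sub>a idt C U = zero_arr C (\<bbbone> \<otimes>\<^sub>o U) (V \<otimes>\<^sub>o U)"
    using mono_tens(2)[OF u(1), of V]
    by (elim mono_arrD[rotated]) simp_all
  then show ?thesis
    by simp
qed

text \<open>Monic by the adjunction. For epi, an arrow that kills \<open>u \<otimes> b\<close> is
  transposed to one that kills \<open>u\<close>, hence factors through the cokernel
  \<open>q\<close>; transposing back brings in \<open>q \<otimes> b\<close>, which is zero.\<close>

lemma unit_mono_tens_dual_iso:
  assumes u: "mono_arr C u" "tgt C u = \<bbbone>" and dual: "is_dual C (src C u) b \<eta> \<epsilon>"
  shows "iso_arr C (u \<otimes>\<^sub>a idt C b)"
proof (rule mono_epi_iso)
  define U where "U = src C u"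
  note [simp] = dual_simps[OF dual, folded U_def] dual_unit_simps[OF dual, folded U_def]
    dual_counit_simps[OF dual, folded U_def]
  have [simp]: "u \<in> arr C" "src C u = U" "tgt C u = \<bbbone>"
    using u mono_arr_arr by (auto simp: U_def)
  show "mono_arr C (u \<otimes>\<^sub>a idt C b)"
    using u by (intro mono_tens) simp_all
  obtain q where q: "is_cokernel C q u"
    using cokernel_exists[of u] by auto
  then have [simp]: "q \<in> arr C" "src C q = \<bbbone>"
    by (auto simp: is_cokernel_def)
  have qb: "q \<otimes>\<^sub>a idt C b = zero_arr C (\<bbbone> \<otimes>\<^sub>o b) (tgt C q \<otimes>\<^sub>o b)"
    using tens_idt_zero_dual[OF dual, of q] cokernel_tens_unit_mono[OF u q] by simp
  show "epi_arr C (u \<otimes>\<^sub>a idt C b)"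
  proof (rule epi_arrI_zero)
    fix f
    assume f: "f \<in> arr C" "src C f = tgt C (u \<otimes>\<^sub>a idt C b)"
      "f \<cdot> (u \<otimes>\<^sub>a idt C b) = zero_arr C (src C (u \<otimes>\<^sub>a idt C b)) (tgt C f)"
    define Y where "Y = tgt C f"
    have [simp]: "f \<in> arr C" "src C f = \<bbbone> \<otimes>\<^sub>o b" "tgt C f = Y" "Y \<in> obj C"
      using f by (auto simp: Y_def)
    \<comment> \<open>The transpose of \<open>f\<close> under the adjunction.\<close>
    define f' where "f' = (f \<otimes>\<^sub>a idt C U) \<cdot> dual_unit U b \<eta> \<bbbone>"
    have [simp]: "f' \<in> arr C" "src C f' = \<bbbone>" "tgt C f' = Y \<otimes>\<^sub>o U"
      by (simp_all add: f'_def)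
    have "f' \<cdot> u = ((f \<cdot> (u \<otimes>\<^sub>a idt C b)) \<otimes>\<^sub>a idt C U) \<cdot> dual_unit U b \<eta> U"
      by (simp add: f'_def dual_unit_natural[OF dual, folded U_def, of u U \<bbbone>] tens_comp_comp)
    then have "f' \<cdot> u = zero_arr C U (Y \<otimes>\<^sub>o U)"
      using f(3) by simp
    then obtain h where h: "h \<in> arr C" "src C h = tgt C q" "tgt C h = Y \<otimes>\<^sub>o U" "h \<cdot> q = f'"
      using cokernel_factor[OF q, of f'] by auto
    let ?c = "dual_counit U b \<epsilon>"
    have "?c Y \<cdot> (f' \<otimes>\<^sub>a idt C b) = ?c Y \<cdot> ((h \<otimes>\<^sub>a idt C b) \<cdot> (q \<otimes>\<^sub>a idt C b))"
      using h by (simp add: tens_comp)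
    also have "\<dots> = zero_arr C (\<bbbone> \<otimes>\<^sub>o b) Y"
      using h by (simp add: qb)
    finally have "?c Y \<cdot> (f' \<otimes>\<^sub>a idt C b) = zero_arr C (\<bbbone> \<otimes>\<^sub>o b) Y" .
    moreover have "?c Y \<cdot> (f' \<otimes>\<^sub>a idt C b) = f \<cdot> (?c (\<bbbone> \<otimes>\<^sub>o b) \<cdot> (dual_unit U b \<eta> \<bbbone> \<otimes>\<^sub>a idt C b))"
      using comp_rewrite[OF dual_counit_natural[OF dual, folded U_def, of f "\<bbbone> \<otimes>\<^sub>o b" Y]]
      by (simp add: f'_def tens_comp)
    ultimately have "f \<cdot> (?c (\<bbbone> \<otimes>\<^sub>o b) \<cdot> (dual_unit U b \<eta> \<bbbone> \<otimes>\<^sub>a idt C b)) = zero_arr C (\<bbbone> \<otimes>\<^sub>o b) Y"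
      by simp
    then show "f = zero_arr C (tgt C (u \<otimes>\<^sub>a idt C b)) (tgt C f)"
      using comp_iso_zero_iff[OF dual_triangle2[OF dual, folded U_def, of \<bbbone>], of f] by simp
  qed simp
qed

text \<open>Since \<open>u \<otimes> b\<close> is invertible, every arrow
  \<open>U \<otimes> b \<rightarrow> 1\<close> extends along it; applied to the transpose of the
  identity of \<open>U\<close>, this yields the retraction.\<close>

theorem unit_mono_split:
  assumes u: "mono_arr C u" "tgt C u = \<bbbone>"
  obtains p where "p \<in> arr C" "src C p = \<bbbone>" "tgt C p = src C u" "p \<cdot> u = idt C (src C u)"
proof -
  define U where "U = src C u"
  have [simp]: "u \<in> arr C" "src C u = U" "tgt C u = \<bbbone>" "U \<in> obj C"
    using u mono_arr_arr by (auto simp: U_def)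
  obtain b \<eta> \<epsilon> where dual: "is_dual C U b \<eta> \<epsilon>"
    using dual_exists[of U] by auto
  note [simp] = dual_simps[OF dual] dual_unit_simps[OF dual] dual_counit_simps[OF dual]
  have [simp]: "iso_arr C (u \<otimes>\<^sub>a idt C b)"
    using unit_mono_tens_dual_iso[OF u] dual by simp
  define t where "t = (dual_counit U b \<epsilon> \<bbbone> \<otimes>\<^sub>a idt C U) \<cdot> dual_unit U b \<eta> (\<bbbone> \<otimes>\<^sub>o U)"
  have t [simp]: "t \<in> arr C" "src C t = \<bbbone> \<otimes>\<^sub>o U" "tgt C t = \<bbbone> \<otimes>\<^sub>o U" "iso_arr C t"
    using dual_triangle1[OF dual, of \<bbbone>] by (simp_all add: t_def)
  let ?l = "inv_arr C (lunit C U)"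
  \<comment> \<open>The transpose of \<open>?l\<close>, which is the identity of \<open>U\<close> up
    to a unitor, extended along \<open>u \<otimes> b\<close>.\<close>
  define g where "g = dual_counit U b \<epsilon> \<bbbone> \<cdot> ((?l \<otimes>\<^sub>a idt C b) \<cdot> inv_arr C (u \<otimes>\<^sub>a idt C b))"
  have [simp]: "g \<in> arr C" "src C g = \<bbbone> \<otimes>\<^sub>o b" "tgt C g = \<bbbone>"
    by (simp_all add: g_def)
  \<comment> \<open>The transpose of \<open>g\<close>. Transposing twice gives the identity only up
    to the isomorphism \<open>t\<close>, so its inverse corrects the result.\<close>
  define p where "p = lunit C U \<cdot> (inv_arr C t \<cdot> ((g \<otimes>\<^sub>a idt C U) \<cdot> dual_unit U b \<eta> \<bbbone>))"
  have gu: "g \<cdot> (u \<otimes>\<^sub>a idt C b) = dual_counit U b \<epsilon> \<bbbone> \<cdot> (?l \<otimes>\<^sub>a idt C b)"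
    by (simp add: g_def)
  have "(g \<otimes>\<^sub>a idt C U) \<cdot> (dual_unit U b \<eta> \<bbbone> \<cdot> u) = ((g \<cdot> (u \<otimes>\<^sub>a idt C b)) \<otimes>\<^sub>a idt C U) \<cdot> dual_unit U b \<eta> U"
    by (simp add: dual_unit_natural[OF dual, of u U \<bbbone>] tens_comp_comp)
  also have "\<dots> = (dual_counit U b \<epsilon> \<bbbone> \<otimes>\<^sub>a idt C U) \<cdot> (((?l \<otimes>\<^sub>a idt C b) \<otimes>\<^sub>a idt C U) \<cdot> dual_unit U b \<eta> U)"
    by (simp add: gu tens_comp_comp)
  also have "\<dots> = t \<cdot> ?l"
    by (simp add: t_def dual_unit_natural[OF dual, of ?l U "\<bbbone> \<otimes>\<^sub>o U"])
  finally have "p \<cdot> u = idt C U"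
    by (simp add: p_def)
  then show ?thesis
    by (intro that[of p]) (simp_all add: p_def)
qed

section \<open>Idempotents of \<open>End(1)\<close> and von Neumann regularity\<close>

abbreviation unit_end :: "'b set"  (\<open>\<Z>\<close>) where
  "\<Z> \<equiv> homset C \<bbbone> \<bbbone>"

definition unit_idem :: "'b set"  (\<open>\<E>\<close>) where
  "\<E> = {e \<in> \<Z>. e \<cdot> e = e}"

abbreviation zero_end :: 'b  (\<open>\<zero>\<close>) where
  "\<zero> \<equiv> zero_arr C \<bbbone> \<bbbone>"

text \<open>The retraction is carried along with the subobject because \<open>u \<cdot> p\<close> is
  the idempotent that represents it.\<close>

definition unit_split :: "'b \<Rightarrow> 'b \<Rightarrow> bool" where
  "unit_split u p \<longleftrightarrow> u \<in> arr C \<and> p \<in> arr C \<and> tgt C u = \<bbbone> \<and> src C p = \<bbbone> \<and> tgt C p = src C u \<and>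
     p \<cdot> u = idt C (src C u)"

lemma unit_idemI: "\<lbrakk>e \<in> arr C; src C e = \<bbbone>; tgt C e = \<bbbone>; e \<cdot> e = e\<rbrakk> \<Longrightarrow> e \<in> \<E>"
  by (simp add: unit_idem_def)

lemma unit_idem_end: "e \<in> \<E> \<Longrightarrow> e \<in> \<Z>"
  by (simp add: unit_idem_def)

lemma unit_idem_simps [simp]:
  assumes "e \<in> \<E>"
  shows "e \<in> arr C" "src C e = \<bbbone>" "tgt C e = \<bbbone>" "e \<cdot> e = e"
  using assms by (auto simp: unit_idem_def)

lemma unit_split_simps:
  assumes "unit_split u p"
  shows "u \<in> arr C" "p \<in> arr C" "tgt C u = \<bbbone>" "src C p = \<bbbone>" "tgt C p = src C u" "p \<cdot> u = idt C (src C u)"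
  using assms by (auto simp: unit_split_def)

lemma unit_split_comp:
  assumes "unit_split u p" "k \<in> arr C" "tgt C k = src C u"
  shows "p \<cdot> (u \<cdot> k) = k"
  using comp_reduce[of p u "idt C (src C u)" k] unit_split_simps[OF assms(1)] assms(2,3) by simp

lemma unit_split_mono: "unit_split u p \<Longrightarrow> mono_arr C u"
  by (intro mono_arr_retract[of p]) (simp_all add: unit_split_simps)

lemma unit_split_exists:
  assumes "mono_arr C u" "tgt C u = \<bbbone>"
  obtains p where "unit_split u p"
proof -
  obtain p where "p \<in> arr C" "src C p = \<bbbone>" "tgt C p = src C u" "p \<cdot> u = idt C (src C u)"
    by (rule unit_mono_split[OF assms])
  then have "unit_split u p"
    using mono_arr_arr[OF assms(1)] assms(2) by (simp add: unit_split_def)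
  then show thesis
    by (rule that)
qed

lemma unit_split_idem: "unit_split u p \<Longrightarrow> u \<cdot> p \<in> \<E>"
  by (rule unit_idemI) (simp_all add: unit_split_simps unit_split_comp)

lemma zero_idem [simp]: "\<zero> \<in> \<E>"
  by (rule unit_idemI) simp_all

lemma unit_idem_complement:
  assumes "e \<in> \<E>"
  shows "\<exists>e'. e' \<in> \<E> \<and> e \<boxplus> e' = idt C \<bbbone> \<and> e \<cdot> e' = \<zero> \<and> e' \<cdot> e = \<zero>"
proof -
  note [simp] = unit_idem_simps[OF assms]
  obtain e' where e': "e' \<in> arr C" "src C e' = \<bbbone>" "tgt C e' = \<bbbone>" and sum: "idt C \<bbbone> = e \<boxplus> e'"
    by (rule minus_exists[of "idt C \<bbbone>" e]) auto
  note [simp] = e'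
  have "e \<boxplus> e \<cdot> e' = e \<cdot> (e \<boxplus> e')" "e \<boxplus> e' \<cdot> e = (e \<boxplus> e') \<cdot> e"
    by (simp_all add: comp_plus_simp plus_comp_simp)
  then have "e \<cdot> e' = \<zero>" "e' \<cdot> e = \<zero>"
    using plus_cancel_zero[of e "e \<cdot> e'"] plus_cancel_zero[of e "e' \<cdot> e"] by (simp_all flip: sum)
  moreover from this have "e' \<cdot> e' = (e \<boxplus> e') \<cdot> e'"
    by (simp add: plus_comp_simp)
  then have "e' \<cdot> e' = e'"
    by (simp flip: sum)
  then have "e' \<in> \<E>"
    by (intro unit_idemI) simp_all
  ultimately show ?thesis
    using sum by metis
qed

text \<open>This is \<open>1 - e\<close>, determined by the equation \<open>e + e' = 1\<close>;
  \<open>SOME\<close> replaces a subtraction on arrows.\<close>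

definition compl :: "'b \<Rightarrow> 'b" where
  "compl e = (SOME e'. e' \<in> \<E> \<and> e \<boxplus> e' = idt C \<bbbone> \<and> e \<cdot> e' = \<zero> \<and> e' \<cdot> e = \<zero>)"

lemma compl [simp]:
  assumes "e \<in> \<E>"
  shows "compl e \<in> \<E>" "e \<boxplus> compl e = idt C \<bbbone>" "e \<cdot> compl e = \<zero>" "compl e \<cdot> e = \<zero>"
  using someI_ex[OF unit_idem_complement[OF assms]] by (auto simp: compl_def)

lemma complementary_decomposition:
  assumes "e \<in> \<Z>" "e' \<in> \<Z>" "e \<boxplus> e' = idt C \<bbbone>" "f \<in> arr C" "tgt C f = \<bbbone>"
  shows "e \<cdot> f \<boxplus> e' \<cdot> f = f"
proof -
  have "(e \<boxplus> e') \<cdot> f = e \<cdot> f \<boxplus> e' \<cdot> f"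
    by (rule plus_comp_simp) (use assms in auto)
  then show ?thesis
    using assms by simp
qed

text \<open>Stated for an arbitrary \<open>e'\<close> with \<open>e + e' = 1\<close>, because the
  complement occurring in \<open>Supp\<close> comes from an arbitrary biproduct.\<close>

lemma complementary_zero_iff:
  assumes "e \<in> \<Z>" "e' \<in> \<Z>" "e \<boxplus> e' = idt C \<bbbone>" "f \<in> arr C" "tgt C f = \<bbbone>"
  shows "e' \<cdot> f = zero_arr C (src C f) \<bbbone> \<longleftrightarrow> e \<cdot> f = f"
proof
  assume "e' \<cdot> f = zero_arr C (src C f) \<bbbone>"
  then show "e \<cdot> f = f"
    using complementary_decomposition[OF assms] assms by simp
next
  assume "e \<cdot> f = f"
  then show "e' \<cdot> f = zero_arr C (src C f) \<bbbone>"
    using complementary_decomposition[OF assms] assms plus_cancel_zero[of f "e' \<cdot> f"] by simp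
qed

lemma compl_zero_iff:
  assumes "e \<in> \<E>" "f \<in> arr C" "tgt C f = \<bbbone>"
  shows "compl e \<cdot> f = zero_arr C (src C f) \<bbbone> \<longleftrightarrow> e \<cdot> f = f"
  by (rule complementary_zero_iff) (use assms unit_idem_end compl in blast)+

text \<open>The image of \<open>e\<close> is obtained as the kernel of \<open>1 - e\<close>.\<close>

lemma unit_idem_split:
  assumes "e \<in> \<E>"
  obtains u p where "unit_split u p" "u \<cdot> p = e"
proof -
  note [simp] = assms
  obtain k where k: "is_kernel C k (compl e)"
    using kernel_exists[of "compl e"] by auto
  have ks [simp]: "k \<in> arr C" "tgt C k = \<bbbone>" and ek: "compl e \<cdot> k = zero_arr C (src C k) \<bbbone>"
    using k by (auto simp: is_kernel_def)
  obtain h where h [simp]: "h \<in> arr C" "src C h = \<bbbone>" "tgt C h = src C k" "k \<cdot> h = e"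
    by (rule kernel_factor[OF k, of e]) auto
  have "e \<cdot> k = k"
    using ek compl_zero_iff[of e k] by simp
  then have "k \<cdot> (h \<cdot> k) = k \<cdot> idt C (src C k)"
    by (simp add: comp_reduce[OF h(4)])
  then have "h \<cdot> k = idt C (src C k)"
    by (intro mono_arrD[OF kernel_mono[OF k], of "h \<cdot> k" "idt C (src C k)"]) simp_all
  then show ?thesis
    by (intro that[of k h]) (simp_all add: unit_split_def)
qed

text \<open>\<open>Z\<close> is von Neumann regular: a kernel of \<open>z\<close> splits off, and on its complement \<open>z\<close> is a
  monomorphism into \<open>\<bbbone>\<close>, hence splits too.\<close>

lemma unit_end_regular:
  assumes z: "z \<in> \<Z>"
  obtains g w where "g \<in> \<E>" "w \<in> \<Z>" "g = z \<cdot> w" "g \<cdot> z = z"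
proof -
  note [simp] = z[simplified]
  obtain k where k: "is_kernel C k z"
    using kernel_exists[of z] by auto
  have [simp]: "k \<in> arr C" "tgt C k = \<bbbone>" and zk: "z \<cdot> k = zero_arr C (src C k) \<bbbone>"
    using k by (auto simp: is_kernel_def)
  obtain r where r: "unit_split k r"
    by (rule unit_split_exists[OF kernel_mono[OF k]]) simp
  have e [simp]: "k \<cdot> r \<in> \<E>"
    by (rule unit_split_idem[OF r])
  obtain u p where p: "unit_split u p" and up: "u \<cdot> p = compl (k \<cdot> r)"
    by (rule unit_idem_split[OF compl(1)[OF e]])
  note [simp] = unit_split_simps[OF r] unit_split_comp[OF r] unit_split_simps[OF p] unit_split_comp[OF p]
  have zup: "z \<cdot> (u \<cdot> p) = z"
  proof -
    have "z = z \<cdot> (k \<cdot> r \<boxplus> compl (k \<cdot> r))"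
      by simp
    also have "\<dots> = z \<cdot> (k \<cdot> r) \<boxplus> z \<cdot> compl (k \<cdot> r)"
      by (rule comp_plus_simp) simp_all
    also have "z \<cdot> (k \<cdot> r) = \<zero>"
      by (simp add: comp_reduce[OF zk])
    finally show ?thesis
      by (simp add: up)
  qed
  have "mono_arr C (z \<cdot> u)"
  proof (rule mono_arrI_zero)
    fix f
    assume f: "f \<in> arr C" "tgt C f = src C (z \<cdot> u)" "(z \<cdot> u) \<cdot> f = zero_arr C (src C f) (tgt C (z \<cdot> u))"
    then obtain h where h: "h \<in> arr C" "src C h = src C f" "tgt C h = src C k" "k \<cdot> h = u \<cdot> f"
      using kernel_factor[OF k, of "u \<cdot> f"] by auto
    \<comment> \<open>\<open>u f\<close> lies in the kernel \<open>k\<close>, yet is fixed by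
      \<open>u p = 1 - k r\<close>, which annihilates \<open>k\<close>.\<close>
    have "f = p \<cdot> ((u \<cdot> p) \<cdot> (u \<cdot> f))"
      using f by simp
    also have "\<dots> = p \<cdot> ((compl (k \<cdot> r) \<cdot> ((k \<cdot> r) \<cdot> k)) \<cdot> h)"
      unfolding up using h by simp
    also have "\<dots> = p \<cdot> (((compl (k \<cdot> r) \<cdot> (k \<cdot> r)) \<cdot> k) \<cdot> h)"
      using h by (simp del: compl(4))
    also have "\<dots> = zero_arr C (src C f) (src C u)"
      unfolding compl(4)[OF e] using h f(1) by simp
    finally show "f = zero_arr C (src C f) (src C (z \<cdot> u))"
      by simp
  qed simp
  then obtain s where s: "unit_split (z \<cdot> u) s"
    by (rule unit_split_exists) simp
  then have [simp]: "s \<in> arr C" "src C s = \<bbbone>" "tgt C s = src C u" and szu: "s \<cdot> (z \<cdot> u) = idt C (src C u)"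
    by (auto simp: unit_split_def)
  have "(z \<cdot> u) \<cdot> s \<in> \<E>"
    by (rule unit_split_idem[OF s])
  moreover have "((z \<cdot> u) \<cdot> s) \<cdot> z = z"
  proof -
    have "((z \<cdot> u) \<cdot> s) \<cdot> z = ((z \<cdot> u) \<cdot> s) \<cdot> (z \<cdot> (u \<cdot> p))"
      by (simp add: zup)
    also have "\<dots> = z \<cdot> (u \<cdot> ((s \<cdot> (z \<cdot> u)) \<cdot> p))"
      by simp
    also have "\<dots> = z"
      using zup by (simp add: szu)
    finally show ?thesis .
  qed
  ultimately show ?thesis
    by (intro that[of "(z \<cdot> u) \<cdot> s" "u \<cdot> s"]) simp_all
qed

section \<open>Supports\<close>

text \<open>The scalar action of \<open>End(1)\<close> that makes the category linear over this
  ring: for each \<open>z\<close> a natural endomorphism of the identity functor.\<close>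

definition act :: "'b \<Rightarrow> 'a \<Rightarrow> 'b" where
  "act z a = runit C a \<cdot> ((idt C a \<otimes>\<^sub>a z) \<cdot> inv_arr C (runit C a))"

lemma act_simps [simp]:
  assumes "z \<in> \<Z>" "a \<in> obj C"
  shows "act z a \<in> arr C" "src C (act z a) = a" "tgt C (act z a) = a"
  using assms by (simp_all add: act_def)

lemma act_natural:
  assumes "z \<in> \<Z>" "f \<in> arr C" "src C f = a" "tgt C f = b"
  shows "act z b \<cdot> f = f \<cdot> act z a"
proof -
  have [simp]: "a \<in> obj C" "b \<in> obj C"
    using assms by auto
  note [simp] = assms[simplified]
  show ?thesis
    using comp_rewrite[OF runit_natural_arr[of f a b, symmetric]]
    by (simp add: act_def runit_inv_natural[of f a b] tens_comp_comp)
qed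

lemma act_comp:
  assumes "z \<in> \<Z>" "w \<in> \<Z>" "a \<in> obj C"
  shows "act z a \<cdot> act w a = act (z \<cdot> w) a"
  using assms by (simp add: act_def tens_comp_comp)

text \<open>The formula gives a conjugate of \<open>z\<close> by an automorphism of the unit, which
  is \<open>z\<close> itself because \<open>End(1)\<close> is commutative.\<close>

lemma act_unit:
  assumes "z \<in> \<Z>"
  shows "act z \<bbbone> = z"
proof -
  let ?l = "lunit C \<bbbone>" and ?r = "runit C \<bbbone>"
  note [simp] = assms[simplified]
  have "idt C \<bbbone> \<otimes>\<^sub>a z = inv_arr C ?l \<cdot> (z \<cdot> ?l)"
    by (simp flip: lunit_natural_arr[of z \<bbbone> \<bbbone>])
  then have "act z \<bbbone> = (?r \<cdot> inv_arr C ?l) \<cdot> (z \<cdot> (?l \<cdot> inv_arr C ?r))"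
    by (simp add: act_def)
  also have "\<dots> = (z \<cdot> (?l \<cdot> inv_arr C ?r)) \<cdot> (?r \<cdot> inv_arr C ?l)"
    by (rule unit_end_commute) simp_all
  finally show ?thesis
    by simp
qed

lemma act_zero_iff:
  assumes "z \<in> \<Z>" "a \<in> obj C"
  shows "act z a = zero_arr C a a \<longleftrightarrow> idt C a \<otimes>\<^sub>a z = zero_arr C (a \<otimes>\<^sub>o \<bbbone>) (a \<otimes>\<^sub>o \<bbbone>)"
  using assms iso_comp_zero_iff[of "runit C a" "(idt C a \<otimes>\<^sub>a z) \<cdot> inv_arr C (runit C a)"]
    comp_iso_zero_iff[of "inv_arr C (runit C a)" "idt C a \<otimes>\<^sub>a z"]
  by (simp add: act_def)

text \<open>Under \<open>Hom(a, a) = Hom(1, b \<otimes> a)\<close> the scalar \<open>z\<close> on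
  \<open>a\<close> corresponds to \<open>\<eta> \<cdot> z\<close>. One direction recognizes
  \<open>\<eta> \<otimes> z\<close> inside \<open>(b \<otimes> a) \<otimes> z\<close>; the other
  recovers \<open>a \<otimes> z\<close> from \<open>\<eta> \<cdot> z\<close> by a zigzag.\<close>

lemma act_zero_iff_dual:
  assumes dual: "is_dual C a b \<eta> \<epsilon>" and z: "z \<in> \<Z>"
  shows "act z a = zero_arr C a a \<longleftrightarrow> \<eta> \<cdot> z = zero_arr C \<bbbone> (b \<otimes>\<^sub>o a)"
proof -
  note [simp] = dual_simps[OF dual] z[simplified]
  have "\<eta> \<cdot> z = zero_arr C \<bbbone> (b \<otimes>\<^sub>o a)" if *: "idt C a \<otimes>\<^sub>a z = zero_arr C (a \<otimes>\<^sub>o \<bbbone>) (a \<otimes>\<^sub>o \<bbbone>)"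
  proof -
    have "assoc C b a \<bbbone> \<cdot> (idt C (b \<otimes>\<^sub>o a) \<otimes>\<^sub>a z) = zero_arr C ((b \<otimes>\<^sub>o a) \<otimes>\<^sub>o \<bbbone>) (b \<otimes>\<^sub>o (a \<otimes>\<^sub>o \<bbbone>))"
      using assoc_natural_arr[of "idt C b" "idt C a" z b a \<bbbone> b a \<bbbone>] by (simp add: *)
    then have "idt C (b \<otimes>\<^sub>o a) \<otimes>\<^sub>a z = zero_arr C ((b \<otimes>\<^sub>o a) \<otimes>\<^sub>o \<bbbone>) ((b \<otimes>\<^sub>o a) \<otimes>\<^sub>o \<bbbone>)"
      using iso_comp_zero_iff[of "assoc C b a \<bbbone>" "idt C (b \<otimes>\<^sub>o a) \<otimes>\<^sub>a z"] by simp
    then have "(idt C (b \<otimes>\<^sub>o a) \<otimes>\<^sub>a z) \<cdot> (\<eta> \<otimes>\<^sub>a idt C \<bbbone>) = zero_arr C (\<bbbone> \<otimes>\<^sub>o \<bbbone>) ((b \<otimes>\<^sub>o a) \<otimes>\<^sub>o \<bbbone>)"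
      by simp
    then show ?thesis
      using unit_tens_zero_iff[of z \<eta>] by (simp add: tens_comp)
  qed
  moreover have "idt C a \<otimes>\<^sub>a z = zero_arr C (a \<otimes>\<^sub>o \<bbbone>) (a \<otimes>\<^sub>o \<bbbone>)" if *: "\<eta> \<cdot> z = zero_arr C \<bbbone> (b \<otimes>\<^sub>o a)"
  proof -
    have "runit C a \<cdot> (idt C a \<otimes>\<^sub>a z)
        = (lunit C a \<cdot> ((\<epsilon> \<otimes>\<^sub>a idt C a) \<cdot> (inv_arr C (assoc C a b a) \<cdot> (idt C a \<otimes>\<^sub>a \<eta>)))) \<cdot> (idt C a \<otimes>\<^sub>a z)"
      by (simp only: zigzag(1)[OF dual])
    also have "\<dots> = zero_arr C (a \<otimes>\<^sub>o \<bbbone>) a"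
      by (simp add: tens_comp *)
    finally show ?thesis
      using iso_comp_zero_iff[of "runit C a" "idt C a \<otimes>\<^sub>a z"] by simp
  qed
  ultimately show ?thesis
    using act_zero_iff[OF z] by auto
qed

text \<open>\<open>z\<close> annihilates \<open>a\<close> iff it factors through the kernel of
  \<eta>, that is, iff the idempotent of that kernel fixes it. The representative \<open>i\<close>
  is kept apart from \<open>k\<close> because a complementary pair may be witnessed by any member of
  the class.\<close>

lemma dual_unit_kernel_supp:
  assumes dual: "is_dual C a b \<eta> \<epsilon>" and k: "is_kernel C k \<eta>" and z: "z \<in> \<Z>"
    and r: "unit_split i r" "factors_through C i k" "factors_through C k i"
  shows "act z a = zero_arr C a a \<longleftrightarrow> (i \<cdot> r) \<cdot> z = z"
proof -
  note [simp] = dual_simps[OF dual] z[simplified] unit_split_simps[OF r(1)] unit_split_comp[OF r(1)]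
  have k' [simp]: "k \<in> arr C" "tgt C k = \<bbbone>" "\<eta> \<cdot> k = zero_arr C (src C k) (b \<otimes>\<^sub>o a)"
    using k by (auto simp: is_kernel_def)
  obtain x where x: "x \<in> arr C" "src C x = src C i" "tgt C x = src C k" "i = k \<cdot> x"
    using r(2) by (auto simp: factors_through_def)
  obtain y where y: "y \<in> arr C" "src C y = src C k" "tgt C y = src C i" "k = i \<cdot> y"
    using r(3) by (auto simp: factors_through_def)
  have "\<eta> \<cdot> (k \<cdot> x) = zero_arr C (src C i) (b \<otimes>\<^sub>o a)"
    using x(1-3) by (simp add: comp_reduce[OF k'(3)])
  then have "\<eta> \<cdot> i = zero_arr C (src C i) (b \<otimes>\<^sub>o a)"
    by (simp flip: x(4))
  then have \<eta>i: "\<eta> \<cdot> ((i \<cdot> r) \<cdot> z) = zero_arr C \<bbbone> (b \<otimes>\<^sub>o a)"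
    by (simp add: comp_reduce[of \<eta> i])
  have "(i \<cdot> r) \<cdot> z = z" if \<eta>z: "\<eta> \<cdot> z = zero_arr C \<bbbone> (b \<otimes>\<^sub>o a)"
  proof -
    obtain h where h: "h \<in> arr C" "src C h = \<bbbone>" "tgt C h = src C k" "k \<cdot> h = z"
      using kernel_factor[OF k, of z] \<eta>z by auto
    have "z = (i \<cdot> y) \<cdot> h"
      using h(4) by (simp flip: y(4))
    then have "z = i \<cdot> (y \<cdot> h)"
      using h(1-3) y(1-3) by simp
    then show ?thesis
      using h(1-3) y(1-3) by simp
  qed
  then show ?thesis
    using \<eta>i act_zero_iff_dual[OF dual z] by metis
qed

text \<open>An idempotent of a commutative ring is determined by its annihilator: as
  \<open>f\<close> kills \<open>1 - f\<close>, so does \<open>e\<close>, whence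
  \<open>e f = e\<close>; symmetrically \<open>f e = f\<close>.\<close>

lemma unit_idem_ext:
  assumes e: "e \<in> \<E>" and f: "f \<in> \<E>" and eq: "\<And>z. z \<in> \<Z> \<Longrightarrow> e \<cdot> z = \<zero> \<longleftrightarrow> f \<cdot> z = \<zero>"
  shows "e = f"
proof -
  have absorb: "x \<cdot> y = x"
    if x: "x \<in> \<E>" and y: "y \<in> \<E>" and xy: "\<And>z. z \<in> \<Z> \<Longrightarrow> y \<cdot> z = \<zero> \<Longrightarrow> x \<cdot> z = \<zero>" for x y
  proof -
    note [simp] = x y
    have "x \<cdot> compl y = \<zero>"
      by (rule xy) simp_all
    then have "compl y \<cdot> x = zero_arr C (src C x) \<bbbone>"
      using unit_end_commute[of x "compl y"] by simp
    then have "y \<cdot> x = x"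
      using compl_zero_iff[OF y, of x] by simp
    then show ?thesis
      using unit_end_commute[of x y] by simp
  qed
  have "e \<cdot> f = e" "f \<cdot> e = f"
    using absorb[OF e f] absorb[OF f e] eq by blast+
  then show ?thesis
    using unit_end_commute[of e f] unit_idem_end[OF e] unit_idem_end[OF f] by simp
qed

text \<open>The idempotent with the same annihilator as \<open>a\<close>. Described this way it
  involves no choice of dual, and \<open>unit_idem_ext\<close> gives uniqueness.\<close>

definition supp_idem :: "'a \<Rightarrow> 'b" where
  "supp_idem a = (THE s. s \<in> \<E> \<and> (\<forall>z\<in>\<Z>. act z a = zero_arr C a a \<longleftrightarrow> s \<cdot> z = \<zero>))"

lemma supp_idem_eqI:
  assumes "s \<in> \<E>" "\<And>z. z \<in> \<Z> \<Longrightarrow> act z a = zero_arr C a a \<longleftrightarrow> s \<cdot> z = \<zero>"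
  shows "supp_idem a = s"
  unfolding supp_idem_def
proof (rule the_equality)
  show "s \<in> \<E> \<and> (\<forall>z\<in>\<Z>. act z a = zero_arr C a a \<longleftrightarrow> s \<cdot> z = \<zero>)"
    using assms by blast
  show "t = s" if "t \<in> \<E> \<and> (\<forall>z\<in>\<Z>. act z a = zero_arr C a a \<longleftrightarrow> t \<cdot> z = \<zero>)" for t
    by (rule unit_idem_ext) (use that assms in blast)+
qed

text \<open>Every choice of dual, kernel, representative and complement leads to the same
  idempotent. This serves both the existence of \<open>supp_idem\<close> and the uniqueness in
  \<open>Supp\<close>.\<close>

lemma supp_idem_of_kernel:
  assumes dual: "is_dual C a b \<eta> \<epsilon>" and k: "is_kernel C k \<eta>"
    and i: "unit_split i r" "factors_through C i k" "factors_through C k i"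
    and s: "s \<in> \<E>" "(i \<cdot> r) \<boxplus> s = idt C \<bbbone>"
  shows "supp_idem a = s"
proof (rule supp_idem_eqI)
  fix z
  assume z: "z \<in> \<Z>"
  show "act z a = zero_arr C a a \<longleftrightarrow> s \<cdot> z = \<zero>"
    using dual_unit_kernel_supp[OF dual k z i] z
      complementary_zero_iff[OF unit_idem_end[OF unit_split_idem[OF i(1)]] unit_idem_end[OF s(1)] s(2), of z]
    by simp
qed (fact s)

lemma supp_kernel_exists:
  assumes "a \<in> obj C"
  obtains b \<eta> \<epsilon> k r where "is_dual C a b \<eta> \<epsilon>" "is_kernel C k \<eta>" "unit_split k r"
    "supp_idem a = compl (k \<cdot> r)"
proof -
  obtain b \<eta> \<epsilon> where dual: "is_dual C a b \<eta> \<epsilon>"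
    using dual_exists[OF assms] by blast
  then obtain k where k: "is_kernel C k \<eta>"
    using kernel_exists[of \<eta>] dual_simps(3)[OF dual] by blast
  then have "k \<in> arr C" "tgt C k = \<bbbone>"
    using dual_simps(4)[OF dual] by (auto simp: is_kernel_def)
  then obtain r where r: "unit_split k r"
    using unit_split_exists[OF kernel_mono[OF k]] by blast
  have "supp_idem a = compl (k \<cdot> r)"
    using unit_split_idem[OF r] \<open>k \<in> arr C\<close>
    by (intro supp_idem_of_kernel[OF dual k r] factors_through_refl compl)
  then show thesis
    using that[OF dual k r] by blast
qed

lemma supp_idem [simp]: "a \<in> obj C \<Longrightarrow> supp_idem a \<in> \<E>"
  using supp_kernel_exists[of a] compl(1)[OF unit_split_idem] by metis

lemma act_zero_iff_supp:
  assumes a: "a \<in> obj C" and z: "z \<in> \<Z>"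
  shows "act z a = zero_arr C a a \<longleftrightarrow> supp_idem a \<cdot> z = \<zero>"
proof -
  obtain b \<eta> \<epsilon> k r where *: "is_dual C a b \<eta> \<epsilon>" "is_kernel C k \<eta>" "unit_split k r"
    "supp_idem a = compl (k \<cdot> r)"
    using supp_kernel_exists[OF a] by blast
  have "k \<in> arr C"
    using *(3) by (rule unit_split_simps)
  then show ?thesis
    using dual_unit_kernel_supp[OF *(1,2) z *(3) factors_through_refl factors_through_refl]
      compl_zero_iff[OF unit_split_idem[OF *(3)], of z] z *(4)
    by simp
qed

lemma supp_le_iff:
  assumes a: "a \<in> obj C" and e: "e \<in> \<E>"
  shows "e \<cdot> supp_idem a = supp_idem a \<longleftrightarrow> act (compl e) a = zero_arr C a a"
proof -
  note [simp] = a e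
  show ?thesis
    using act_zero_iff_supp[OF a, of "compl e"] unit_end_commute[of "supp_idem a" "compl e"]
      compl_zero_iff[OF e, of "supp_idem a"]
    by simp
qed

text \<open>Inclusion of annihilators reverses the order of supports; test it on the complement of
  \<open>supp_idem b\<close>, which annihilates \<open>b\<close>.\<close>

lemma supp_le_of_act:
  assumes a: "a \<in> obj C" and b: "b \<in> obj C"
    and ab: "\<And>z. z \<in> \<Z> \<Longrightarrow> act z b = zero_arr C b b \<Longrightarrow> act z a = zero_arr C a a"
  shows "supp_idem b \<cdot> supp_idem a = supp_idem a"
proof -
  have "act (compl (supp_idem b)) b = zero_arr C b b"
    using supp_le_iff[OF b supp_idem[OF b]] b by simp
  then have "act (compl (supp_idem b)) a = zero_arr C a a"
    using ab unit_idem_end[OF compl(1)[OF supp_idem[OF b]]] by blast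
  then show ?thesis
    using supp_le_iff[OF a supp_idem[OF b]] by simp
qed

text \<open>By naturality \<open>z \<cdot> u\<close> is \<open>u\<close> after the action of
  \<open>z\<close> on its source. As \<open>u\<close> is monic with retraction \<open>p\<close>, the
  action vanishes exactly when \<open>z\<close> kills \<open>u \<cdot> p\<close>.\<close>

lemma supp_idem_split:
  assumes r: "unit_split u p"
  shows "supp_idem (src C u) = u \<cdot> p"
proof (rule supp_idem_eqI)
  note [simp] = unit_split_simps[OF r] unit_split_comp[OF r]
  show "u \<cdot> p \<in> \<E>"
    by (rule unit_split_idem[OF r])
  fix z
  assume z: "z \<in> \<Z>"
  note [simp] = z[simplified]
  let ?U = "src C u"
  have zu: "z \<cdot> u = u \<cdot> act z ?U"
    using act_natural[OF z, of u ?U \<bbbone>] by (simp add: act_unit)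
  have comm: "(u \<cdot> p) \<cdot> z = z \<cdot> (u \<cdot> p)"
    by (rule unit_end_commute) simp_all
  show "act z ?U = zero_arr C ?U ?U \<longleftrightarrow> (u \<cdot> p) \<cdot> z = \<zero>"
  proof
    assume "act z ?U = zero_arr C ?U ?U"
    then show "(u \<cdot> p) \<cdot> z = \<zero>"
      unfolding comm using comp_reduce[OF zu, of p] by simp
  next
    assume "(u \<cdot> p) \<cdot> z = \<zero>"
    then have "(z \<cdot> (u \<cdot> p)) \<cdot> u = \<zero> \<cdot> u"
      unfolding comm by simp
    then have "u \<cdot> act z ?U = u \<cdot> zero_arr C ?U ?U"
      using zu by simp
    then show "act z ?U = zero_arr C ?U ?U"
      by (rule mono_arrD[OF unit_split_mono[OF r]]) simp_all
  qed
qed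

text \<open>The action of \<open>e\<close> on the middle object factors through the quotient
  \<open>g\<close>, and \<open>g\<close> composed with it is zero. So its square vanishes, and for
  an idempotent the square is the action itself.\<close>

lemma act_idem_zero_ext:
  assumes e: "e \<in> \<E>" and ex: "short_exact C f g"
    and f: "act e (src C f) = zero_arr C (src C f) (src C f)"
    and g: "act e (tgt C g) = zero_arr C (tgt C g) (tgt C g)"
  shows "act e (src C g) = zero_arr C (src C g) (src C g)"
proof -
  define b where "b = src C g"
  have k: "is_kernel C f g" and c: "is_cokernel C g f"
    using ex by (auto simp: short_exact_def)
  have [simp]: "f \<in> arr C" "g \<in> arr C" "tgt C f = b" "src C g = b"
    using k by (auto simp: is_kernel_def b_def)
  have [simp]: "b \<in> obj C"
    using src_obj[of g] by simp
  note [simp] = e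
  have "act e b \<cdot> f = zero_arr C (src C f) b"
    using act_natural[of e f "src C f" b] f by simp
  then obtain h where h: "h \<in> arr C" "src C h = tgt C g" "tgt C h = b" "h \<cdot> g = act e b"
    using cokernel_factor[OF c, of "act e b"] by auto
  have "g \<cdot> act e b = zero_arr C b (tgt C g)"
    using act_natural[of e g b "tgt C g"] g by simp
  then have "h \<cdot> (g \<cdot> act e b) = zero_arr C b b"
    using h by simp
  then have "act e b \<cdot> act e b = zero_arr C b b"
    using h comp_reduce[OF h(4), of "act e b"] by simp
  then show ?thesis
    using act_comp[of e e b] by simp
qed

lemma act_zero_mono:
  assumes z: "z \<in> \<Z>" and f: "mono_arr C f"
    and b: "act z (tgt C f) = zero_arr C (tgt C f) (tgt C f)"
  shows "act z (src C f) = zero_arr C (src C f) (src C f)"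
proof -
  have [simp]: "f \<in> arr C"
    using f by (rule mono_arr_arr)
  have "f \<cdot> act z (src C f) = f \<cdot> zero_arr C (src C f) (src C f)"
    using act_natural[OF z, of f "src C f" "tgt C f"] b by simp
  then show ?thesis
    using z by (intro mono_arrD[OF f, of "act z (src C f)" "zero_arr C (src C f) (src C f)"]) simp_all
qed

lemma act_zero_cokernel:
  assumes z: "z \<in> \<Z>" and g: "is_cokernel C g f"
    and b: "act z (src C g) = zero_arr C (src C g) (src C g)"
  shows "act z (tgt C g) = zero_arr C (tgt C g) (tgt C g)"
proof -
  have [simp]: "g \<in> arr C"
    using g by (simp add: is_cokernel_def)
  have "act z (tgt C g) \<cdot> g = zero_arr C (src C g) (tgt C g)"
    using act_natural[OF z, of g "src C g" "tgt C g"] b by simp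
  then show ?thesis
    using cokernel_epi_zero[OF g, of "act z (tgt C g)"] z by simp
qed

lemma act_zero_tens:
  assumes z: "z \<in> \<Z>" and [simp]: "a \<in> obj C" "b \<in> obj C" and b: "act z b = zero_arr C b b"
  shows "act z (a \<otimes>\<^sub>o b) = zero_arr C (a \<otimes>\<^sub>o b) (a \<otimes>\<^sub>o b)"
proof -
  note [simp] = z[simplified]
  have *: "idt C b \<otimes>\<^sub>a z = zero_arr C (b \<otimes>\<^sub>o \<bbbone>) (b \<otimes>\<^sub>o \<bbbone>)"
    using b act_zero_iff[OF z, of b] by simp
  have "assoc C a b \<bbbone> \<cdot> (idt C (a \<otimes>\<^sub>o b) \<otimes>\<^sub>a z) = zero_arr C ((a \<otimes>\<^sub>o b) \<otimes>\<^sub>o \<bbbone>) (a \<otimes>\<^sub>o (b \<otimes>\<^sub>o \<bbbone>))"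
    using assoc_natural_arr[of "idt C a" "idt C b" z a b \<bbbone> a b \<bbbone>] by (simp add: *)
  then show ?thesis
    using iso_comp_zero_iff[of "assoc C a b \<bbbone>" "idt C (a \<otimes>\<^sub>o b) \<otimes>\<^sub>a z"] act_zero_iff[OF z, of "a \<otimes>\<^sub>o b"]
    by simp
qed

section \<open>Subobjects of the unit as idempotents\<close>

lemma unit_split_factors_iff:
  assumes u: "unit_split u p" and v: "unit_split v q"
  shows "factors_through C u v \<longleftrightarrow> (v \<cdot> q) \<cdot> (u \<cdot> p) = u \<cdot> p"
proof
  note [simp] = unit_split_simps[OF u] unit_split_comp[OF u] unit_split_simps[OF v] unit_split_comp[OF v]
  show "(v \<cdot> q) \<cdot> (u \<cdot> p) = u \<cdot> p" if uv: "factors_through C u v"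
  proof -
    obtain h where h: "h \<in> arr C" "src C h = src C u" "tgt C h = src C v" "u = v \<cdot> h"
      using uv by (rule factors_throughE)
    have "(v \<cdot> q) \<cdot> (v \<cdot> h) = v \<cdot> h"
      using h(1-3) by simp
    then have "(v \<cdot> q) \<cdot> u = u"
      by (simp only: h(4)[symmetric])
    then show ?thesis
      using comp_reduce[of "v \<cdot> q" u u p] by simp
  qed
  show "factors_through C u v" if *: "(v \<cdot> q) \<cdot> (u \<cdot> p) = u \<cdot> p"
  proof (rule factors_throughI[of "q \<cdot> u"])
    have "((v \<cdot> q) \<cdot> (u \<cdot> p)) \<cdot> u = (u \<cdot> p) \<cdot> u"
      by (simp only: *)
    then show "u = v \<cdot> (q \<cdot> u)"
      by simp
  qed simp_all
qed

lemma unit_split_monos_into: "unit_split u p \<Longrightarrow> u \<in> monos_into C \<bbbone>"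
  using unit_split_mono unit_split_simps(3) by (auto simp: monos_into_def)

text \<open>The image of \<open>e\<close> as a subobject; by \<open>sub_of_split\<close> the chosen
  splitting does not affect the class.\<close>

definition sub_of :: "'b \<Rightarrow> 'b set" where
  "sub_of e = subobj_class C (SOME u. \<exists>p. unit_split u p \<and> u \<cdot> p = e)"

lemma sub_of_split:
  assumes u: "unit_split u p"
  shows "sub_of (u \<cdot> p) = subobj_class C u"
proof -
  define v where "v = (SOME v. \<exists>q. unit_split v q \<and> v \<cdot> q = u \<cdot> p)"
  have "\<exists>v. \<exists>q. unit_split v q \<and> v \<cdot> q = u \<cdot> p"
    using u by blast
  then have "\<exists>q. unit_split v q \<and> v \<cdot> q = u \<cdot> p"
    unfolding v_def by (rule someI_ex)
  then obtain q where v: "unit_split v q" and vq: "v \<cdot> q = u \<cdot> p"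
    by blast
  have "factors_through C u v" "factors_through C v u"
    using unit_split_factors_iff[OF u v] unit_split_factors_iff[OF v u]
      unit_idem_simps(4)[OF unit_split_idem[OF u]] by (simp_all only: vq)
  then have "v \<in> subobj_class C u"
    using unit_split_monos_into[OF v] unit_split_simps(3)[OF u] by (simp add: subobj_class_def)
  then have "subobj_class C v = subobj_class C u"
    using subobj_class_eqI[OF unit_split_monos_into[OF u]] by blast
  then show ?thesis
    by (simp add: sub_of_def v_def)
qed

lemma subobjects_unit: "subobjects C \<bbbone> = sub_of ` \<E>"
proof (intro equalityI subsetI)
  fix S
  assume "S \<in> subobjects C \<bbbone>"
  then obtain m where m: "mono_arr C m" "tgt C m = \<bbbone>" "S = subobj_class C m"
    by (auto simp: subobjects_def monos_into_def)
  obtain p where p: "unit_split m p"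
    by (rule unit_split_exists[OF m(1,2)])
  show "S \<in> sub_of ` \<E>"
    using sub_of_split[OF p] unit_split_idem[OF p] m(3) by blast
next
  fix S
  assume "S \<in> sub_of ` \<E>"
  then obtain e where e: "e \<in> \<E>" "S = sub_of e"
    by blast
  obtain u p where "unit_split u p" "u \<cdot> p = e"
    by (rule unit_idem_split[OF e(1)])
  then show "S \<in> subobjects C \<bbbone>"
    using sub_of_split unit_split_monos_into e(2) by (auto simp: subobjects_def)
qed

lemma sub_of_le_iff:
  assumes e: "e \<in> \<E>" and f: "f \<in> \<E>"
  shows "subobj_le C (sub_of e) (sub_of f) \<longleftrightarrow> f \<cdot> e = e"
proof -
  obtain u p where u: "unit_split u p" "u \<cdot> p = e"
    by (rule unit_idem_split[OF e])
  obtain v q where v: "unit_split v q" "v \<cdot> q = f"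
    by (rule unit_idem_split[OF f])
  have uv: "u \<in> arr C" "v \<in> arr C"
    using u(1) v(1) by (simp_all add: unit_split_simps)
  have "subobj_le C (subobj_class C u) (subobj_class C v) \<longleftrightarrow> factors_through C u v"
  proof
    assume "subobj_le C (subobj_class C u) (subobj_class C v)"
    then obtain m n where mn: "mono_arr C m" "mono_arr C n" "factors_through C u m"
      "factors_through C m n" "factors_through C n v"
      by (auto simp: subobj_le_def subobj_class_def monos_into_def)
    then show "factors_through C u v"
      using factors_through_trans mono_arr_arr uv by blast
  next
    assume "factors_through C u v"
    then show "subobj_le C (subobj_class C u) (subobj_class C v)"
      using subobj_class_self unit_split_monos_into u(1) v(1) unfolding subobj_le_def by blast
  qed
  then show ?thesis
    using sub_of_split[OF u(1)] sub_of_split[OF v(1)] unit_split_factors_iff[OF u(1) v(1)] u(2) v(2)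
    by simp
qed

lemma sub_of_inj: "inj_on sub_of \<E>"
proof (rule inj_onI)
  fix e f
  assume e: "e \<in> \<E>" and f: "f \<in> \<E>" and eq: "sub_of e = sub_of f"
  then have "f \<cdot> e = e" "e \<cdot> f = f"
    using sub_of_le_iff[OF e e] sub_of_le_iff[OF e f] sub_of_le_iff[OF f e] by simp_all
  then show "e = f"
    using unit_end_commute[of e f] e f by simp
qed

text \<open>Existence assembles a biproduct from the splittings of \<open>k r\<close> and its
  complement. Uniqueness, demanded by \<open>THE\<close> over all duals, kernels and complements, is
  \<open>supp_idem_of_kernel\<close>.\<close>

lemma Supp_eq:
  assumes a: "a \<in> obj C"
  shows "Supp C a = sub_of (supp_idem a)"
  unfolding Supp_def
proof (rule the_equality)
  obtain b \<eta> \<epsilon> k r where dual: "is_dual C a b \<eta> \<epsilon>" and k: "is_kernel C k \<eta>" and r: "unit_split k r"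
    and s: "supp_idem a = compl (k \<cdot> r)"
    by (rule supp_kernel_exists[OF a])
  note [simp] = unit_split_idem[OF r] unit_split_simps[OF r] unit_split_comp[OF r]
  obtain u p where u: "unit_split u p" and up: "u \<cdot> p = compl (k \<cdot> r)"
    by (rule unit_idem_split[OF compl(1)[OF unit_split_idem[OF r]]])
  note [simp] = unit_split_simps[OF u] unit_split_comp[OF u]
  \<comment> \<open>Orthogonality of the two idempotents is pulled back to orthogonality of their
    splittings.\<close>
  have "r \<cdot> u = r \<cdot> (((k \<cdot> r) \<cdot> (u \<cdot> p)) \<cdot> u)"
    by simp
  also have "\<dots> = zero_arr C (src C u) (src C k)"
    unfolding up by simp
  finally have ru: "r \<cdot> u = zero_arr C (src C u) (src C k)" .
  have "p \<cdot> k = p \<cdot> (((u \<cdot> p) \<cdot> (k \<cdot> r)) \<cdot> k)"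
    by simp
  also have "\<dots> = zero_arr C (src C k) (src C u)"
    unfolding up by (simp del: comp_assoc_simp)
  finally have pk: "p \<cdot> k = zero_arr C (src C k) (src C u)" .
  have "biproduct C (src C k) (src C u) \<bbbone> k u r p"
    unfolding biproduct_def using ru pk up by simp
  moreover have "k \<in> subobj_class C k" "u \<in> subobj_class C u"
    "subobj_class C k \<in> subobjects C \<bbbone>" "subobj_class C u \<in> subobjects C \<bbbone>"
    using unit_split_monos_into[OF r] unit_split_monos_into[OF u] subobj_class_self
    by (auto simp: subobjects_def)
  ultimately have "complementary C \<bbbone> (subobj_class C k) (subobj_class C u)"
    unfolding complementary_def by blast
  then show "\<exists>b \<eta> \<epsilon> k. is_dual C a b \<eta> \<epsilon> \<and> is_kernel C k \<eta> \<and>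
      complementary C \<bbbone> (subobj_class C k) (sub_of (supp_idem a))"
    using dual k sub_of_split[OF u] up s by metis
next
  fix S
  assume "\<exists>b \<eta> \<epsilon> k. is_dual C a b \<eta> \<epsilon> \<and> is_kernel C k \<eta> \<and> complementary C \<bbbone> (subobj_class C k) S"
  then obtain b \<eta> \<epsilon> k i j p q where dual: "is_dual C a b \<eta> \<epsilon>" and k: "is_kernel C k \<eta>"
    and S: "S \<in> subobjects C \<bbbone>" "j \<in> S" and i: "i \<in> subobj_class C k"
    and bi: "biproduct C (src C i) (src C j) \<bbbone> i j p q"
    unfolding complementary_def by blast
  have ip: "unit_split i p" and jq: "unit_split j q" and sum: "i \<cdot> p \<boxplus> j \<cdot> q = idt C \<bbbone>"
    using bi by (auto simp: biproduct_def unit_split_def)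
  have "factors_through C i k" "factors_through C k i"
    using i by (auto simp: subobj_class_def)
  \<comment> \<open>The given biproduct supplies retractions of \<open>i\<close> and
    \<open>j\<close>, and its sum condition makes \<open>j \<cdot> q\<close> the complement of
    \<open>i \<cdot> p\<close>.\<close>
  then have "supp_idem a = j \<cdot> q"
    using supp_idem_of_kernel[OF dual k ip _ _ unit_split_idem[OF jq] sum] by blast
  then show "S = sub_of (supp_idem a)"
    using subobjects_class(2)[OF S] sub_of_split[OF jq] by simp
qed

section \<open>Ideals of idempotents, cofilters and Serre tensor ideals\<close>

text \<open>An ideal of the Boolean algebra of idempotents, where \<open>e \<cdot> f = f\<close>
  means \<open>f \<le> e\<close>. Closure under joins is expressed as directedness, so consumers get
  a common upper bound without the join formula.\<close>

definition idem_ideal :: "'b set \<Rightarrow> bool" where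
  "idem_ideal B \<longleftrightarrow> B \<subseteq> \<E> \<and> \<zero> \<in> B \<and> (\<forall>e\<in>B. \<forall>f\<in>\<E>. e \<cdot> f = f \<longrightarrow> f \<in> B) \<and>
     (\<forall>e\<in>B. \<forall>f\<in>B. \<exists>g\<in>B. g \<cdot> e = e \<and> g \<cdot> f = f)"

text \<open>\<open>e + f - e f\<close>, the Boolean join, written with the complement to avoid
  subtraction.\<close>

definition join :: "'b \<Rightarrow> 'b \<Rightarrow> 'b" where
  "join e f = e \<boxplus> f \<cdot> compl e"

lemma join:
  assumes e: "e \<in> \<E>" and f: "f \<in> \<E>"
  shows "join e f \<in> \<E>" "join e f \<cdot> e = e" "join e f \<cdot> f = f"
    "\<And>h. \<lbrakk>h \<in> \<Z>; h \<cdot> e = e; h \<cdot> f = f\<rbrakk> \<Longrightarrow> h \<cdot> join e f = join e f"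
proof -
  note [simp] = e f
  define g where "g = join e f"
  have g [simp]: "g \<in> arr C" "src C g = \<bbbone>" "tgt C g = \<bbbone>"
    by (simp_all add: g_def join_def)
  show ge: "join e f \<cdot> e = e"
    by (simp add: join_def plus_comp_simp)
  have "f \<cdot> compl e = compl e \<cdot> f"
    by (rule unit_end_commute) simp_all
  then have "join e f \<cdot> f = e \<cdot> f \<boxplus> compl e \<cdot> f"
    by (simp add: join_def plus_comp_simp)
  then show gf: "join e f \<cdot> f = f"
    using complementary_decomposition[of e "compl e" f] by simp
  show absorb: "h \<cdot> join e f = join e f" if "h \<in> \<Z>" "h \<cdot> e = e" "h \<cdot> f = f" for h
    using that comp_reduce[of h f f "compl e"] by (simp add: join_def comp_plus_simp)
  show "join e f \<in> \<E>"
    using absorb[of "join e f"] ge gf g unfolding g_def by (intro unit_idemI) simp_all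
qed

definition idems :: "'a set \<Rightarrow> 'b set" where
  "idems I = {e. \<exists>u p. unit_split u p \<and> u \<cdot> p = e \<and> src C u \<in> I}"

definition obj_ideal :: "'b set \<Rightarrow> 'a set" where
  "obj_ideal B = {a \<in> obj C. supp_idem a \<in> B}"

text \<open>For an \<open>idem_ideal\<close> this is the ideal of \<open>End(1)\<close> generated by
  \<open>B\<close>: by directedness a single idempotent of \<open>B\<close> fixes any finite sum of
  multiples of members of \<open>B\<close>.\<close>

definition generated :: "'b set \<Rightarrow> 'b set" where
  "generated B = {z \<in> \<Z>. \<exists>g\<in>B. g \<cdot> z = z}"

lemma cofilter_of_eq: "cofilter_of C I = sub_of ` idems I"
proof (intro equalityI subsetI)
  fix S
  assume "S \<in> cofilter_of C I"
  then obtain m where S: "S \<in> subobjects C \<bbbone>" "m \<in> S" "src C m \<in> I"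
    by (auto simp: cofilter_of_def)
  then have "mono_arr C m" "tgt C m = \<bbbone>"
    using subobjects_class(1) by (auto simp: monos_into_def)
  then obtain p where p: "unit_split m p"
    by (rule unit_split_exists)
  then show "S \<in> sub_of ` idems I"
    using sub_of_split[OF p] subobjects_class(2)[OF S(1,2)] S(3) by (auto simp: idems_def)
next
  fix S
  assume "S \<in> sub_of ` idems I"
  then obtain u p where u: "unit_split u p" "src C u \<in> I" "S = sub_of (u \<cdot> p)"
    by (auto simp: idems_def)
  then have "u \<in> S" "S \<in> subobjects C \<bbbone>"
    using sub_of_split[OF u(1)] unit_split_monos_into[OF u(1)] subobj_class_self
    by (auto simp: subobjects_def)
  then show "S \<in> cofilter_of C I"
    using u(2) by (auto simp: cofilter_of_def)
qed

lemma serre_ideal_of_eq: "serre_ideal_of C \<Phi> = obj_ideal {e \<in> \<E>. sub_of e \<in> \<Phi>}"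
  by (auto simp: serre_ideal_of_def obj_ideal_def Supp_eq)

text \<open>The idempotent of the image of \<open>z\<close> fixes \<open>z\<close>. Conversely, if
  \<open>e = u p\<close> fixes \<open>z\<close>, then \<open>1 - e\<close> kills \<open>z\<close>,
  so it factors through the cokernel and kills the image \<open>m\<close>; hence the source of
  \<open>m\<close> embeds into that of \<open>u\<close>.\<close>

lemma Z_ideal_of_eq:
  assumes serre: "serre_subcategory C I"
  shows "Z_ideal_of C I = generated (idems I)"
proof (intro equalityI subsetI)
  fix z
  assume "z \<in> Z_ideal_of C I"
  then obtain c m where z: "z \<in> \<Z>" and c: "is_cokernel C c z" and m: "is_kernel C m c" "src C m \<in> I"
    by (auto simp: Z_ideal_of_def is_image_def)
  have ms: "tgt C m = \<bbbone>" "src C c = \<bbbone>" "c \<cdot> z = zero_arr C \<bbbone> (tgt C c)"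
    using c m z by (auto simp: is_kernel_def is_cokernel_def)
  obtain p where p: "unit_split m p"
    by (rule unit_split_exists[OF kernel_mono[OF m(1)] ms(1)])
  obtain h where h: "h \<in> arr C" "src C h = \<bbbone>" "tgt C h = src C m" "m \<cdot> h = z"
    using kernel_factor[OF m(1), of z] ms z by auto
  have "(m \<cdot> p) \<cdot> (m \<cdot> h) = m \<cdot> h"
    using h(1-3) unit_split_simps[OF p] unit_split_comp[OF p] by simp
  then have "(m \<cdot> p) \<cdot> z = z"
    by (simp only: h(4))
  then show "z \<in> generated (idems I)"
    using z p m(2) by (auto simp: generated_def idems_def)
next
  fix z
  assume "z \<in> generated (idems I)"
  then obtain u p where z: "z \<in> \<Z>" and u: "unit_split u p" "src C u \<in> I" and uz: "(u \<cdot> p) \<cdot> z = z"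
    by (auto simp: generated_def idems_def)
  define e where "e = u \<cdot> p"
  have e [simp]: "e \<in> \<E>"
    unfolding e_def by (rule unit_split_idem[OF u(1)])
  note [simp] = unit_split_simps[OF u(1)] unit_split_comp[OF u(1)] z[simplified]
  obtain c where c: "is_cokernel C c z"
    using cokernel_exists[of z] by auto
  then obtain m where m: "is_kernel C m c"
    using kernel_exists[of c] by (auto simp: is_cokernel_def)
  have [simp]: "m \<in> arr C" "tgt C m = \<bbbone>" "c \<in> arr C" "src C c = \<bbbone>"
    and cm: "c \<cdot> m = zero_arr C (src C m) (tgt C c)"
    using c m by (auto simp: is_kernel_def is_cokernel_def)
  have "compl e \<cdot> z = \<zero>"
    using compl_zero_iff[of e z] uz by (simp flip: e_def)
  then obtain x where x: "x \<in> arr C" "src C x = tgt C c" "tgt C x = \<bbbone>" "x \<cdot> c = compl e"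
    using cokernel_factor[OF c, of "compl e"] by auto
  have "compl e \<cdot> m = x \<cdot> (c \<cdot> m)"
    using comp_assoc_simp[of m c x] x by simp
  then have "compl e \<cdot> m = zero_arr C (src C m) \<bbbone>"
    using x(1-3) by (simp add: cm)
  then have "e \<cdot> m = m"
    using compl_zero_iff[of e m] by simp
  then have "u \<cdot> (p \<cdot> m) = m"
    by (simp add: e_def)
  then have "mono_arr C (u \<cdot> (p \<cdot> m))"
    using kernel_mono[OF m] by simp
  then have "mono_arr C (p \<cdot> m)"
    by (rule mono_arr_cancel) simp_all
  then have "src C m \<in> I"
    using serre_mono[OF serre, of "p \<cdot> m"] u(2) by simp
  then show "z \<in> Z_ideal_of C I"
    using z c m by (auto simp: Z_ideal_of_def is_image_def)
qed

section \<open>Cofilters as ideals of idempotents\<close>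

lemma idem_idealD:
  assumes "idem_ideal B"
  shows "e \<in> B \<Longrightarrow> e \<in> \<E>" "\<zero> \<in> B" "\<lbrakk>e \<in> B; f \<in> \<E>; e \<cdot> f = f\<rbrakk> \<Longrightarrow> f \<in> B"
    "\<lbrakk>e \<in> B; f \<in> B\<rbrakk> \<Longrightarrow> \<exists>g\<in>B. g \<cdot> e = e \<and> g \<cdot> f = f"
  using assms by (auto simp: idem_ideal_def)

lemma idem_idealI:
  assumes "B \<subseteq> \<E>" "\<zero> \<in> B" "\<And>e f. \<lbrakk>e \<in> B; f \<in> \<E>; e \<cdot> f = f\<rbrakk> \<Longrightarrow> f \<in> B"
    and "\<And>e f. \<lbrakk>e \<in> B; f \<in> B\<rbrakk> \<Longrightarrow> join e f \<in> B"
  shows "idem_ideal B"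
  unfolding idem_ideal_def
proof (intro conjI ballI impI)
  fix e f
  assume ef: "e \<in> B" "f \<in> B"
  then have "e \<in> \<E>" "f \<in> \<E>"
    using assms(1) by blast+
  then show "\<exists>g\<in>B. g \<cdot> e = e \<and> g \<cdot> f = f"
    using assms(4)[OF ef] join(2,3) by blast
qed (use assms in blast)+

text \<open>A finite family has an upper bound in \<open>B\<close> by directedness. A sum is the
  least upper bound, so it lies below that one and belongs to \<open>B\<close> by downward
  closure.\<close>

lemma cofilter_idem_ideal:
  assumes B: "idem_ideal B"
  shows "cofilter C (sub_of ` B)"
  unfolding cofilter_def
proof (intro conjI allI impI ballI)
  show "sub_of ` B \<subseteq> subobjects C \<bbbone>"
    using idem_idealD(1)[OF B] by (auto simp: subobjects_unit)
next
  fix S w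
  assume S: "finite S" "S \<subseteq> sub_of ` B" and w: "is_subobj_sum C \<bbbone> S w"
  have "\<exists>g\<in>B. \<forall>s\<in>S. subobj_le C s (sub_of g)"
    using S
  proof (induction rule: finite_induct)
    case empty
    then show ?case
      using idem_idealD(2)[OF B] by blast
  next
    case (insert s S)
    then obtain g f where g: "g \<in> B" "\<forall>s\<in>S. subobj_le C s (sub_of g)" and f: "f \<in> B" "s = sub_of f"
      by auto
    obtain h where h: "h \<in> B" "h \<cdot> g = g" "h \<cdot> f = f"
      using idem_idealD(4)[OF B g(1) f(1)] by blast
    have "subobj_le C t (sub_of h)" if t: "t \<in> S" for t
    proof -
      obtain x where x: "x \<in> B" "t = sub_of x"
        using insert.prems t by auto
      have xgh: "x \<in> \<E>" "g \<in> \<E>" "h \<in> \<E>"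
        using x g h idem_idealD(1)[OF B] by blast+
      then have "g \<cdot> x = x"
        using g(2) t sub_of_le_iff[OF xgh(1,2)] x(2) by blast
      then have "h \<cdot> x = x"
        using comp_reduce[OF h(2), of x] xgh by simp
      then show ?thesis
        using sub_of_le_iff xgh x(2) by simp
    qed
    moreover have "subobj_le C s (sub_of h)"
      using sub_of_le_iff[of f h] f h idem_idealD(1)[OF B] by simp
    ultimately show ?case
      using h(1) by blast
  qed
  then obtain g where g: "g \<in> B" "\<forall>s\<in>S. subobj_le C s (sub_of g)"
    by blast
  have gE: "g \<in> \<E>"
    using g idem_idealD(1)[OF B] by blast
  then have "subobj_le C w (sub_of g)"
    using w g(2) by (auto simp: is_subobj_sum_def subobjects_unit)
  moreover obtain e where e: "e \<in> \<E>" "w = sub_of e"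
    using w by (auto simp: is_subobj_sum_def subobjects_unit)
  ultimately have "e \<in> B"
    using sub_of_le_iff[OF e(1) gE] idem_idealD(3)[OF B g(1) e(1)] by simp
  then show "w \<in> sub_of ` B"
    using e(2) by simp
next
  fix u v
  assume u: "u \<in> sub_of ` B" and v: "v \<in> subobjects C \<bbbone>" and vu: "subobj_le C v u"
  obtain e where e: "e \<in> B" "u = sub_of e"
    using u by blast
  obtain f where f: "f \<in> \<E>" "v = sub_of f"
    using v by (auto simp: subobjects_unit)
  have "f \<in> B"
    using vu sub_of_le_iff[of f e] idem_idealD(1)[OF B e(1)] idem_idealD(3)[OF B e(1) f(1)] e f by simp
  then show "v \<in> sub_of ` B"
    using f(2) by simp
qed

lemma idem_ideal_cofilter:
  assumes \<Phi>: "cofilter C \<Phi>"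
  shows "idem_ideal {e \<in> \<E>. sub_of e \<in> \<Phi>}" "sub_of ` {e \<in> \<E>. sub_of e \<in> \<Phi>} = \<Phi>"
proof -
  have sums: "w \<in> \<Phi>" if "finite S" "S \<subseteq> \<Phi>" "is_subobj_sum C \<bbbone> S w" for S w
    using \<Phi> that by (auto simp: cofilter_def)
  have down: "v \<in> \<Phi>" if "u \<in> \<Phi>" "v \<in> subobjects C \<bbbone>" "subobj_le C v u" for u v
    using \<Phi> that by (auto simp: cofilter_def)
  have sub: "sub_of e \<in> subobjects C \<bbbone>" if "e \<in> \<E>" for e
    using that by (simp add: subobjects_unit)
  \<comment> \<open>The empty sum is the zero subobject, which every cofilter therefore
    contains.\<close>
  have "is_subobj_sum C \<bbbone> {} (sub_of \<zero>)"
    using sub sub_of_le_iff[OF zero_idem] by (auto simp: is_subobj_sum_def subobjects_unit)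
  then have zero: "sub_of \<zero> \<in> \<Phi>"
    by (intro sums[of "{}"]) auto
  have "sub_of (join e f) \<in> \<Phi>" if ef: "e \<in> \<E>" "sub_of e \<in> \<Phi>" "f \<in> \<E>" "sub_of f \<in> \<Phi>" for e f
  proof (rule sums[of "{sub_of e, sub_of f}"])
    \<comment> \<open>The join is the least upper bound, hence represents the sum of the two
      subobjects.\<close>
    have "subobj_le C (sub_of (join e f)) (sub_of h)"
      if h: "h \<in> \<E>" "subobj_le C (sub_of e) (sub_of h)" "subobj_le C (sub_of f) (sub_of h)" for h
      using h join(1)[OF ef(1,3)] join(4)[OF ef(1,3) unit_idem_end[OF h(1)]] sub_of_le_iff ef by simp
    then show "is_subobj_sum C \<bbbone> {sub_of e, sub_of f} (sub_of (join e f))"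
      using join[OF ef(1,3)] sub sub_of_le_iff ef by (auto simp: is_subobj_sum_def subobjects_unit)
  qed (use ef in auto)
  moreover have "sub_of f \<in> \<Phi>" if "e \<in> \<E>" "sub_of e \<in> \<Phi>" "f \<in> \<E>" "e \<cdot> f = f" for e f
    using down[OF that(2) sub[OF that(3)]] sub_of_le_iff[OF that(3,1)] that(4) by blast
  ultimately show "idem_ideal {e \<in> \<E>. sub_of e \<in> \<Phi>}"
    using zero zero_idem join(1) by (intro idem_idealI) blast+
  show "sub_of ` {e \<in> \<E>. sub_of e \<in> \<Phi>} = \<Phi>"
    using \<Phi> by (auto simp: cofilter_def subobjects_unit)
qed

lemma idem_ideal_generated:
  assumes B: "idem_ideal B"
  shows "generated B \<inter> \<E> = B"
proof (intro equalityI subsetI)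
  show "e \<in> B" if "e \<in> generated B \<inter> \<E>" for e
    using that idem_idealD(3)[OF B] unfolding generated_def by blast
  show "e \<in> generated B \<inter> \<E>" if "e \<in> B" for e
    using that idem_idealD(1)[OF B that] unit_idem_end unit_idem_simps(4) unfolding generated_def by blast
qed

section \<open>Serre tensor ideals as ideals of idempotents\<close>

lemma idems_serre:
  assumes "serre_subcategory C I"
  shows "idem_ideal (idems I)"
proof -
  note serre = serre_obj[OF assms] serre_mono[OF assms] serre_zero_obj[OF assms] serre_biproduct[OF assms]
  have "idems I \<subseteq> \<E>"
    using unit_split_idem by (auto simp: idems_def)
  moreover have "\<zero> \<in> idems I"
  proof -
    obtain z where z: "zero_obj C z"
      using zero_obj_exists by blast
    then have [simp]: "z \<in> obj C"
      by (simp add: zero_obj_def)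
    \<comment> \<open>The zero idempotent splits through a zero object, whose identity is
      zero.\<close>
    have "zero_arr C z z = idt C z"
      by (rule zero_obj_hom[OF z]) simp_all
    then have "unit_split (zero_arr C z \<bbbone>) (zero_arr C \<bbbone> z)"
      by (simp add: unit_split_def)
    moreover have "zero_arr C z \<bbbone> \<cdot> zero_arr C \<bbbone> z = \<zero>" "src C (zero_arr C z \<bbbone>) \<in> I"
      using serre(3)[OF z] by simp_all
    ultimately show ?thesis
      unfolding idems_def by blast
  qed
  moreover have "f \<in> idems I" if e: "e \<in> idems I" and f: "f \<in> \<E>" and ef: "e \<cdot> f = f" for e f
  proof -
    obtain u p where u: "unit_split u p" "u \<cdot> p = e" "src C u \<in> I"
      using e by (auto simp: idems_def)
    obtain v q where v: "unit_split v q" "v \<cdot> q = f"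
      by (rule unit_idem_split[OF f])
    have "factors_through C v u"
      using unit_split_factors_iff[OF v(1) u(1)] u(2) v(2) ef by simp
    then obtain h where h: "h \<in> arr C" "src C h = src C v" "tgt C h = src C u" "v = u \<cdot> h"
      by (rule factors_throughE)
    have "mono_arr C (u \<cdot> h)"
      using unit_split_mono[OF v(1)] by (simp flip: h(4))
    then have "mono_arr C h"
      by (rule mono_arr_cancel) (use h(1,3) unit_split_simps[OF u(1)] in simp_all)
    then show ?thesis
      using serre(2)[of h] h u(3) v by (auto simp: idems_def)
  qed
  moreover have "join e f \<in> idems I" if ef: "e \<in> idems I" "f \<in> idems I" for e f
  proof -
    obtain u p where u: "unit_split u p" "u \<cdot> p = e" "src C u \<in> I"
      using ef(1) by (auto simp: idems_def)
    obtain v q where v: "unit_split v q" "v \<cdot> q = f" "src C v \<in> I"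
      using ef(2) by (auto simp: idems_def)
    have eE [simp]: "e \<in> \<E>" "f \<in> \<E>"
      using unit_split_idem u v by blast+
    define U V where "U = src C u" and "V = src C v"
    have UV: "U \<in> I" "V \<in> I"
      using u(3) v(3) by (simp_all add: U_def V_def)
    have [simp]: "U \<in> obj C" "V \<in> obj C" "src C u = U" "src C v = V"
      using UV serre(1) by (simp_all add: U_def V_def)
    obtain s i j a b where bi: "biproduct C U V s i j a b"
      using biproduct_exists[of U V] by auto
    have [simp]: "i \<in> arr C" "j \<in> arr C" "a \<in> arr C" "b \<in> arr C" "src C i = U" "tgt C i = s"
      "src C j = V" "tgt C j = s" "src C a = s" "tgt C a = U" "src C b = s" "tgt C b = V"
      "a \<cdot> i = idt C U" "b \<cdot> j = idt C V" "a \<cdot> j = zero_arr C V U" "b \<cdot> i = zero_arr C U V"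
      using bi by (auto simp: biproduct_def)
    note [simp] = unit_split_simps[OF u(1), folded U_def] unit_split_simps[OF v(1), folded V_def]
    \<comment> \<open>\<open>y\<close> is the map from the direct sum of \<open>U\<close> and
      \<open>V\<close> to the unit given by \<open>u\<close> and \<open>v\<close>; \<open>x\<close>
      is chosen so that \<open>y \<cdot> x\<close> is the join. The image of the join then embeds
      into the direct sum, a member of \<open>I\<close>.\<close>
    define x where "x = i \<cdot> p \<boxplus> j \<cdot> (q \<cdot> compl e)"
    define y where "y = u \<cdot> a \<boxplus> v \<cdot> b"
    have xy [simp]: "x \<in> arr C" "src C x = \<bbbone>" "tgt C x = s" "y \<in> arr C" "src C y = s" "tgt C y = \<bbbone>"
      by (simp_all add: x_def y_def)
    have yij: "y \<cdot> i = u" "y \<cdot> j = v"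
      by (simp_all add: y_def plus_comp_simp)
    have "y \<cdot> x = u \<cdot> p \<boxplus> v \<cdot> (q \<cdot> compl e)"
      by (simp add: x_def comp_plus_simp comp_reduce[OF yij(1)] comp_reduce[OF yij(2)])
    also have "\<dots> = join e f"
      by (simp add: join_def u(2) comp_reduce[OF v(2)])
    finally have yx: "y \<cdot> x = join e f" .
    obtain w r where w: "unit_split w r" "w \<cdot> r = join e f"
      using unit_idem_split[OF join(1)[OF eE]] by blast
    note [simp] = unit_split_simps[OF w(1)] unit_split_comp[OF w(1)]
    have "(r \<cdot> y) \<cdot> (x \<cdot> w) = r \<cdot> ((y \<cdot> x) \<cdot> w)"
      by simp
    also have "\<dots> = r \<cdot> ((w \<cdot> r) \<cdot> w)"
      by (simp only: yx w(2))
    finally have "mono_arr C (x \<cdot> w)"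
      by (intro mono_arr_retract[of "r \<cdot> y"]) simp_all
    moreover have "s \<in> I"
      by (rule serre(4)[OF bi UV])
    ultimately have "src C w \<in> I"
      using serre(2)[of "x \<cdot> w"] by simp
    then show ?thesis
      using w by (auto simp: idems_def)
  qed
  ultimately show ?thesis
    by (intro idem_idealI) blast+
qed

text \<open>An object \<open>a\<close> and the subobject \<open>U\<close> of \<open>\<bbbone>\<close> cut out by its support idempotent generate the
  same Serre tensor ideal: \<open>a\<close> is a retract of \<open>a \<otimes> U\<close>, and \<open>U\<close> embeds into \<open>a\<^sup>* \<otimes> a\<close>.\<close>

lemma obj_ideal_idems:
  assumes I: "serre_tensor_ideal C I"
  shows "obj_ideal (idems I) = I"
proof -
  have serre: "serre_subcategory C I" and tens: "\<And>a b. a \<in> obj C \<Longrightarrow> b \<in> I \<Longrightarrow> a \<otimes>\<^sub>o b \<in> I"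
    using I by (auto simp: serre_tensor_ideal_def)
  have "a \<in> I" if a: "a \<in> obj C" and s: "supp_idem a \<in> idems I" for a
  proof -
    obtain u p where u: "unit_split u p" "u \<cdot> p = supp_idem a" "src C u \<in> I"
      using s by (auto simp: idems_def)
    note [simp] = a unit_split_simps[OF u(1)]
    let ?s = "supp_idem a"
    have "act (compl ?s) a = zero_arr C a a"
      using supp_le_iff[of a ?s] by simp
    then have "idt C a \<otimes>\<^sub>a compl ?s = zero_arr C (a \<otimes>\<^sub>o \<bbbone>) (a \<otimes>\<^sub>o \<bbbone>)"
      using act_zero_iff[of "compl ?s" a] by simp
    \<comment> \<open>Of the two summands the second vanishes, so the first is the identity; writing
      the support idempotent as \<open>u p\<close> then makes \<open>a\<close> a retract.\<close>
    moreover have "idt C a \<otimes>\<^sub>a (?s \<boxplus> compl ?s) = (idt C a \<otimes>\<^sub>a ?s) \<boxplus> (idt C a \<otimes>\<^sub>a compl ?s)"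
      by (rule tens_plus_arr) simp_all
    ultimately have "idt C a \<otimes>\<^sub>a ?s = idt C (a \<otimes>\<^sub>o \<bbbone>)"
      by simp
    then have "(idt C a \<otimes>\<^sub>a u) \<cdot> (idt C a \<otimes>\<^sub>a p) = idt C (a \<otimes>\<^sub>o \<bbbone>)"
      by (simp add: tens_comp u(2))
    then have "mono_arr C (idt C a \<otimes>\<^sub>a p)"
      by (intro mono_arr_retract[of "idt C a \<otimes>\<^sub>a u"]) simp_all
    then have "mono_arr C ((idt C a \<otimes>\<^sub>a p) \<cdot> inv_arr C (runit C a))"
      by (rule mono_arr_comp[OF _ iso_arr_mono]) simp_all
    then show "a \<in> I"
      using serre_mono[OF serre, of "(idt C a \<otimes>\<^sub>a p) \<cdot> inv_arr C (runit C a)"] tens[OF a u(3)] by simp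
  qed
  moreover have "supp_idem a \<in> idems I" if aI: "a \<in> I" for a
  proof -
    have a: "a \<in> obj C"
      by (rule serre_obj[OF serre aI])
    obtain b \<eta> \<epsilon> k r where dual: "is_dual C a b \<eta> \<epsilon>" and k: "is_kernel C k \<eta>" and r: "unit_split k r"
      and s: "supp_idem a = compl (k \<cdot> r)"
      by (rule supp_kernel_exists[OF a])
    obtain u p where u: "unit_split u p" "u \<cdot> p = supp_idem a"
      by (rule unit_idem_split[OF supp_idem[OF a]])
    note [simp] = dual_simps[OF dual] unit_split_idem[OF r] unit_split_simps[OF r] unit_split_comp[OF r]
      unit_split_simps[OF u(1)] unit_split_comp[OF u(1)]
    have "mono_arr C (\<eta> \<cdot> u)"
    proof (rule mono_arrI_zero)
      fix f
      assume f: "f \<in> arr C" "tgt C f = src C (\<eta> \<cdot> u)" "(\<eta> \<cdot> u) \<cdot> f = zero_arr C (src C f) (tgt C (\<eta> \<cdot> u))"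
      then obtain h where h: "h \<in> arr C" "src C h = src C f" "tgt C h = src C k" "k \<cdot> h = u \<cdot> f"
        using kernel_factor[OF k, of "u \<cdot> f"] by auto
      \<comment> \<open>\<open>u f\<close> factors through the kernel \<open>k\<close> of \<eta>,
        and \<open>u p\<close> is the complement of \<open>k r\<close>, so \<eta> is monic on the
        image of \<open>u\<close>.\<close>
      have "f = p \<cdot> ((u \<cdot> p) \<cdot> (u \<cdot> f))"
        using f by simp
      also have "\<dots> = p \<cdot> ((compl (k \<cdot> r) \<cdot> ((k \<cdot> r) \<cdot> k)) \<cdot> h)"
        unfolding u(2) s using h by simp
      also have "\<dots> = p \<cdot> (((compl (k \<cdot> r) \<cdot> (k \<cdot> r)) \<cdot> k) \<cdot> h)"
        using h by (simp del: compl(4))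
      also have "\<dots> = zero_arr C (src C f) (src C u)"
        unfolding compl(4)[OF unit_split_idem[OF r]] using h f(1) by simp
      finally show "f = zero_arr C (src C f) (src C (\<eta> \<cdot> u))"
        by simp
    qed simp
    then have "src C u \<in> I"
      using serre_mono[OF serre, of "\<eta> \<cdot> u"] tens[of b a] aI by simp
    then show ?thesis
      using u by (auto simp: idems_def)
  qed
  ultimately show ?thesis
    using serre_obj[OF serre] by (auto simp: obj_ideal_def)
qed

text \<open>Subobjects, quotients and tensor multiples have larger annihilators, hence smaller
  supports. For an extension, an upper bound in \<open>B\<close> of the two outer supports also
  bounds the middle one.\<close>

lemma obj_ideal_serre:
  assumes B: "idem_ideal B"
  shows "serre_tensor_ideal C (obj_ideal B)"
proof -
  have le: "supp_idem a \<in> B"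
    if "a \<in> obj C" "b \<in> obj C" "supp_idem b \<in> B"
      "\<And>z. z \<in> \<Z> \<Longrightarrow> act z b = zero_arr C b b \<Longrightarrow> act z a = zero_arr C a a" for a b
    using idem_idealD(3)[OF B that(3) supp_idem[OF that(1)]] supp_le_of_act[OF that(1,2,4)] by blast
  have "obj_ideal B \<noteq> {}"
  proof -
    obtain z where z: "zero_obj C z"
      using zero_obj_exists by blast
    then have [simp]: "z \<in> obj C"
      by (simp add: zero_obj_def)
    have "act x z = zero_arr C z z" if "x \<in> \<Z>" for x
      by (rule zero_obj_hom[OF z]) (use that in simp_all)
    then have "supp_idem z = \<zero>"
      by (intro supp_idem_eqI) auto
    then have "z \<in> obj_ideal B"
      using idem_idealD(2)[OF B] by (simp add: obj_ideal_def)
    then show ?thesis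
      by blast
  qed
  moreover have "src C g \<in> obj_ideal B \<longleftrightarrow> src C f \<in> obj_ideal B \<and> tgt C g \<in> obj_ideal B"
    if ex: "short_exact C f g" for f g
  proof -
    have k: "is_kernel C f g" and c: "is_cokernel C g f"
      using ex by (auto simp: short_exact_def)
    have fg: "f \<in> arr C" "g \<in> arr C" "tgt C f = src C g"
      using k by (auto simp: is_kernel_def)
    define a b c where "a = src C f" and "b = src C g" and "c = tgt C g"
    have obj: "a \<in> obj C" "b \<in> obj C" "c \<in> obj C"
      using fg by (simp_all add: a_def b_def c_def)
    have "supp_idem a \<in> B" "supp_idem c \<in> B" if "supp_idem b \<in> B"
      using le[OF obj(1,2) that] le[OF obj(3,2) that] act_zero_mono[OF _ kernel_mono[OF k]]
        act_zero_cokernel[OF _ \<open>is_cokernel C g f\<close>] fg(3)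
      by (simp_all add: a_def b_def c_def)
    moreover have "supp_idem b \<in> B" if ac: "supp_idem a \<in> B" "supp_idem c \<in> B"
    proof -
      obtain e where e: "e \<in> B" "e \<cdot> supp_idem a = supp_idem a" "e \<cdot> supp_idem c = supp_idem c"
        using idem_idealD(4)[OF B ac] by blast
      have eE: "e \<in> \<E>"
        by (rule idem_idealD(1)[OF B e(1)])
      \<comment> \<open>The complement of the common bound annihilates both ends, and being
        idempotent it annihilates the extension.\<close>
      have "act (compl e) a = zero_arr C a a" "act (compl e) c = zero_arr C c c"
        using e supp_le_iff[OF _ eE] obj by simp_all
      then have "act (compl e) b = zero_arr C b b"
        using act_idem_zero_ext[OF compl(1)[OF eE] ex] by (simp add: a_def b_def c_def)
      then show ?thesis
        using supp_le_iff[OF obj(2) eE] idem_idealD(3)[OF B e(1) supp_idem[OF obj(2)]] by blast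
    qed
    ultimately show ?thesis
      using obj by (auto simp: obj_ideal_def a_def b_def c_def)
  qed
  moreover have "a \<otimes>\<^sub>o b \<in> obj_ideal B" if "a \<in> obj C" "b \<in> obj_ideal B" for a b
  proof -
    have b: "b \<in> obj C" "supp_idem b \<in> B"
      using that(2) by (auto simp: obj_ideal_def)
    have "supp_idem (a \<otimes>\<^sub>o b) \<in> B"
      using that(1) b by (intro le[of "a \<otimes>\<^sub>o b" b] act_zero_tens) simp_all
    then show ?thesis
      using that(1) b(1) by (simp add: obj_ideal_def)
  qed
  ultimately show ?thesis
    by (auto simp: serre_tensor_ideal_def serre_subcategory_def obj_ideal_def)
qed

lemma idems_obj_ideal:
  assumes B: "idem_ideal B"
  shows "idems (obj_ideal B) = B"
proof (intro equalityI subsetI)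
  fix e
  assume "e \<in> idems (obj_ideal B)"
  then show "e \<in> B"
    using supp_idem_split by (auto simp: idems_def obj_ideal_def)
next
  fix e
  assume e: "e \<in> B"
  obtain u p where u: "unit_split u p" "u \<cdot> p = e"
    by (rule unit_idem_split[OF idem_idealD(1)[OF B e]])
  have "src C u \<in> obj_ideal B"
    using supp_idem_split[OF u(1)] u e unit_split_simps(1)[OF u(1)] by (simp add: obj_ideal_def)
  then show "e \<in> idems (obj_ideal B)"
    using u by (auto simp: idems_def)
qed

section \<open>Ideals of the ring \<open>End(1)\<close>\<close>

lemma generated_ideal:
  assumes B: "idem_ideal B"
  shows "ideal (generated B) (end_ring C \<bbbone>)"
proof -
  let ?R = "end_ring C \<bbbone>"
  interpret ring ?R
    by (rule end_ring_ring) simp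
  have R [simp]: "carrier ?R = \<Z>" "x \<otimes>\<^bsub>?R\<^esub> y = x \<cdot> y" "x \<oplus>\<^bsub>?R\<^esub> y = x \<boxplus> y" "\<zero>\<^bsub>?R\<^esub> = \<zero>" for x y
    by (simp_all add: end_ring_def)
  have B_Z: "g \<in> \<Z>" if "g \<in> B" for g
    using idem_idealD(1)[OF B that] by (rule unit_idem_end)
  show ?thesis
  proof (rule idealI)
    show "ring ?R"
      by (rule ring_axioms)
    show "subgroup (generated B) (add_monoid ?R)"
    proof (rule add.subgroupI)
      show "generated B \<subseteq> carrier ?R"
        by (auto simp: generated_def)
      show "generated B \<noteq> {}"
        using idem_idealD(2)[OF B] by (auto simp: generated_def intro!: exI[of _ \<zero>] bexI[of _ \<zero>])
      fix x
      assume "x \<in> generated B"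
      then obtain g where x: "x \<in> \<Z>" and g: "g \<in> B" "g \<cdot> x = x"
        by (auto simp: generated_def)
      have "\<ominus>\<^bsub>?R\<^esub> x \<in> \<Z>"
        using a_inv_closed[of x] x by simp
      moreover have "g \<cdot> (\<ominus>\<^bsub>?R\<^esub> x) = \<ominus>\<^bsub>?R\<^esub> x"
        using r_minus[of g x] x g B_Z[of g] by simp
      ultimately show "\<ominus>\<^bsub>?R\<^esub> x \<in> generated B"
        using g(1) by (auto simp: generated_def)
      fix y
      assume "y \<in> generated B"
      then obtain h where y: "y \<in> \<Z>" and h: "h \<in> B" "h \<cdot> y = y"
        by (auto simp: generated_def)
      \<comment> \<open>A single idempotent above \<open>g\<close> and \<open>h\<close> fixes both
        \<open>x\<close> and \<open>y\<close>, hence their sum.\<close>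
      obtain e where e: "e \<in> B" "e \<cdot> g = g" "e \<cdot> h = h"
        using idem_idealD(4)[OF B g(1) h(1)] by blast
      note [simp] = x[simplified] y[simplified] B_Z[OF g(1), simplified] B_Z[OF h(1), simplified]
        B_Z[OF e(1), simplified]
      have "e \<cdot> x = x" "e \<cdot> y = y"
        using comp_reduce[OF e(2), of x] comp_reduce[OF e(3), of y] g(2) h(2) by simp_all
      then have "e \<cdot> (x \<boxplus> y) = x \<boxplus> y"
        by (simp add: comp_plus_simp)
      then show "x \<oplus>\<^bsub>?R\<^esub> y \<in> generated B"
        using e(1) by (auto simp: generated_def)
    qed
  next
    fix z x
    assume "z \<in> generated B" and "x \<in> carrier ?R"
    then obtain g where z: "z \<in> \<Z>" and x: "x \<in> \<Z>" and g: "g \<in> B" "g \<cdot> z = z"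
      by (auto simp: generated_def)
    have "g \<cdot> (z \<cdot> x) = z \<cdot> x"
      using comp_reduce[OF g(2), of x] x z B_Z[OF g(1)] by simp
    then show "z \<otimes>\<^bsub>?R\<^esub> x \<in> generated B"
      using g(1) x z by (auto simp: generated_def)
    then show "x \<otimes>\<^bsub>?R\<^esub> z \<in> generated B"
      using unit_end_commute[OF x z] by simp
  qed
qed

text \<open>By regularity each \<open>z\<close> in \<open>J\<close> satisfies \<open>z = g z\<close>
  for an idempotent \<open>g = z w\<close>, which again lies in \<open>J\<close>. So
  \<open>J\<close> is generated by its idempotents.\<close>

lemma ideal_idem_ideal:
  assumes J: "ideal J (end_ring C \<bbbone>)"
  shows "idem_ideal (J \<inter> \<E>)" "generated (J \<inter> \<E>) = J"
proof -
  let ?R = "end_ring C \<bbbone>"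
  interpret ideal J ?R
    by (rule J)
  have R: "carrier ?R = \<Z>" "x \<otimes>\<^bsub>?R\<^esub> y = x \<cdot> y" "x \<oplus>\<^bsub>?R\<^esub> y = x \<boxplus> y" "\<zero>\<^bsub>?R\<^esub> = \<zero>" for x y
    by (simp_all add: end_ring_def)
  have J_mult: "x \<cdot> y \<in> J" if "x \<in> J" "y \<in> \<Z>" for x y
    using I_r_closed[of x y] that by (simp only: R)
  have J_plus: "x \<boxplus> y \<in> J" if "x \<in> J" "y \<in> J" for x y
    using additive_subgroup.a_closed[OF additive_subgroup_axioms that] by (simp only: R)
  have J_zero: "\<zero> \<in> J"
    using additive_subgroup.zero_closed[OF additive_subgroup_axioms] by (simp only: R)
  have J_Z: "x \<in> \<Z>" if "x \<in> J" for x
    using a_Hcarr[OF that] by (simp only: R)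
  have "join e f \<in> J" if "e \<in> J \<inter> \<E>" "f \<in> J \<inter> \<E>" for e f
    unfolding join_def using that by (intro J_plus J_mult unit_idem_end compl(1)) blast+
  moreover have "f \<in> J \<inter> \<E>" if "e \<in> J \<inter> \<E>" "f \<in> \<E>" "e \<cdot> f = f" for e f
    using J_mult[of e f] unit_idem_end[OF that(2)] that by simp
  ultimately show "idem_ideal (J \<inter> \<E>)"
    using J_zero join(1) by (intro idem_idealI) simp_all
  have "z \<in> generated (J \<inter> \<E>)" if z: "z \<in> J" for z
  proof -
    obtain g w where "g \<in> \<E>" "w \<in> \<Z>" "g = z \<cdot> w" "g \<cdot> z = z"
      by (rule unit_end_regular[OF J_Z[OF z]])
    then show ?thesis
      using J_mult[OF z] J_Z[OF z] unfolding generated_def by blast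
  qed
  moreover have "z \<in> J" if "z \<in> generated (J \<inter> \<E>)" for z
    using that J_mult unfolding generated_def by fastforce
  ultimately show "generated (J \<inter> \<E>) = J"
    by blast
qed

text \<open>Each of the three structures is matched with ideals of idempotents: \<open>idems\<close>
  and \<open>obj_ideal\<close> for Serre tensor ideals, image and preimage under
  \<open>sub_of\<close> for cofilters, \<open>generated\<close> and intersection with \<E> for ring
  ideals.\<close>

theorem serre_tensor_ideal_correspondence:
  shows "bij_betw (cofilter_of C) {I. serre_tensor_ideal C I} {\<Phi>. cofilter C \<Phi>} \<and>
         bij_betw (serre_ideal_of C) {\<Phi>. cofilter C \<Phi>} {I. serre_tensor_ideal C I} \<and>
         (\<forall>I. serre_tensor_ideal C I \<longrightarrow> serre_ideal_of C (cofilter_of C I) = I) \<and>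
         (\<forall>\<Phi>. cofilter C \<Phi> \<longrightarrow> cofilter_of C (serre_ideal_of C \<Phi>) = \<Phi>) \<and>
         bij_betw (Z_ideal_of C) {I. serre_tensor_ideal C I} {J. ideal J (Z_ring C)}"
proof -
  have serre: "serre_subcategory C I" if "serre_tensor_ideal C I" for I
    using that by (simp add: serre_tensor_ideal_def)
  have idems: "idem_ideal (idems I)" if "serre_tensor_ideal C I" for I
    using idems_serre[OF serre[OF that]] .
  \<comment> \<open>Injectivity of \<open>sub_of\<close> makes preimage undo image.\<close>
  have preimage: "{e \<in> \<E>. sub_of e \<in> sub_of ` B} = B" if "idem_ideal B" for B
  proof -
    have B: "B \<subseteq> \<E>"
      using that by (simp add: idem_ideal_def)
    have "sub_of e \<in> sub_of ` B \<longleftrightarrow> e \<in> B" if "e \<in> \<E>" for e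
      by (rule inj_on_image_mem_iff[OF sub_of_inj that B])
    then show ?thesis
      using B by blast
  qed
  have cofilter: "cofilter C (cofilter_of C I)" if "serre_tensor_ideal C I" for I
    using cofilter_idem_ideal[OF idems[OF that]] by (simp add: cofilter_of_eq)
  have ideal: "serre_tensor_ideal C (serre_ideal_of C \<Phi>)" if "cofilter C \<Phi>" for \<Phi>
    using obj_ideal_serre[OF idem_ideal_cofilter(1)[OF that]] by (simp add: serre_ideal_of_eq)
  have inverse1: "serre_ideal_of C (cofilter_of C I) = I" if "serre_tensor_ideal C I" for I
    using preimage[OF idems[OF that]] obj_ideal_idems[OF that] by (simp add: serre_ideal_of_eq cofilter_of_eq)
  have inverse2: "cofilter_of C (serre_ideal_of C \<Phi>) = \<Phi>" if "cofilter C \<Phi>" for \<Phi>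
    using idem_ideal_cofilter(2)[OF that] idems_obj_ideal[OF idem_ideal_cofilter(1)[OF that]]
    by (simp add: serre_ideal_of_eq cofilter_of_eq)
  have Z: "Z_ideal_of C I = generated (idems I)" if "serre_tensor_ideal C I" for I
    using Z_ideal_of_eq[OF serre[OF that]] .
  have "bij_betw (cofilter_of C) {I. serre_tensor_ideal C I} {\<Phi>. cofilter C \<Phi>}"
    using cofilter ideal inverse1 inverse2 by (intro bij_betw_byWitness[of _ "serre_ideal_of C"]) auto
  moreover have "bij_betw (serre_ideal_of C) {\<Phi>. cofilter C \<Phi>} {I. serre_tensor_ideal C I}"
    using cofilter ideal inverse1 inverse2 by (intro bij_betw_byWitness[of _ "cofilter_of C"]) auto
  moreover have "bij_betw (Z_ideal_of C) {I. serre_tensor_ideal C I} {J. ideal J (Z_ring C)}"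
  \<comment> \<open>The inverse sends \<open>J\<close> to the objects whose support idempotent lies
    in \<open>J\<close>.\<close>
  proof (rule bij_betw_byWitness[of _ "\<lambda>J. obj_ideal (J \<inter> \<E>)"])
    show "\<forall>I\<in>{I. serre_tensor_ideal C I}. obj_ideal (Z_ideal_of C I \<inter> \<E>) = I"
      using Z idem_ideal_generated[OF idems] obj_ideal_idems by simp
    show "\<forall>J\<in>{J. ideal J (Z_ring C)}. Z_ideal_of C (obj_ideal (J \<inter> \<E>)) = J"
      using Z[OF obj_ideal_serre] idems_obj_ideal ideal_idem_ideal by simp
    show "Z_ideal_of C ` {I. serre_tensor_ideal C I} \<subseteq> {J. ideal J (Z_ring C)}"
      using Z generated_ideal[OF idems] by auto
    show "(\<lambda>J. obj_ideal (J \<inter> \<E>)) ` {J. ideal J (Z_ring C)} \<subseteq> {I. serre_tensor_ideal C I}"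
      using obj_ideal_serre ideal_idem_ideal(1) by auto
  qed
  ultimately show ?thesis
    using inverse1 inverse2 by blast
qed

end

theorem theorem4p18:
  fixes A :: "('o, 'm, 'x) tensor_cat_scheme"
  assumes "rigid_abelian_tensor_category A"
  shows "bij_betw (cofilter_of A) {I. serre_tensor_ideal A I} {\<Phi>. cofilter A \<Phi>} \<and>
         bij_betw (serre_ideal_of A) {\<Phi>. cofilter A \<Phi>} {I. serre_tensor_ideal A I} \<and>
         (\<forall>I. serre_tensor_ideal A I \<longrightarrow> serre_ideal_of A (cofilter_of A I) = I) \<and>
         (\<forall>\<Phi>. cofilter A \<Phi> \<longrightarrow> cofilter_of A (serre_ideal_of A \<Phi>) = \<Phi>) \<and>
         bij_betw (Z_ideal_of A) {I. serre_tensor_ideal A I} {J. ideal J (Z_ring A)}"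
  by (rule rigid_abelian_tensor_category.serre_tensor_ideal_correspondence[OF assms])

end
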